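(* Let $L$ be a self-adjoint positive definite operator in a Hilbert space $\mathcal{H}$, and for $m\geq 0$ let $\mathcal{H}^{m}$ be the domain of $L^{m/2}$. Assume that there exist $C>0$ and $m_0\ge 0$ such that for any $0<\rho<1$ there exists a set of linear functionals $\mathcal{A}^{(\rho)}=\{\mathcal{A}^{(\rho)}_k\}_k$, defined on $\mathcal{H}^{m_0}$, for which $$\|f\|^{2}\le C\left(\sum_{k}|\mathcal{A}^{(\rho)}_k(f)|^{2}+\rho^{2m}\|L^{m/2}f\|^{2}\right),\qquad f\in\mathcal{H}^{m},\ m>m_0,$$ and $$\sum_{k}|\mathcal{A}^{(\rho)}_k(f)|^{2}\le C\|f\|^{2},\qquad f\in\mathcal{H}^{m},\ m>m_0 .$$ Fix $m>m_0$ and $\delta\in(0,1)$. Let $\{\Phi^{j}_k\}_{j\ge 0,\,k}$ be the family of Paley-Wiener vectors built from these functionals as described in the context. Then for $\alpha>0$ and $1\le q\le\infty$ the norm of the Besov space $\mathcal{B}^{\alpha}_{\mathcal{H},q}(\sqrt{L})$ is equivalent to $$\left(\sum_{j=0}^{\infty}2^{j\alpha q}\left(\sum_{k}\left|\langle f,\Phi^{j}_{k}\rangle\right|^{2}\right)^{q/2}\right)^{1/q},$$ with the standard modifications for $q=\infty$.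
   Context: "Positive definite" is meant in the sense $\langle Lf,f\rangle\ge 0$; $\sqrt{L}$ is the non-negative square root. For bounded measurable $F$ on $[0,\infty)$, $F(\sqrt{L})$ is defined by the spectral theorem. For $\omega>0$, $\mathbf{PW}_{\omega}(\sqrt{L})$ is the range of the spectral projection $\mathcal{P}_{\omega}$ of $\sqrt{L}$ corresponding to $[0,\omega]$. Construction of $\Phi^j_k$. Let $g\in C^\infty(\mathbb{R}_+)$ be non-increasing with $\operatorname{supp} g\subset[0,2]$, $g(\lambda)=1$ on $[0,1]$, $0\le g\le 1$; put $h(\lambda)=g(\lambda)-g(2\lambda)$, $F_0(\lambda)=\sqrt{g(\lambda)}$, $F_j(\lambda)=\sqrt{h(2^{-j}\lambda)}$ for $j\ge 1$, so that $\sum_{j\ge0}F_j^2(\lambda)=1$ for $\lambda\ge0$. For each $j\ge 0$ let $\omega_j=2^{j+1}$ and let $\rho_j$ be given by $\rho_j^{2m}=C^{-1}\omega_j^{-2m}\delta$. Let $\mu^{j}_k\in\mathcal{H}$ be the vectors with $\langle f,\mu^{j}_k\rangle=\mathcal{A}^{(\rho_j)}_k(f)$ for $f\in\mathcal{H}^m$, put $\phi^{j}_k=\mathcal{P}_{\omega_j}\mu^{j}_k$, and $\Phi^{j}_k=F_j(\sqrt{L})\phi^{j}_k$. For $r\in\mathbb{N}$, $H^{r}$ is the domain of $(I+L)^{r/2}$ with the graph norm, and $\mathcal{B}^{\alpha}_{\mathcal{H},q}(\sqrt{L})=(\mathcal{H},H^{r})^{K}_{\alpha/r,q}$ (Peetre's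 real interpolation $K$-method), where $r$ is any natural number with $0<\alpha<r$. Equivalence of norms means two-sided estimates with positive constants independent of $f\in\mathcal{H}$ (both sides being allowed to be $+\infty$). *)

theory Defs
  imports "HOL-Analysis.Analysis"
begin

section \<open>Complex Hilbert spaces\<close>

class complex_inner = real_normed_vector +
  fixes scaleC :: "complex \<Rightarrow> 'a \<Rightarrow> 'a"  (infixr "*\<^sub>C" 75)
    and cinner :: "'a \<Rightarrow> 'a \<Rightarrow> complex"
  assumes scaleC_add_right: "c *\<^sub>C (x + y) = c *\<^sub>C x + c *\<^sub>C y"
    and scaleC_add_left: "(c + d) *\<^sub>C x = c *\<^sub>C x + d *\<^sub>C x"
    and scaleC_scaleC: "c *\<^sub>C d *\<^sub>C x = (c * d) *\<^sub>C x"
    and scaleC_of_real: "complex_of_real a *\<^sub>C x = a *\<^sub>R x"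
    and cinner_commute: "cinner x y = cnj (cinner y x)"
    and cinner_add_left: "cinner (x + y) z = cinner x z + cinner y z"
    and cinner_scaleC_left: "cinner (c *\<^sub>C x) y = c * cinner x y"
    and norm_eq_sqrt_cinner: "norm x = sqrt (Re (cinner x x))"

class complex_hilbert_space = complex_inner + complete_space


section \<open>Unbounded operators\<close>

text \<open>An operator is a domain together with a map; the values of the map off the domain
  carry no meaning, so equality of operators is \<open>op_eq\<close>.\<close>

type_synonym 'h unbounded_op = "'h set \<times> ('h \<Rightarrow> 'h)"

abbreviation dom_op :: "'h unbounded_op \<Rightarrow> 'h set" where
  "dom_op \<equiv> fst"

abbreviation app_op :: "'h unbounded_op \<Rightarrow> 'h \<Rightarrow> 'h" where
  "app_op \<equiv> snd"

definition op_eq :: "'h unbounded_op \<Rightarrow> 'h unbounded_op \<Rightarrow> bool" where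
  "op_eq S T \<longleftrightarrow> dom_op S = dom_op T \<and> (\<forall>f\<in>dom_op S. app_op S f = app_op T f)"

definition csubspace :: "'h::complex_inner set \<Rightarrow> bool" where
  "csubspace V \<longleftrightarrow> 0 \<in> V \<and> (\<forall>f\<in>V. \<forall>g\<in>V. f + g \<in> V) \<and> (\<forall>c. \<forall>f\<in>V. c *\<^sub>C f \<in> V)"

definition linear_op :: "'h::complex_inner unbounded_op \<Rightarrow> bool" where
  "linear_op T \<longleftrightarrow> csubspace (dom_op T)
     \<and> (\<forall>f\<in>dom_op T. \<forall>g\<in>dom_op T. app_op T (f + g) = app_op T f + app_op T g)
     \<and> (\<forall>c. \<forall>f\<in>dom_op T. app_op T (c *\<^sub>C f) = c *\<^sub>C app_op T f)"

definition adjoint_op :: "'h::complex_inner unbounded_op \<Rightarrow> 'h unbounded_op" where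
  "adjoint_op T =
     ({g. \<exists>z. \<forall>f\<in>dom_op T. cinner (app_op T f) g = cinner f z},
      \<lambda>g. THE z. \<forall>f\<in>dom_op T. cinner (app_op T f) g = cinner f z)"

definition self_adjoint_op :: "'h::complex_inner unbounded_op \<Rightarrow> bool" where
  "self_adjoint_op T \<longleftrightarrow>
     linear_op T \<and> closure (dom_op T) = UNIV \<and> op_eq (adjoint_op T) T"

definition positive_op :: "'h::complex_inner unbounded_op \<Rightarrow> bool" where
  "positive_op T \<longleftrightarrow> (\<forall>f\<in>dom_op T. cinner (app_op T f) f \<in> \<real>\<^sub>\<ge>\<^sub>0)"

definition linear_functional_on :: "'h::complex_inner set \<Rightarrow> ('h \<Rightarrow> complex) \<Rightarrow> bool" where
  "linear_functional_on V A \<longleftrightarrow>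
     (\<forall>f\<in>V. \<forall>g\<in>V. A (f + g) = A f + A g) \<and> (\<forall>c. \<forall>f\<in>V. A (c *\<^sub>C f) = c * A f)"


section \<open>Spectral measures and functional calculus\<close>

definition projection_valued_measure :: "(real set \<Rightarrow> 'h::complex_inner \<Rightarrow> 'h) \<Rightarrow> bool" where
  "projection_valued_measure E \<longleftrightarrow>
     (\<forall>S\<in>sets borel.
        linear_op (UNIV, E S) \<and>
        (\<forall>f. E S (E S f) = E S f) \<and>
        (\<forall>f g. cinner (E S f) g = cinner f (E S g))) \<and>
     (\<forall>f. E {} f = 0) \<and>
     (\<forall>f. E UNIV f = f) \<and>
     (\<forall>S\<in>sets borel. \<forall>T\<in>sets borel. \<forall>f. E (S \<inter> T) f = E S (E T f)) \<and>
     (\<forall>S :: nat \<Rightarrow> real set. range S \<subseteq> sets borel \<longrightarrow> disjoint_family S \<longrightarrow>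
        (\<forall>f. (\<lambda>n. E (S n) f) sums E (\<Union>n. S n) f))"

definition scalar_measure :: "(real set \<Rightarrow> 'h::complex_inner \<Rightarrow> 'h) \<Rightarrow> 'h \<Rightarrow> real measure" where
  "scalar_measure E f =
     measure_of UNIV (sets borel) (\<lambda>S. ennreal (Re (cinner (E S f) f)))"

text \<open>The domain \<open>{f. \<integral>\<bar>\<phi>\<bar>\<^sup>2 d\<langle>E f, f\<rangle> < \<infinity>}\<close> of the operator \<open>\<integral> \<phi> dE\<close>.\<close>

definition spectral_domain ::
  "(real set \<Rightarrow> 'h::complex_inner \<Rightarrow> 'h) \<Rightarrow> (real \<Rightarrow> real) \<Rightarrow> 'h set" where
  "spectral_domain E \<phi> = {f. (\<integral>\<^sup>+x. ennreal ((\<phi> x)\<^sup>2) \<partial>scalar_measure E f) < \<infinity>}"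

text \<open>The integral of \<open>\<phi>\<close> against the complex measure \<open>\<langle>E f, g\<rangle>\<close>, which by polarization is
  one quarter of the sum of \<open>\<i>\<^sup>k \<langle>E (f + \<i>\<^sup>k g), f + \<i>\<^sup>k g\<rangle>\<close> over \<open>k < 4\<close>.
  For \<open>f\<close>, \<open>g\<close> in the spectral domain of \<open>\<phi>\<close> all four integrals converge.\<close>

definition spectral_form ::
  "(real set \<Rightarrow> 'h::complex_inner \<Rightarrow> 'h) \<Rightarrow> (real \<Rightarrow> real) \<Rightarrow> 'h \<Rightarrow> 'h \<Rightarrow> complex" where
  "spectral_form E \<phi> f g =
     (\<Sum>k<4. \<i> ^ k * complex_of_real (\<integral>x. \<phi> x \<partial>scalar_measure E (f + \<i> ^ k *\<^sub>C g))) / 4"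

text \<open>The operator \<open>\<integral> \<phi> dE\<close>. Its value at \<open>f\<close> is determined by testing against the spectral
  domain of \<open>\<phi>\<close>, since that domain is dense.\<close>

definition spectral_integral ::
  "(real set \<Rightarrow> 'h::complex_inner \<Rightarrow> 'h) \<Rightarrow> (real \<Rightarrow> real) \<Rightarrow> 'h unbounded_op" where
  "spectral_integral E \<phi> =
     (spectral_domain E \<phi>,
      \<lambda>f. THE v. \<forall>g\<in>spectral_domain E \<phi>. cinner v g = spectral_form E \<phi> f g)"

text \<open>The spectral measure of a self-adjoint operator \<open>L\<close>, i.e. the one with
  \<open>L = \<integral> x dE(x)\<close>. The choice only affects the irrelevant values of \<open>E\<close> on non-Borel sets.\<close>

definition spectral_measure :: "'h::complex_inner unbounded_op \<Rightarrow> real set \<Rightarrow> 'h \<Rightarrow> 'h" where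
  "spectral_measure L =
     (SOME E. projection_valued_measure E \<and> op_eq L (spectral_integral E (\<lambda>x. x)))"

text \<open>The remaining notions are meant for positive self-adjoint \<open>L\<close>, whose spectral measure
  is carried by \<open>[0, \<infinity>)\<close>. The case distinction makes \<open>L\<^sup>0\<close> the identity also on the kernel of
  \<open>L\<close>, because \<open>0 powr 0 = 0\<close>.\<close>

definition op_powr :: "'h::complex_inner unbounded_op \<Rightarrow> real \<Rightarrow> 'h unbounded_op" where
  "op_powr L s = spectral_integral (spectral_measure L) (\<lambda>x. if s = 0 then 1 else x powr s)"

definition op_I_plus_powr :: "'h::complex_inner unbounded_op \<Rightarrow> real \<Rightarrow> 'h unbounded_op" where
  "op_I_plus_powr L s = spectral_integral (spectral_measure L) (\<lambda>x. (1 + x) powr s)"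

text \<open>\<open>F(\<surd>L)\<close> for a bounded Borel function \<open>F\<close> on \<open>[0, \<infinity>)\<close>; the values of \<open>F\<close> on negative
  numbers are discarded.\<close>

definition fun_sqrt_op :: "'h::complex_inner unbounded_op \<Rightarrow> (real \<Rightarrow> real) \<Rightarrow> 'h \<Rightarrow> 'h" where
  "fun_sqrt_op L F =
     app_op (spectral_integral (spectral_measure L) (\<lambda>x. if 0 \<le> x then F (sqrt x) else 0))"

definition PW_projection :: "'h::complex_inner unbounded_op \<Rightarrow> real \<Rightarrow> 'h \<Rightarrow> 'h" where
  "PW_projection L \<omega> = fun_sqrt_op L (indicator {0..\<omega>})"

definition smoothness_space :: "'h::complex_inner unbounded_op \<Rightarrow> real \<Rightarrow> 'h set" where
  "smoothness_space L m = dom_op (op_powr L (m / 2))"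


section \<open>The Paley--Wiener vectors\<close>

text \<open>Smoothness is required on \<open>(0, \<infinity>)\<close> only: as \<open>g = 1\<close> on \<open>[0, 1]\<close>, it extends to
  \<open>[0, \<infinity>)\<close>, and the values of \<open>g\<close> on negative numbers play no role.\<close>

definition cutoff_function :: "(real \<Rightarrow> real) \<Rightarrow> bool" where
  "cutoff_function g \<longleftrightarrow>
     (\<forall>n. \<forall>x>0. (deriv ^^ n) g field_differentiable (at x)) \<and>
     antimono_on {0..} g \<and>
     (\<forall>x>2. g x = 0) \<and>
     (\<forall>x\<in>{0..1}. g x = 1) \<and>
     (\<forall>x\<ge>0. 0 \<le> g x \<and> g x \<le> 1)"

definition dyadic_window :: "(real \<Rightarrow> real) \<Rightarrow> nat \<Rightarrow> real \<Rightarrow> real" where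
  "dyadic_window g j x =
     (if j = 0 then sqrt (g x)
      else let h = (\<lambda>y. g y - g (2 * y)) in sqrt (h (2 powr (- real j) * x)))"

definition omega :: "nat \<Rightarrow> real" where
  "omega j = 2 ^ (j + 1)"

text \<open>The positive solution of \<open>\<rho>\<^sub>j\<^bsup>2m\<^esup> = C\<^bsup>-1\<^esup> \<omega>\<^sub>j\<^bsup>-2m\<^esup> \<delta>\<close>.\<close>

definition rho :: "real \<Rightarrow> real \<Rightarrow> real \<Rightarrow> nat \<Rightarrow> real" where
  "rho C m \<delta> j = (inverse C * omega j powr (- 2 * m) * \<delta>) powr (1 / (2 * m))"

definition riesz_vector :: "'h::complex_inner set \<Rightarrow> ('h \<Rightarrow> complex) \<Rightarrow> 'h" where
  "riesz_vector V A = (THE v. \<forall>f\<in>V. cinner f v = A f)"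

definition PW_vector ::
  "'h::complex_inner unbounded_op \<Rightarrow> (real \<Rightarrow> 'i \<Rightarrow> 'h \<Rightarrow> complex) \<Rightarrow> (real \<Rightarrow> real)
     \<Rightarrow> real \<Rightarrow> real \<Rightarrow> real \<Rightarrow> nat \<Rightarrow> 'i \<Rightarrow> 'h" where
  "PW_vector L A g C m \<delta> j k =
     (let \<mu> = riesz_vector (smoothness_space L m) (A (rho C m \<delta> j) k);
          \<phi> = PW_projection L (omega j) \<mu>
      in fun_sqrt_op L (dyadic_window g j) \<phi>)"


section \<open>Besov norms\<close>

text \<open>Real powers of extended non-negative numbers, used for positive exponents only.\<close>

definition epowr :: "ennreal \<Rightarrow> real \<Rightarrow> ennreal" where
  "epowr x p = (if x = \<infinity> then \<infinity> else ennreal (enn2real x powr p))"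

definition sobolev_norm :: "'h::complex_inner unbounded_op \<Rightarrow> nat \<Rightarrow> 'h \<Rightarrow> real" where
  "sobolev_norm L r f = norm f + norm (app_op (op_I_plus_powr L (real r / 2)) f)"

definition K_functional :: "'h::complex_inner unbounded_op \<Rightarrow> nat \<Rightarrow> real \<Rightarrow> 'h \<Rightarrow> real" where
  "K_functional L r t f =
     Inf {norm f0 + t * sobolev_norm L r f1 | f0 f1.
            f1 \<in> dom_op (op_I_plus_powr L (real r / 2)) \<and> f = f0 + f1}"

text \<open>The norm of the interpolation space between the whole space and \<open>H\<^sup>r\<close> with parameters
  \<open>\<theta> = \<alpha> / r\<close> and \<open>q\<close>, with value \<open>\<infinity>\<close> off the Besov space.\<close>

definition besov_norm ::
  "'h::complex_inner unbounded_op \<Rightarrow> nat \<Rightarrow> real \<Rightarrow> ennreal \<Rightarrow> 'h \<Rightarrow> ennreal" where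
  "besov_norm L r \<alpha> q f =
     (let \<theta> = \<alpha> / real r in
      if q = \<infinity> then (SUP t\<in>{0<..}. ennreal (t powr (- \<theta>) * K_functional L r t f))
      else epowr
        (\<integral>\<^sup>+t\<in>{0<..}. ennreal ((t powr (- \<theta>) * K_functional L r t f) powr enn2real q / t) \<partial>lborel)
        (1 / enn2real q))"

text \<open>The discrete norm of \<open>f\<close> for a family \<open>\<Phi>\<close>, where \<open>\<Phi> j\<close> is indexed by \<open>K j\<close>.\<close>

definition frame_norm ::
  "(nat \<Rightarrow> 'i set) \<Rightarrow> (nat \<Rightarrow> 'i \<Rightarrow> 'h::complex_inner) \<Rightarrow> real \<Rightarrow> ennreal \<Rightarrow> 'h \<Rightarrow> ennreal" where
  "frame_norm K \<Phi> \<alpha> q f =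
     (let s = (\<lambda>j. \<Sum>\<^sub>\<infinity>k\<in>K j. ennreal ((cmod (cinner f (\<Phi> j k)))\<^sup>2)) in
      if q = \<infinity> then (SUP j. ennreal (2 powr (real j * \<alpha>)) * epowr (s j) (1 / 2))
      else epowr
        (\<Sum>j. ennreal (2 powr (real j * \<alpha> * enn2real q)) * epowr (s j) (enn2real q / 2))
        (1 / enn2real q))"

end

theory Submission
  imports Defs "HOL-Probability.Helly_Selection"
begin

text \<open>
  Only the size of the spectral pieces \<open>F\<^sub>j(\<surd>L) f\<close> matters on both sides of the equivalence.

  \<^emph>\<open>The frame side.\<close> The vector \<open>h = F\<^sub>j(\<surd>L) f\<close> has spectrum in \<open>[0, \<omega>\<^sub>j]\<close>, so it is smooth, the
  projection \<open>\<P>\<close> onto that spectral interval fixes it, and \<open>\<langle>f, \<Phi>\<^sup>j\<^sub>k\<rangle> = \<A>\<^sub>k h\<close> (\<open>PW_coefficient\<close>). Bernstein's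
  inequality \<open>\<parallel>L\<^bsup>m/2\<^esup> h\<parallel> \<le> \<omega>\<^sub>j\<^sup>m \<parallel>h\<parallel>\<close> turns the last term of the sampling inequality into \<open>\<delta> \<parallel>h\<parallel>\<^sup>2\<close>, by the
  choice of \<open>\<rho>\<^sub>j\<close>, and this is absorbed on the left. Hence \<open>\<Sum>\<^sub>k \<bar>\<langle>f, \<Phi>\<^sup>j\<^sub>k\<rangle>\<bar>\<^sup>2\<close> is comparable to \<open>\<parallel>F\<^sub>j(\<surd>L) f\<parallel>\<^sup>2\<close>
  with constants independent of \<open>j\<close>. That \<open>\<rho>\<^sub>j < 1\<close> follows from \<open>C \<ge> 1\<close>, which the two
  hypotheses on the functionals imply as \<open>\<rho>\<close> tends to \<open>0\<close> (\<open>sampling_constant_ge_1\<close>).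

  \<^emph>\<open>The Besov side.\<close> The interpolation norm is equivalent to the weighted \<open>\<ell>\<^sup>q\<close> norm of the samples of the
  \<open>K\<close>-functional at \<open>2\<^bsup>-jr\<^esup>\<close> (\<open>sample_le\<close>, \<open>le_sample\<close>). On the support of \<open>F\<^sub>j(\<surd>x)\<close> the
  function \<open>(1 + x)\<^bsup>r/2\<^esup>\<close> is at least a multiple of \<open>2\<^bsup>jr\<^esup>\<close>, which bounds \<open>\<parallel>F\<^sub>j(\<surd>L) f\<parallel>\<close> by the sample at
  \<open>2\<^bsup>-jr\<^esup>\<close> (\<open>window_le_K\<close>). Conversely, splitting \<open>f\<close> at frequency \<open>2\<^sup>j\<close> bounds that
  sample by a tail and a low-frequency part (\<open>K_le_tail_low\<close>), which satisfy contracting recursions in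
  \<open>j\<close>; a discrete Hardy inequality (\<open>Hardy_recursion\<close>) bounds the weighted norms of such sequences by
  that of \<open>\<parallel>F\<^sub>j(\<surd>L) f\<parallel>\<close>.

  \<^emph>\<open>The spectral theorem.\<close> All of this rests on the existence of the spectral measure of \<open>L\<close>, which is proved
  first. The resolvent \<open>R = (I + L)\<^sup>-\<^sup>1\<close> satisfies \<open>0 \<le> R \<le> I\<close>, so the numbers \<open>\<langle>R\<^sup>a (I - R)\<^sup>b f, f\<rangle>\<close> are
  non-negative, and the Hausdorff moment problem represents \<open>\<langle>R\<^sup>k f, f\<rangle>\<close> as the moments of a measure on
  \<open>[0, 1]\<close>. Measures on \<open>[0, 1]\<close> are determined by their moments; this makes the polarized measures
  sesquilinear and multiplicative, hence a projection-valued measure for \<open>R\<close>, and its image under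
  \<open>x \<mapsto> 1/x - 1\<close> is one for \<open>L\<close>. The calculus \<open>\<integral> \<phi> dE\<close> of unbounded functions is developed for an arbitrary
  projection-valued measure; the norm formula \<open>\<parallel>\<phi>(E) f\<parallel>\<^sup>2 = \<integral> \<phi>\<^sup>2 d\<langle>E f, f\<rangle>\<close> reduces every estimate
  above to a pointwise comparison of functions on \<open>[0, \<infinity>)\<close>.
\<close>

section \<open>Complex inner products\<close>

lemma cinner_add_right: "cinner (x::'a::complex_inner) (y + z) = cinner x y + cinner x z"
  by (metis cinner_add_left cinner_commute complex_cnj_add)

lemma cinner_scaleC_right: "cinner (x::'a::complex_inner) (c *\<^sub>C y) = cnj c * cinner x y"
  by (metis cinner_commute cinner_scaleC_left complex_cnj_mult)

lemma cinner_scaleR_left: "cinner (a *\<^sub>R x) (y::'a::complex_inner) = of_real a * cinner x y"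
  by (metis cinner_scaleC_left scaleC_of_real)

lemma cinner_scaleR_right: "cinner (x::'a::complex_inner) (a *\<^sub>R y) = of_real a * cinner x y"
  by (metis cinner_scaleC_right complex_cnj_complex_of_real scaleC_of_real)

lemma Im_cinner_same: "Im (cinner (x::'a::complex_inner) x) = 0"
  by (metis add.inverse_neutral cinner_commute complex_cnj_cancel_iff complex_is_Real_iff Reals_cnj_iff)

lemma Re_cinner_same_ge0: "0 \<le> Re (cinner (x::'a::complex_inner) x)"
  by (metis norm_eq_sqrt_cinner norm_ge_zero real_sqrt_ge_0_iff)

lemma Re_cinner_same: "Re (cinner (x::'a::complex_inner) x) = (norm x)\<^sup>2"
  by (simp add: norm_eq_sqrt_cinner Re_cinner_same_ge0)

lemma cinner_same: "cinner (x::'a::complex_inner) x = of_real ((norm x)\<^sup>2)"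
  by (simp add: complex_eq_iff Im_cinner_same Re_cinner_same)

lemma scaleC_one: "1 *\<^sub>C (x::'a::complex_inner) = x"
  using scaleC_of_real[of 1 x] by simp

lemma scaleC_minus_one: "(-1) *\<^sub>C (x::'a::complex_inner) = - x"
  using scaleC_of_real[of "-1" x] by simp

lemma cinner_diff_left: "cinner (x - y) (z::'a::complex_inner) = cinner x z - cinner y z"
  by (metis cinner_add_left diff_add_cancel add_diff_cancel_right')

lemma cinner_diff_right: "cinner (x::'a::complex_inner) (y - z) = cinner x y - cinner x z"
  by (metis cinner_add_right diff_add_cancel add_diff_cancel_right')

lemma norm_scaleC: "norm (c *\<^sub>C (x::'a::complex_inner)) = cmod c * norm x"
proof -
  have "(norm (c *\<^sub>C x))\<^sup>2 = Re (c * cnj c * cinner x x)"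
    by (simp add: Re_cinner_same[symmetric] cinner_scaleC_left cinner_scaleC_right mult_ac)
  also have "\<dots> = (cmod c * norm x)\<^sup>2"
    by (simp add: complex_norm_square[symmetric] cinner_same power_mult_distrib flip: of_real_power of_real_mult)
  finally show ?thesis by (simp add: power2_eq_iff_nonneg)
qed

text \<open>This is \<open>\<parallel>x - a y\<parallel>\<^sup>2 \<ge> 0\<close> for the coefficient \<open>a = \<langle>x, y\<rangle> / \<parallel>y\<parallel>\<^sup>2\<close> of the orthogonal projection
  of \<open>x\<close> onto \<open>y\<close>.\<close>

lemma Cauchy_Schwarz_cinner: "cmod (cinner (x::'a::complex_inner) y) \<le> norm x * norm y"
proof (cases "y = 0")
  case True
  then show ?thesis using cinner_scaleR_right[of x 0 0] by simp
next
  case False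
  define a where "a = cinner x y / of_real ((norm y)\<^sup>2)"
  have ny: "(norm y)\<^sup>2 > 0" using False by simp
  have eq: "cinner (x - a *\<^sub>C y) (x - a *\<^sub>C y)
      = cinner x x - cnj a * cinner x y - a * cnj (cinner x y) + a * cnj a * cinner y y"
    by (simp add: cinner_diff_left cinner_diff_right
        cinner_scaleC_left cinner_scaleC_right algebra_simps cinner_commute[of y x])
  have "a * cnj a * cinner y y = a * cnj (cinner x y)"
    using False by (simp add: a_def cinner_same power2_eq_square)
  then have "cinner (x - a *\<^sub>C y) (x - a *\<^sub>C y) = cinner x x - cnj a * cinner x y"
    using eq by simp
  also have "cnj a * cinner x y = of_real ((cmod (cinner x y))\<^sup>2 / (norm y)\<^sup>2)"
    unfolding a_def by (simp only: complex_norm_square of_real_divide) (simp add: mult.commute)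
  finally have "Re (cinner (x - a *\<^sub>C y) (x - a *\<^sub>C y)) = (norm x)\<^sup>2 - (cmod (cinner x y))\<^sup>2 / (norm y)\<^sup>2"
    by (simp only: minus_complex.simps Re_cinner_same Re_complex_of_real)
  then have "(cmod (cinner x y))\<^sup>2 / (norm y)\<^sup>2 \<le> (norm x)\<^sup>2"
    using Re_cinner_same_ge0[of "x - a *\<^sub>C y"] by simp
  then have "(cmod (cinner x y))\<^sup>2 \<le> (norm x * norm y)\<^sup>2"
    using ny by (simp add: divide_le_eq power_mult_distrib)
  then show ?thesis by (rule power2_le_imp_le) simp
qed

interpretation cinner: bounded_bilinear "cinner :: 'a::complex_inner \<Rightarrow> 'a \<Rightarrow> complex"
proof
  show "\<exists>K. \<forall>a b. cmod (cinner a (b::'a)) \<le> norm a * norm b * K"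
    by (rule exI[of _ 1]) (simp add: Cauchy_Schwarz_cinner)
qed (simp_all add: cinner_add_left cinner_add_right cinner_scaleR_left cinner_scaleR_right scaleR_conv_of_real)

lemma scaleC_diff_right: "c *\<^sub>C (x - y) = c *\<^sub>C x - c *\<^sub>C (y::'a::complex_inner)"
  by (metis (no_types) add_diff_cancel_right' diff_add_cancel scaleC_add_right)

lemma scaleC_zero_left: "0 *\<^sub>C (x::'a::complex_inner) = 0"
  using scaleC_of_real[of 0 x] by simp

lemma scaleC_scaleR: "c *\<^sub>C (a *\<^sub>R x) = a *\<^sub>R (c *\<^sub>C (x::'a::complex_inner))"
  by (simp add: scaleC_of_real[symmetric] scaleC_scaleC mult.commute)

lemma bounded_linear_scaleC: "bounded_linear (\<lambda>x::'a::complex_inner. c *\<^sub>C x)"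
  by (rule bounded_linear_intro[of _ "cmod c"])
    (simp_all add: scaleC_add_right scaleC_scaleR norm_scaleC)

lemmas tendsto_scaleC = bounded_linear.tendsto[OF bounded_linear_scaleC]

lemma cinner_eq_zero_dense:
  fixes v :: "'a::complex_inner"
  assumes "closure V = UNIV" and "\<And>f. f \<in> V \<Longrightarrow> cinner f v = 0"
  shows "v = 0"
proof -
  have "closed {f. cinner f v = 0}"
    by (intro closed_Collect_eq continuous_intros cinner.continuous_on)
  then have "closure V \<subseteq> {f. cinner f v = 0}"
    by (intro closure_minimal) (use assms in auto)
  then have "cinner v v = 0" using assms(1) by auto
  then show ?thesis by (simp add: cinner_same)
qed

lemma cinner_eq_dense:
  fixes v :: "'a::complex_inner"
  assumes "closure V = UNIV" and "\<And>f. f \<in> V \<Longrightarrow> cinner f v = cinner f w"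
  shows "v = w"
  using cinner_eq_zero_dense[OF assms(1), of "v - w"] assms(2) by (simp add: cinner.diff_right)

lemma cinner_eq_dense_left:
  fixes v :: "'a::complex_inner"
  assumes "closure V = UNIV" and "\<And>f. f \<in> V \<Longrightarrow> cinner v f = cinner w f"
  shows "v = w"
  using cinner_eq_dense[OF assms(1), of v w] assms(2) by (metis cinner_commute)

lemma norm_diff_square: "(norm ((x::'a::complex_inner) - y))\<^sup>2 = (norm x)\<^sup>2 + (norm y)\<^sup>2 - 2 * Re (cinner x y)"
  by (simp add: Re_cinner_same[symmetric] cinner.diff_left cinner.diff_right cinner_commute[of y x])

lemma norm_add_square: "(norm ((x::'a::complex_inner) + y))\<^sup>2 = (norm x)\<^sup>2 + (norm y)\<^sup>2 + 2 * Re (cinner x y)"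
  by (simp add: Re_cinner_same[symmetric] cinner.add_left cinner.add_right cinner_commute[of y x])

text \<open>Riesz representation on an arbitrary subspace: the quadratic functional
  \<open>\<parallel>f\<parallel>\<^sup>2 - 2 Re (A f)\<close> is bounded below, its minimizing sequences are Cauchy by the parallelogram
  law, and its first variation at the limit \<open>u\<close> is the identity \<open>\<langle>f, u\<rangle> = A f\<close>.
  For a subspace that is not closed, \<open>u\<close> is found in the closure. This also serves as the projection
  theorem, with \<open>A f = \<langle>f, h\<rangle>\<close>.\<close>

lemma Riesz_representation_subspace:
  fixes A :: "'h::complex_hilbert_space \<Rightarrow> complex"
  assumes V: "csubspace V" and A: "linear_functional_on V A"
    and bound: "\<And>f. f \<in> V \<Longrightarrow> cmod (A f) \<le> M * norm f"
  shows "\<exists>u\<in>closure V. \<forall>f\<in>V. cinner f u = A f"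
proof -
  define J where "J f = (norm f)\<^sup>2 - 2 * Re (A f)" for f
  have V0: "0 \<in> V" and Vadd: "\<And>f g. f \<in> V \<Longrightarrow> g \<in> V \<Longrightarrow> f + g \<in> V"
    and Vsc: "\<And>c f. f \<in> V \<Longrightarrow> c *\<^sub>C f \<in> V"
    using V by (auto simp: csubspace_def)
  have VscR: "a *\<^sub>R f \<in> V" if "f \<in> V" for a f
    using Vsc[OF that, of "of_real a"] by (simp add: scaleC_of_real)
  have Aadd: "\<And>f g. f \<in> V \<Longrightarrow> g \<in> V \<Longrightarrow> A (f + g) = A f + A g"
    and Asc: "\<And>c f. f \<in> V \<Longrightarrow> A (c *\<^sub>C f) = c * A f"
    using A by (auto simp: linear_functional_on_def)
  have AscR: "A (a *\<^sub>R f) = of_real a * A f" if "f \<in> V" for a f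
    using Asc[OF that, of "of_real a"] by (simp add: scaleC_of_real)
  have Jlow: "J f \<ge> - M\<^sup>2" if "f \<in> V" for f
  proof -
    have "Re (A f) \<le> M * norm f" using bound[OF that] complex_Re_le_cmod[of "A f"] by linarith
    moreover have "0 \<le> (norm f - M)\<^sup>2" by simp
    ultimately show ?thesis by (simp add: J_def power2_eq_square algebra_simps)
  qed
  define d where "d = Inf (J ` V)"
  have bdd: "bdd_below (J ` V)" using Jlow by (rule bdd_belowI2)
  have dle: "d \<le> J f" if "f \<in> V" for f
    unfolding d_def using bdd that by (auto intro: cInf_lower)
  have "\<exists>f\<in>V. J f < d + 1 / real (Suc n)" for n
    using cInf_lessD[of "J ` V" "d + 1 / real (Suc n)"] V0 unfolding d_def by auto
  then obtain s where sV: "\<And>n. s n \<in> V" and sJ: "\<And>n. J (s n) < d + 1 / real (Suc n)"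
    by metis
  have par: "(norm (f - g))\<^sup>2 = 2 * J f + 2 * J g - 4 * J ((1/2) *\<^sub>R (f + g))" if "f \<in> V" "g \<in> V" for f g
  proof -
    have "(norm ((1/2) *\<^sub>R (f + g)))\<^sup>2 = ((norm f)\<^sup>2 + (norm g)\<^sup>2 + 2 * Re (cinner f g)) / 4"
      by (simp only: norm_add_square[symmetric] norm_scaleR power_mult_distrib) (simp add: power2_eq_square)
    moreover have "Re (A ((1/2) *\<^sub>R (f + g))) = (Re (A f) + Re (A g)) / 2"
      using that by (simp only: AscR[OF Vadd] Aadd) simp
    ultimately show ?thesis
      using that unfolding J_def norm_diff_square by simp
  qed
  have close: "(norm (s i - s j))\<^sup>2 \<le> 2 / real (Suc i) + 2 / real (Suc j)" for i j
  proof -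
    define a b where "a = 1 / real (Suc i)" and "b = 1 / real (Suc j)"
    have "(norm (s i - s j))\<^sup>2 \<le> 2 * (d + a) + 2 * (d + b) - 4 * d"
    proof -
      have "x \<le> 2 * (d + a) + 2 * (d + b) - 4 * d"
        if "x = 2 * p + 2 * q - 4 * z" "p < d + a" "q < d + b" "d \<le> z" for x p q z :: real
        using that by argo
      from this[OF par[OF sV[of i] sV[of j]] sJ[of i, folded a_def] sJ[of j, folded b_def]
        dle[OF VscR[OF Vadd[OF sV[of i] sV[of j]]]]] show ?thesis .
    qed
    then show ?thesis by (simp add: a_def b_def)
  qed
  have "Cauchy s"
  proof (rule metric_CauchyI)
    fix e :: real assume e: "e > 0"
    obtain N where N: "4 / e\<^sup>2 < real (Suc N)" using reals_Archimedean2 less_Suc_eq by (metis of_nat_less_iff order_less_trans lessI)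
    have "dist (s i) (s j) < e" if "i \<ge> N" "j \<ge> N" for i j
    proof -
      have "2 / real (Suc i) + 2 / real (Suc j) \<le> 2 / real (Suc N) + 2 / real (Suc N)"
        using that by (intro add_mono divide_left_mono) auto
      also have "\<dots> = 4 / real (Suc N)" by simp
      also have "\<dots> < e\<^sup>2" using N e by (simp add: field_simps del: of_nat_Suc)
      finally have "(norm (s i - s j))\<^sup>2 < e\<^sup>2" using close[of i j] by linarith
      then show ?thesis using e by (simp add: dist_norm power2_less_imp_less)
    qed
    then show "\<exists>N. \<forall>m\<ge>N. \<forall>n\<ge>N. dist (s m) (s n) < e" by blast
  qed
  then obtain u where u: "s \<longlonglongrightarrow> u" using Cauchy_convergent convergent_def by blast
  have uV: "u \<in> closure V" unfolding closure_sequential using u sV by blast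
  have Re_eq: "Re (cinner u f) = Re (A f)" if f: "f \<in> V" for f
  proof -
    have key: "2 * t * (Re (cinner u f) - Re (A f)) + t\<^sup>2 * (norm f)\<^sup>2 \<ge> 0" for t :: real
    proof -
      have "d \<le> d + 1 / real (Suc n) + (2 * t * (Re (cinner (s n) f) - Re (A f)) + t\<^sup>2 * (norm f)\<^sup>2)" for n
      proof -
        have "J (s n + t *\<^sub>R f) = J (s n) + (2 * t * (Re (cinner (s n) f) - Re (A f)) + t\<^sup>2 * (norm f)\<^sup>2)"
          using f sV[of n] by (simp add: J_def norm_add_square Aadd AscR VscR cinner_scaleR_right power_mult_distrib algebra_simps)
        then show ?thesis using dle[OF Vadd[OF sV[of n] VscR[OF f, of t]]] sJ[of n] by linarith
      qed
      moreover have "(\<lambda>n. d + 1 / real (Suc n) + (2 * t * (Re (cinner (s n) f) - Re (A f)) + t\<^sup>2 * (norm f)\<^sup>2))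
          \<longlonglongrightarrow> d + 0 + (2 * t * (Re (cinner u f) - Re (A f)) + t\<^sup>2 * (norm f)\<^sup>2)"
        by (intro tendsto_intros cinner.tendsto u LIMSEQ_Suc[OF lim_1_over_n])
      ultimately have "d \<le> d + 0 + (2 * t * (Re (cinner u f) - Re (A f)) + t\<^sup>2 * (norm f)\<^sup>2)"
        by (intro LIMSEQ_le_const) auto
      then show ?thesis by simp
    qed
    define b where "b = Re (cinner u f) - Re (A f)"
    have "b = 0"
    proof (rule ccontr)
      assume b: "b \<noteq> 0"
      \<comment> \<open>close to the minimizer \<open>- b / \<parallel>f\<parallel>\<^sup>2\<close> of the quadratic polynomial, but defined for \<open>f = 0\<close> too\<close>
      define t where "t = - b / ((norm f)\<^sup>2 + 1)"
      have n1: "(norm f)\<^sup>2 + 1 > 0" by (simp add: add_nonneg_pos)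
      have tb: "t * ((norm f)\<^sup>2 + 1) = - b" using n1 by (simp add: t_def)
      have "2 * t * b + t\<^sup>2 * (norm f)\<^sup>2 = 2 * t * b + t * (t * ((norm f)\<^sup>2 + 1)) - t\<^sup>2"
        by (simp add: power2_eq_square algebra_simps)
      also have "\<dots> = t * b - t\<^sup>2" by (simp add: tb)
      also have "\<dots> = - (b\<^sup>2 / ((norm f)\<^sup>2 + 1)) - t\<^sup>2" by (simp add: t_def power2_eq_square)
      also have "\<dots> < 0"
      proof -
        have "0 < b\<^sup>2 / ((norm f)\<^sup>2 + 1)" using b n1 by simp
        moreover have "0 \<le> t\<^sup>2" by simp
        ultimately show ?thesis by argo
      qed
      finally show False using key[of t] by (simp add: b_def)
    qed
    then show ?thesis by (simp add: b_def)
  qed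
  have "cinner f u = A f" if f: "f \<in> V" for f
  proof (rule complex_eqI)
    show "Re (cinner f u) = Re (A f)" using Re_eq[OF f] cinner_commute[of f u] by simp
    have "Re (cinner u (\<i> *\<^sub>C f)) = Re (A (\<i> *\<^sub>C f))" by (rule Re_eq[OF Vsc[OF f]])
    then show "Im (cinner f u) = Im (A f)"
      using cinner_commute[of f u] by (simp add: cinner_scaleC_right Asc[OF f])
  qed
  then show ?thesis using uV by blast
qed

definition clin :: "('h::complex_inner \<Rightarrow> 'h) \<Rightarrow> bool" where
  "clin T \<longleftrightarrow> (\<forall>f g. T (f + g) = T f + T g) \<and> (\<forall>c f. T (c *\<^sub>C f) = c *\<^sub>C T f)"

lemma linear_op_UNIV: "linear_op (UNIV, T) \<longleftrightarrow> clin T"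
  by (simp add: linear_op_def clin_def csubspace_def)

lemma clinD:
  assumes "clin T"
  shows clin_add: "T (f + g) = T f + T g" and clin_scaleC: "T (c *\<^sub>C f) = c *\<^sub>C T f"
    and clin_scaleR: "T (a *\<^sub>R f) = a *\<^sub>R T f"
    and clin_diff: "T (f - g) = T f - T g" and clin_zero: "T 0 = 0"
proof -
  show a: "T (f + g) = T f + T g" for f g using assms by (simp add: clin_def)
  show s: "T (c *\<^sub>C f) = c *\<^sub>C T f" for c f using assms by (simp add: clin_def)
  show r: "T (a *\<^sub>R f) = a *\<^sub>R T f" for a f using s[of "of_real a"] by (simp add: scaleC_of_real)
  show "T (f - g) = T f - T g" using a[of "f - g" g] by (simp add: algebra_simps)
  show "T 0 = 0" using r[of 0] by simp
qed

lemma clin_sum: "clin T \<Longrightarrow> T (\<Sum>i\<in>I. h i) = (\<Sum>i\<in>I. T (h i))"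
  by (induction I rule: infinite_finite_induct) (auto simp: clin_zero clin_add)

text \<open>The left-hand side has the shape of \<open>spectral_form\<close>, with the quadratic form of \<open>T\<close> in place of
  the scalar integrals.\<close>

lemma polarization:
  assumes "clin T"
  shows "(\<Sum>k<4. \<i> ^ k * cinner (T (f + \<i> ^ k *\<^sub>C g)) (f + \<i> ^ k *\<^sub>C g)) / 4 = cinner (T f) g"
  by (simp add: numeral_eq_Suc clin_add[OF assms] clin_scaleC[OF assms] cinner.add_left cinner.add_right
      cinner_scaleC_left cinner_scaleC_right scaleC_one algebra_simps)

section \<open>The Hausdorff moment problem\<close>

text \<open>Throughout, \<open>m a b\<close> stands for the integral of \<open>x\<^sup>a (1 - x)\<^sup>b\<close> against the measure to be found. The
  recursion \<open>m a b = m (a + 1) b + m a (b + 1)\<close> says \<open>x + (1 - x) = 1\<close>, and the next lemma is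
  \<open>(x + (1 - x))\<^sup>n = 1\<close>.\<close>

lemma moment_binomial:
  fixes m :: "nat \<Rightarrow> nat \<Rightarrow> real"
  assumes rec: "\<And>a b. m a b = m (Suc a) b + m a (Suc b)"
  shows "m a b = (\<Sum>k\<le>n. real (n choose k) * m (a + k) (b + (n - k)))"
proof (induction n arbitrary: a b)
  case 0
  then show ?case by simp
next
  case (Suc n)
  have "m a b = m (Suc a) b + m a (Suc b)" by (rule rec)
  also have "m (Suc a) b = (\<Sum>k\<le>n. real (n choose k) * m (a + Suc k) (b + (Suc n - Suc k)))"
    using Suc[of "Suc a" b] by simp
  also have "\<dots> = (\<Sum>k\<in>{1..Suc n}. real (n choose (k - 1)) * m (a + k) (b + (Suc n - k)))"
    by (rule sum.reindex_bij_witness[of _ "\<lambda>k. k - 1" Suc]) auto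
  also have "m a (Suc b) = (\<Sum>k\<le>n. real (n choose k) * m (a + k) (b + (Suc n - k)))"
    using Suc[of a "Suc b"] by (simp add: Suc_diff_le)
  also have "\<dots> = (\<Sum>k\<le>Suc n. real (n choose k) * m (a + k) (b + (Suc n - k)))"
    by simp
  also have "(\<Sum>k\<in>{1..Suc n}. real (n choose (k - 1)) * m (a + k) (b + (Suc n - k)))
      = (\<Sum>k\<le>Suc n. (if k = 0 then 0 else real (n choose (k - 1))) * m (a + k) (b + (Suc n - k)))"
    by (rule sum.mono_neutral_cong_left) auto
  also have "\<dots> + (\<Sum>k\<le>Suc n. real (n choose k) * m (a + k) (b + (Suc n - k)))
     = (\<Sum>k\<le>Suc n. real (Suc n choose k) * m (a + k) (b + (Suc n - k)))"
    unfolding sum.distrib[symmetric]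
  proof (rule sum.cong[OF refl])
    fix k
    show "(if k = 0 then 0 else real (n choose (k - 1))) * m (a + k) (b + (Suc n - k)) +
         real (n choose k) * m (a + k) (b + (Suc n - k)) =
         real (Suc n choose k) * m (a + k) (b + (Suc n - k))"
      by (cases k) (simp_all add: distrib_right)
  qed
  finally show ?case .
qed

text \<open>The weights \<open>\<lambda>\<^sub>k = (n choose k) m k (n - k)\<close> integrate the normalised falling factorial
  \<open>(k choose j) / (n choose j)\<close> exactly to the moment \<open>m j 0\<close>.\<close>

lemma moment_falling_factorial:
  fixes m :: "nat \<Rightarrow> nat \<Rightarrow> real"
  assumes rec: "\<And>a b. m a b = m (Suc a) b + m a (Suc b)" and "j \<le> n"
  shows "m j 0 = (\<Sum>k\<le>n. real (n choose k) * m k (n - k) * (real (k choose j) / real (n choose j)))"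
proof -
  have "m j 0 = (\<Sum>k\<le>n - j. real ((n - j) choose k) * m (j + k) (n - j - k))"
    using moment_binomial[of m, OF rec, of j 0 "n - j"] by simp
  also have "\<dots> = (\<Sum>k\<in>{j..n}. real ((n - j) choose (k - j)) * m k (n - k))"
    by (rule sum.reindex_bij_witness[of _ "\<lambda>k. k - j" "\<lambda>k. j + k"]) (use \<open>j \<le> n\<close> in auto)
  also have "\<dots> = (\<Sum>k\<in>{j..n}. real (n choose k) * m k (n - k) * (real (k choose j) / real (n choose j)))"
  proof (rule sum.cong[OF refl])
    fix k assume k: "k \<in> {j..n}"
    have "real (n choose k) * real (k choose j) = real (n choose j) * real ((n - j) choose (k - j))"
      using choose_mult[of j k n] k by (metis atLeastAtMost_iff of_nat_mult)
    moreover have "real (n choose j) \<noteq> 0" using \<open>j \<le> n\<close> by simp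
    ultimately have "real ((n - j) choose (k - j)) = real (n choose k) * (real (k choose j) / real (n choose j))"
      by (simp add: field_simps)
    then show "real ((n - j) choose (k - j)) * m k (n - k) = real (n choose k) * m k (n - k) * (real (k choose j) / real (n choose j))"
      by simp
  qed
  also have "\<dots> = (\<Sum>k\<le>n. real (n choose k) * m k (n - k) * (real (k choose j) / real (n choose j)))"
    by (rule sum.mono_neutral_left) auto
  finally show ?thesis .
qed

text \<open>The quotient is the product of the \<open>(k - i) / (n - i)\<close> over \<open>i < j\<close>. All its factors, and
  \<open>k / n\<close>, lie in \<open>[-1, 1]\<close>, so the products differ by at most the sum of the differences of the
  factors.\<close>

lemma falling_factorial_approx:
  assumes "k \<le> n" "2 * j < n"
  shows "\<bar>real (k choose j) / real (n choose j) - (real k / real n) ^ j\<bar> \<le> 2 * real j ^ 2 / real n"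
proof -
  have prodform: "real (k choose j) / real (n choose j) = (\<Prod>i<j. (real k - real i) / (real n - real i))"
  proof -
    have *: "real (l choose j) = (\<Prod>i<j. real l - real i) / fact j" for l
      unfolding binomial_gbinomial gbinomial_prod_rev by (simp add: atLeast0LessThan)
    have "(\<Prod>i<j. real n - real i) \<noteq> 0" using assms by auto
    then show ?thesis unfolding * prod_dividef by simp
  qed
  have n0: "real n > 0" using assms by auto
  have 1: "\<bar>(real k - real i) / (real n - real i)\<bar> \<le> 1" if "i < j" for i
  proof -
    have "real n - real i > 0" "\<bar>real k - real i\<bar> \<le> real n - real i" using that assms by linarith+
    then show ?thesis by (simp add: divide_le_eq)
  qed
  have 2: "\<bar>(real k - real i) / (real n - real i) - real k / real n\<bar> \<le> 2 * real j / real n" if "i < j" for i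
  proof -
    have p: "real n - real i \<ge> real n / 2" using that assms by linarith
    then have p0: "real n - real i > 0" using n0 by linarith
    have "(real k - real i) / (real n - real i) - real k / real n = - (real i * (real n - real k)) / ((real n - real i) * real n)"
      using p0 n0 by (simp add: field_simps)
    then have "\<bar>(real k - real i) / (real n - real i) - real k / real n\<bar> = real i * (real n - real k) / ((real n - real i) * real n)"
      using p0 n0 assms by (simp add: abs_mult)
    also have "\<dots> \<le> real j * real n / ((real n / 2) * real n)"
      using that assms p n0 by (intro frac_le mult_mono) auto
    also have "\<dots> = 2 * real j / real n" using n0 by simp
    finally show ?thesis .
  qed
  have "\<bar>(\<Prod>i<j. (real k - real i) / (real n - real i)) - (\<Prod>i<j. real k / real n)\<bar>
      \<le> (\<Sum>i<j. \<bar>(real k - real i) / (real n - real i) - real k / real n\<bar>)"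
    using norm_prod_diff[of "{..<j}" "\<lambda>i. (real k - real i) / (real n - real i)" "\<lambda>i. real k / real n"] 1 assms n0
    by (simp add: divide_le_eq)
  also have "\<dots> \<le> (\<Sum>i<j. 2 * real j / real n)" by (intro sum_mono 2) auto
  also have "\<dots> = 2 * real j ^ 2 / real n" by (simp add: power2_eq_square)
  finally show ?thesis by (simp add: prodform)
qed

text \<open>The probability measures with mass \<open>(n choose k) m k (n - k)\<close> at \<open>k / n\<close> live on \<open>[0, 1]\<close>,
  so a subsequence converges weakly; the moments of its limit are those prescribed because the
  falling factorials approximate the powers \<open>(k / n)\<^sup>j\<close> uniformly in \<open>k\<close>.\<close>

lemma Hausdorff_moment_normalized:
  fixes m :: "nat \<Rightarrow> nat \<Rightarrow> real"
  assumes rec: "\<And>a b. m a b = m (Suc a) b + m a (Suc b)"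
    and nonneg: "\<And>a b. m a b \<ge> 0" and one: "m 0 0 = 1"
  shows "\<exists>M. real_distribution M \<and> (AE x in M. x \<in> {0..1}) \<and> (\<forall>j. (\<integral>x. x ^ j \<partial>M) = m j 0)"
proof -
  \<comment> \<open>a bounded continuous substitute for \<open>x\<close>, as weak convergence requires\<close>
  define clip where "clip x = max 0 (min 1 x)" for x :: real
  have clip_meas[measurable]: "clip \<in> borel_measurable borel" unfolding clip_def by measurable
  have clip_bd: "0 \<le> clip x" "clip x \<le> 1" for x by (auto simp: clip_def)
  define w where "w n k = real (n choose k) * m k (n - k)" for n k
  have w0: "w n k \<ge> 0" for n k by (simp add: w_def nonneg)
  have wsum: "(\<Sum>k\<le>n. w n k) = 1" for n
    using moment_binomial[of m, OF rec, of 0 0 n] one by (simp add: w_def)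
  define \<nu> where "\<nu> n = distr (point_measure {..n} (\<lambda>k. ennreal (w n k))) borel (\<lambda>k. real k / real n)" for n
  have prob_pm: "prob_space (point_measure {..n} (\<lambda>k. ennreal (w n k)))" for n
    by (rule prob_spaceI) (simp add: space_point_measure emeasure_point_measure_finite sum_ennreal w0 wsum)
  have rd: "real_distribution (\<nu> n)" for n
  proof -
    interpret prob_space "point_measure {..n} (\<lambda>k. ennreal (w n k))" by (rule prob_pm)
    show ?thesis unfolding \<nu>_def real_distribution_def real_distribution_axioms_def
      by (auto intro!: prob_space_distr)
  qed
  have int\<nu>: "(\<integral>x. f x \<partial>\<nu> n) = (\<Sum>k\<le>n. w n k * f (real k / real n))" if "f \<in> borel_measurable borel" for f :: "real \<Rightarrow> real" and n
    unfolding \<nu>_def using that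
    by (subst integral_distr) (simp_all add: lebesgue_integral_point_measure_finite w0)
  have "tight \<nu>" unfolding tight_def
  proof (intro conjI allI impI)
    show "real_distribution (\<nu> n)" for n by (rule rd)
    fix \<epsilon> :: real assume \<epsilon>: "\<epsilon> > 0"
    have "measure (\<nu> n) {-1<..1} = 1" for n
    proof -
      have "measure (\<nu> n) {-1<..1} = (\<integral>x. indicator {-1<..1} x \<partial>\<nu> n)"
        by (simp add: \<nu>_def)
      also have "\<dots> = (\<Sum>k\<le>n. w n k * indicator {-1<..1} (real k / real n))"
        by (rule int\<nu>) auto
      also have "\<dots> = (\<Sum>k\<le>n. w n k)"
      proof (rule sum.cong[OF refl])
        fix k assume "k \<in> {..n}"
        then have "real k / real n \<le> 1" by (simp add: divide_le_eq)
        moreover have "real k / real n > -1"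
          by (rule less_le_trans[of _ 0]) auto
        ultimately show "w n k * indicator {-1<..1} (real k / real n) = w n k" by (simp add: indicator_def)
      qed
      finally show ?thesis by (simp add: wsum)
    qed
    then have "\<forall>n. 1 - \<epsilon> < measure (\<nu> n) {-1<..1}" using \<epsilon> by simp
    then show "\<exists>a b. a < b \<and> (\<forall>n. 1 - \<epsilon> < measure (\<nu> n) {a<..b})"
      by (intro exI[of _ "-1"] exI[of _ 1]) simp
  qed
  from tight_imp_convergent_subsubsequence[OF this strict_mono_id]
  obtain r N where r: "strict_mono (r::nat\<Rightarrow>nat)" and N: "real_distribution N"
    and wc: "weak_conv_m (\<lambda>n. \<nu> (r n)) N"
    by (auto simp: o_def id_def)
  interpret N: real_distribution N by (rule N)
  have mom: "(\<integral>x. clip x ^ j \<partial>N) = m j 0" for j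
  proof (rule LIMSEQ_unique)
    show "(\<lambda>n. \<integral>x. clip x ^ j \<partial>\<nu> (r n)) \<longlonglongrightarrow> (\<integral>x. clip x ^ j \<partial>N)"
    proof (rule weak_conv_imp_integral_bdd_continuous_conv[OF rd N wc, where B = 1])
      show "isCont (\<lambda>x. clip x ^ j) x" for x unfolding clip_def by (intro continuous_intros)
      show "norm (clip x ^ j) \<le> 1" for x using clip_bd[of x] by (simp add: power_le_one)
    qed
    have ev: "\<bar>(\<integral>x. clip x ^ j \<partial>\<nu> n) - m j 0\<bar> \<le> 2 * real j ^ 2 / real n" if n: "2 * j < n" for n
    proof -
      have eq: "(\<integral>x. clip x ^ j \<partial>\<nu> n) = (\<Sum>k\<le>n. w n k * (real k / real n) ^ j)"
      proof -
        have "(\<integral>x. clip x ^ j \<partial>\<nu> n) = (\<Sum>k\<le>n. w n k * clip (real k / real n) ^ j)"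
          by (rule int\<nu>) measurable
        also have "\<dots> = (\<Sum>k\<le>n. w n k * (real k / real n) ^ j)"
        proof (rule sum.cong[OF refl])
          fix k assume "k \<in> {..n}"
          then have "real k / real n \<le> 1" by (simp add: divide_le_eq)
          then show "w n k * clip (real k / real n) ^ j = w n k * (real k / real n) ^ j"
            by (simp add: clip_def)
        qed
        finally show ?thesis .
      qed
      have "m j 0 = (\<Sum>k\<le>n. w n k * (real (k choose j) / real (n choose j)))"
        unfolding w_def by (rule moment_falling_factorial[of m, OF rec]) (use n in auto)
      then have "\<bar>(\<integral>x. clip x ^ j \<partial>\<nu> n) - m j 0\<bar> = \<bar>\<Sum>k\<le>n. w n k * ((real k / real n) ^ j - real (k choose j) / real (n choose j))\<bar>"
        by (simp add: eq right_diff_distrib sum_subtractf)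
      also have "\<dots> \<le> (\<Sum>k\<le>n. \<bar>w n k * ((real k / real n) ^ j - real (k choose j) / real (n choose j))\<bar>)"
        by (rule sum_abs)
      also have "\<dots> \<le> (\<Sum>k\<le>n. w n k * (2 * real j ^ 2 / real n))"
      proof (rule sum_mono)
        fix k assume "k \<in> {..n}"
        then have "\<bar>(real k / real n) ^ j - real (k choose j) / real (n choose j)\<bar> \<le> 2 * real j ^ 2 / real n"
          using falling_factorial_approx[of k n j] n by (simp only: abs_minus_commute atMost_iff)
        then show "\<bar>w n k * ((real k / real n) ^ j - real (k choose j) / real (n choose j))\<bar> \<le> w n k * (2 * real j ^ 2 / real n)"
          using w0[of n k] by (simp only: abs_mult abs_of_nonneg mult_left_mono)
      qed
      also have "\<dots> = 2 * real j ^ 2 / real n" by (simp only: sum_distrib_right[symmetric] wsum mult_1)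
      finally show ?thesis .
    qed
    have "(\<lambda>n. (\<integral>x. clip x ^ j \<partial>\<nu> n) - m j 0) \<longlonglongrightarrow> 0"
    proof (rule Lim_null_comparison)
      show "\<forall>\<^sub>F n in sequentially. norm ((\<integral>x. clip x ^ j \<partial>\<nu> n) - m j 0) \<le> 2 * real j ^ 2 / real n"
        by (rule eventually_mono[OF eventually_gt_at_top[of "2 * j"]]) (simp add: ev)
      show "(\<lambda>n. 2 * real j ^ 2 / real n) \<longlonglongrightarrow> 0"
        by (rule lim_const_over_n)
    qed
    then have "(\<lambda>n. \<integral>x. clip x ^ j \<partial>\<nu> n) \<longlonglongrightarrow> m j 0"
      by (simp add: LIM_zero_iff)
    then show "(\<lambda>n. \<integral>x. clip x ^ j \<partial>\<nu> (r n)) \<longlonglongrightarrow> m j 0"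
      using LIMSEQ_subseq_LIMSEQ[OF _ r] by (force simp: o_def)
  qed
  have "real_distribution (distr N borel clip)"
    unfolding real_distribution_def real_distribution_axioms_def
    by (auto intro!: N.prob_space_distr)
  moreover have "AE x in distr N borel clip. x \<in> {0..1}"
    by (subst AE_distr_iff) (auto simp: clip_bd)
  moreover have "(\<integral>x. x ^ j \<partial>distr N borel clip) = m j 0" for j
    by (subst integral_distr) (simp_all add: mom)
  ultimately show ?thesis by blast
qed

lemma Hausdorff_moment:
  fixes m :: "nat \<Rightarrow> nat \<Rightarrow> real"
  assumes rec: "\<And>a b. m a b = m (Suc a) b + m a (Suc b)"
    and nonneg: "\<And>a b. m a b \<ge> 0"
  shows "\<exists>M. finite_measure M \<and> sets M = sets borel \<and> (AE x in M. x \<in> {0..1::real}) \<and> (\<forall>j. (\<integral>x. x ^ j \<partial>M) = m j 0)"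
proof (cases "m 0 0 = 0")
  case True
  have "m j 0 \<le> m 0 0" for j
  proof (induction j)
    case (Suc j)
    then show ?case using rec[of j 0] nonneg[of j 1] by simp
  qed simp
  then have "m j 0 = 0" for j using True nonneg[of j 0] by (simp add: antisym)
  then show ?thesis
  proof (intro exI[of _ "null_measure borel"] conjI allI)
    show "finite_measure (null_measure borel :: real measure)" by (rule finite_measureI) simp
    show "AE x in null_measure borel. x \<in> {0..1::real}"
      by (rule AE_I[of _ _ UNIV]) auto
  qed simp_all
next
  case False
  define c where "c = m 0 0"
  have c: "c > 0" using False nonneg[of 0 0] by (simp add: c_def)
  have "\<exists>M. real_distribution M \<and> (AE x in M. x \<in> {0..1}) \<and> (\<forall>j. (\<integral>x. x ^ j \<partial>M) = m j 0 / c)"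
  proof (rule Hausdorff_moment_normalized)
    show "m a b / c = m (Suc a) b / c + m a (Suc b) / c" for a b
      by (simp only: add_divide_distrib[symmetric] rec[of a b, symmetric])
  qed (use nonneg c in \<open>auto simp: c_def\<close>)
  then obtain M where M: "real_distribution M" "AE x in M. x \<in> {0..1}" "\<And>j. (\<integral>x. x ^ j \<partial>M) = m j 0 / c"
    by blast
  interpret M: real_distribution M by (rule M(1))
  define N where "N = density M (\<lambda>_. ennreal c)"
  have "finite_measure N" unfolding N_def
    by (rule finite_measureI) (simp add: emeasure_density ennreal_mult_eq_top_iff)
  moreover have "sets N = sets borel" by (simp add: N_def)
  moreover have "AE x in N. x \<in> {0..1}"
    unfolding N_def using M(2) by (subst AE_density) auto
  moreover have "(\<integral>x. x ^ j \<partial>N) = m j 0" for j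
    unfolding N_def using M(3)[of j] c by (subst integral_real_density) simp_all
  ultimately show ?thesis by blast
qed

text \<open>A complex combination of finite measures on \<open>[0, 1]\<close> vanishes as soon as all its moments
  do: the vanishing passes to continuous functions by Weierstrass approximation, to half-lines by
  dominated convergence and to all Borel sets by the \<open>\<pi>\<close>-\<open>\<lambda>\<close> argument.\<close>

lemma moments_determine:
  fixes c :: "'i \<Rightarrow> complex" and M :: "'i \<Rightarrow> real measure"
  assumes I: "finite I"
    and fin: "\<And>i. i \<in> I \<Longrightarrow> finite_measure (M i)"
    and sb: "\<And>i. i \<in> I \<Longrightarrow> sets (M i) = sets borel"
    and ae: "\<And>i. i \<in> I \<Longrightarrow> AE x in M i. x \<in> {0..1}"
    and mom: "\<And>k. (\<Sum>i\<in>I. c i * of_real (\<integral>x. x ^ k \<partial>M i)) = 0"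
    and S: "S \<in> sets borel"
  shows "(\<Sum>i\<in>I. c i * of_real (measure (M i) S)) = 0"
proof -
  define \<Lambda> where "\<Lambda> f = (\<Sum>i\<in>I. c i * of_real (\<integral>x. f x \<partial>M i))" for f :: "real \<Rightarrow> real"
  have meas: "f \<in> borel_measurable (M i)" if "i \<in> I" "f \<in> borel_measurable borel" for f :: "real \<Rightarrow> real" and i
    using that sb measurable_cong_sets[OF sb[OF that(1)] refl] by auto
  have sp: "space (M i) = UNIV" if "i \<in> I" for i
    using sets_eq_imp_space_eq[OF sb[OF that]] by simp
  have intb: "integrable (M i) f"
    if "i \<in> I" "f \<in> borel_measurable borel" "\<And>x. x \<in> {0..1} \<Longrightarrow> \<bar>f x\<bar> \<le> B" for f :: "real \<Rightarrow> real" and i B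
  proof (rule finite_measure.integrable_const_bound[OF fin[OF that(1)]])
    show "AE x in M i. norm (f x) \<le> B" using ae[OF that(1)] by eventually_elim (use that(3) in auto)
  qed (rule meas[OF that(1,2)])
  have poly: "\<Lambda> (\<lambda>x. \<Sum>k\<le>n. a k * x ^ k) = 0" for a :: "nat \<Rightarrow> real" and n
  proof -
    have "(\<integral>x. (\<Sum>k\<le>n. a k * x ^ k) \<partial>M i) = (\<Sum>k\<le>n. a k * (\<integral>x. x ^ k \<partial>M i))" if "i \<in> I" for i
      using intb[OF that, of "\<lambda>x. x ^ _" 1] by (simp add: power_le_one)
    then have "\<Lambda> (\<lambda>x. \<Sum>k\<le>n. a k * x ^ k) = (\<Sum>i\<in>I. \<Sum>k\<le>n. of_real (a k) * (c i * of_real (\<integral>x. x ^ k \<partial>M i)))"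
      unfolding \<Lambda>_def by (intro sum.cong[OF refl]) (simp add: sum_distrib_left mult_ac)
    also have "\<dots> = (\<Sum>k\<le>n. of_real (a k) * (\<Sum>i\<in>I. c i * of_real (\<integral>x. x ^ k \<partial>M i)))"
      by (subst sum.swap) (simp add: sum_distrib_left)
    also have "\<dots> = 0" by (simp add: mom)
    finally show ?thesis .
  qed
  have cont: "\<Lambda> f = 0" if f: "continuous_on UNIV f" for f
  proof -
    have fm: "f \<in> borel_measurable borel" using f by (rule borel_measurable_continuous_onI)
    obtain B where B: "\<And>x. x \<in> {0..1} \<Longrightarrow> \<bar>f x\<bar> \<le> B"
      using compact_continuous_image[OF continuous_on_subset[OF f subset_UNIV] compact_Icc[of 0 1], THEN compact_imp_bounded]
      unfolding bounded_iff by (metis image_eqI real_norm_def)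
    define K where "K = (\<Sum>i\<in>I. cmod (c i) * measure (M i) UNIV)"
    have "cmod (\<Lambda> f) \<le> e * K" if e: "e > 0" for e
    proof -
      obtain p where p: "real_polynomial_function p" and pe: "\<And>x. x \<in> {0..1} \<Longrightarrow> \<bar>f x - p x\<bar> < e"
        using Stone_Weierstrass_real_polynomial_function[OF compact_Icc continuous_on_subset[OF f subset_UNIV] e] by blast
      obtain a n where a: "p = (\<lambda>x. \<Sum>k\<le>n. a k * x ^ k)" using p unfolding real_polynomial_function_iff_sum by auto
      have pm: "p \<in> borel_measurable borel" unfolding a by measurable
      have pB: "\<bar>p x\<bar> \<le> B + e" if "x \<in> {0..1}" for x using pe[OF that] B[OF that] by linarith
      have "\<Lambda> f = \<Lambda> f - \<Lambda> p" using poly[of a n] by (simp add: a)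
      also have "\<dots> = (\<Sum>i\<in>I. c i * of_real (\<integral>x. f x - p x \<partial>M i))"
        unfolding \<Lambda>_def sum_subtractf[symmetric]
      proof (rule sum.cong[OF refl])
        fix i assume i: "i \<in> I"
        have "(\<integral>x. f x - p x \<partial>M i) = (\<integral>x. f x \<partial>M i) - (\<integral>x. p x \<partial>M i)"
          by (rule Bochner_Integration.integral_diff[OF intb[OF i fm B] intb[OF i pm pB]])
        then show "c i * of_real (\<integral>x. f x \<partial>M i) - c i * of_real (\<integral>x. p x \<partial>M i) = c i * of_real (\<integral>x. f x - p x \<partial>M i)"
          by (simp add: right_diff_distrib)
      qed
      also have "cmod \<dots> \<le> (\<Sum>i\<in>I. cmod (c i * of_real (\<integral>x. f x - p x \<partial>M i)))" by (rule norm_sum)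
      also have "\<dots> \<le> (\<Sum>i\<in>I. cmod (c i) * (e * measure (M i) UNIV))"
      proof (rule sum_mono)
        fix i assume i: "i \<in> I"
        interpret finite_measure "M i" by (rule fin[OF i])
        have "\<bar>\<integral>x. f x - p x \<partial>M i\<bar> \<le> (\<integral>x. \<bar>f x - p x\<bar> \<partial>M i)" by (rule integral_abs_bound)
        also have "\<dots> \<le> (\<integral>x. e \<partial>M i)"
        proof (rule integral_mono_AE)
          show "AE x in M i. \<bar>f x - p x\<bar> \<le> e" using ae[OF i] by eventually_elim (use pe in \<open>auto intro: less_imp_le\<close>)
        qed (use intb[OF i fm B] intb[OF i pm pB] in auto)
        finally have "\<bar>\<integral>x. f x - p x \<partial>M i\<bar> \<le> e * measure (M i) UNIV" by (simp add: sp[OF i] mult.commute)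
        then show "cmod (c i * of_real (\<integral>x. f x - p x \<partial>M i)) \<le> cmod (c i) * (e * measure (M i) UNIV)"
          by (simp add: norm_mult mult_left_mono)
      qed
      also have "\<dots> = e * K" by (simp add: K_def sum_distrib_left mult_ac)
      finally show ?thesis .
    qed
    moreover have "K \<ge> 0" unfolding K_def by (intro sum_nonneg) auto
    ultimately have "cmod (\<Lambda> f) = 0"
    proof -
      assume K: "K \<ge> 0" and le: "\<And>e. e > 0 \<Longrightarrow> cmod (\<Lambda> f) \<le> e * K"
      show ?thesis
      proof (rule ccontr)
        assume "cmod (\<Lambda> f) \<noteq> 0"
        then have pos: "cmod (\<Lambda> f) > 0" by simp
        have "cmod (\<Lambda> f) * (K + 1) \<le> cmod (\<Lambda> f) * K"
          using le[of "cmod (\<Lambda> f) / (K + 1)"] K pos by (simp add: field_simps)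
        then show False using pos by (simp add: distrib_left)
      qed
    qed
    then show ?thesis by simp
  qed
  have half: "(\<Sum>i\<in>I. c i * of_real (measure (M i) {..a})) = 0" for a
  proof (rule LIMSEQ_unique)
    define F where "F n x = max 0 (min 1 (1 - real n * (x - a)))" for n x
    have Fm: "F n \<in> borel_measurable borel" for n unfolding F_def by measurable
    have "\<Lambda> (F n) = 0" for n by (rule cont) (unfold F_def, intro continuous_intros)
    then show "(\<lambda>n. \<Lambda> (F n)) \<longlonglongrightarrow> 0" by simp
    have "(\<lambda>n. \<integral>x. F n x \<partial>M i) \<longlonglongrightarrow> measure (M i) {..a}" if i: "i \<in> I" for i
    proof -
      interpret finite_measure "M i" by (rule fin[OF i])
      have "(\<lambda>n. \<integral>x. F n x \<partial>M i) \<longlonglongrightarrow> (\<integral>x. indicator {..a} x \<partial>M i)"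
      proof (rule integral_dominated_convergence[where w = "\<lambda>_. 1"])
        show "AE x in M i. (\<lambda>n. F n x) \<longlonglongrightarrow> indicator {..a} x"
        proof (rule AE_I2)
          fix x
          show "(\<lambda>n. F n x) \<longlonglongrightarrow> indicator {..a} x"
          proof (cases "x \<le> a")
            case True
            then have "F n x = 1" for n by (simp add: F_def mult_nonneg_nonpos)
            then show ?thesis using True by simp
          next
            case False
            obtain N where N: "real N * (x - a) \<ge> 1"
              using False reals_Archimedean3[of "x - a"] by (metis diff_gt_0_iff_gt not_le less_imp_le)
            have "F n x = 0" if "n \<ge> N" for n
            proof -
              have "real n * (x - a) \<ge> real N * (x - a)" using that False by (intro mult_right_mono) auto
              then show ?thesis using N by (simp add: F_def)
            qed
            then have "\<forall>\<^sub>F n in sequentially. F n x = 0" using eventually_sequentially by blast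
            then show ?thesis using False by (simp add: tendsto_eventually)
          qed
        qed
      qed (auto simp: F_def intro!: meas[OF i])
      moreover have "(\<integral>x. indicator {..a} x \<partial>M i) = measure (M i) {..a}" by (simp add: sb[OF i] sp[OF i])
      ultimately show ?thesis by simp
    qed
    then show "(\<lambda>n. \<Lambda> (F n)) \<longlonglongrightarrow> (\<Sum>i\<in>I. c i * of_real (measure (M i) {..a}))"
      unfolding \<Lambda>_def by (intro tendsto_intros)
  qed
  have UN: "(\<Sum>i\<in>I. c i * of_real (measure (M i) UNIV)) = 0"
    using mom[of 0] by (simp add: sp)
  have "Int_stable (range (\<lambda>a::real. {..a}))"
  proof (rule Int_stableI)
    fix A B :: "real set" assume "A \<in> range (\<lambda>a. {..a})" "B \<in> range (\<lambda>a. {..a})"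
    then obtain a b where "A = {..a}" "B = {..b}" by auto
    then have "A \<inter> B = {..min a b}" by auto
    then show "A \<inter> B \<in> range (\<lambda>a. {..a})" by blast
  qed
  moreover have "range (\<lambda>a::real. {..a}) \<subseteq> Pow UNIV" by simp
  moreover have "S \<in> sigma_sets UNIV (range (\<lambda>a::real. {..a}))" using S unfolding borel_eq_atMost by simp
  ultimately show ?thesis
  proof (induction rule: sigma_sets_induct_disjoint)
    case (basic A)
    then show ?case using half by auto
  next
    case empty
    show ?case by simp
  next
    case (compl A)
    then have A: "A \<in> sets borel" unfolding borel_eq_atMost by simp
    have "measure (M i) (UNIV - A) = measure (M i) UNIV - measure (M i) A" if "i \<in> I" for i
      using finite_measure.finite_measure_compl[OF fin[OF that], of A] A by (simp add: sp[OF that] sb[OF that])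
    then have "(\<Sum>i\<in>I. c i * of_real (measure (M i) (UNIV - A)))
       = (\<Sum>i\<in>I. c i * of_real (measure (M i) UNIV)) - (\<Sum>i\<in>I. c i * of_real (measure (M i) A))"
      by (simp add: right_diff_distrib sum_subtractf)
    then show ?case using compl UN by simp
  next
    case (union A)
    then have A: "range A \<subseteq> sets borel" unfolding borel_eq_atMost by simp
    have "(\<lambda>n. measure (M i) (A n)) sums measure (M i) (\<Union>n. A n)" if "i \<in> I" for i
      using finite_measure.finite_measure_UNION[OF fin[OF that], of A] A union by (simp add: sb[OF that])
    then have "(\<lambda>n. \<Sum>i\<in>I. c i * of_real (measure (M i) (A n))) sums (\<Sum>i\<in>I. c i * of_real (measure (M i) (\<Union>n. A n)))"
      by (intro sums_sum sums_mult sums_of_real)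
    then show ?case using union by (simp add: sums_iff)
  qed
qed

section \<open>Functional calculus of a projection-valued measure\<close>

text \<open>Everything in this part holds for an arbitrary projection-valued measure, because the spectral
  measure of an operator is only known through its defining properties.\<close>

locale pvm =
  fixes E :: "real set \<Rightarrow> 'h::complex_hilbert_space \<Rightarrow> 'h"
  assumes pvm: "projection_valued_measure E"
begin

lemma E_clin: "S \<in> sets borel \<Longrightarrow> clin (E S)"
  using pvm by (auto simp: projection_valued_measure_def linear_op_UNIV)

lemma E_idem: "S \<in> sets borel \<Longrightarrow> E S (E S f) = E S f"
  and E_sym: "S \<in> sets borel \<Longrightarrow> cinner (E S f) g = cinner f (E S g)"
  and E_empty: "E {} f = 0" and E_UNIV: "E UNIV f = f"
  and E_Int: "S \<in> sets borel \<Longrightarrow> T \<in> sets borel \<Longrightarrow> E (S \<inter> T) f = E S (E T f)"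
  and E_sums: "range A \<subseteq> sets borel \<Longrightarrow> disjoint_family A \<Longrightarrow> (\<lambda>n. E (A n) f) sums E (\<Union>n. A n) f"
  using pvm by (auto simp: projection_valued_measure_def)

lemma cinner_E: "S \<in> sets borel \<Longrightarrow> cinner (E S f) f = of_real ((norm (E S f))\<^sup>2)"
  by (metis E_idem E_sym cinner_same)

lemma norm_E_le:
  assumes "S \<in> sets borel" shows "norm (E S f) \<le> norm f"
proof -
  have "norm (E S f) * norm (E S f) = cmod (cinner (E S f) f)"
    by (simp add: cinner_E[OF assms] power2_eq_square norm_mult)
  also have "\<dots> \<le> norm (E S f) * norm f" by (rule Cauchy_Schwarz_cinner)
  finally show ?thesis
    by (metis mult_le_cancel_left_pos norm_ge_zero norm_le_zero_iff not_le order.trans)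
qed

lemma E_bounded_linear: "S \<in> sets borel \<Longrightarrow> bounded_linear (E S)"
  by (rule bounded_linear_intro[of _ 1]) (auto simp: clinD[OF E_clin] norm_E_le)

abbreviation mu where "mu f \<equiv> scalar_measure E f"

lemma sets_mu [simp, measurable_cong]: "sets (mu f) = sets borel"
  unfolding scalar_measure_def using sets.sigma_sets_eq[of "borel::real measure"] by (simp add: sets_measure_of_conv)

lemma space_mu [simp]: "space (mu f) = UNIV"
  by (simp add: scalar_measure_def space_measure_of_conv)

lemma emeasure_mu:
  assumes S: "S \<in> sets borel" shows "emeasure (mu f) S = ennreal ((norm (E S f))\<^sup>2)"
proof -
  have "emeasure (mu f) S = ennreal (Re (cinner (E S f) f))"
  proof (rule emeasure_measure_of[OF scalar_measure_def])
    show "positive (sets (mu f)) (\<lambda>S. ennreal (Re (cinner (E S f) f)))"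
      by (simp add: positive_def E_empty cinner.zero_left)
    show "countably_additive (sets (mu f)) (\<lambda>S. ennreal (Re (cinner (E S f) f)))"
    proof (rule countably_additiveI)
      fix A :: "nat \<Rightarrow> real set" assume A: "range A \<subseteq> sets (mu f)" "disjoint_family A"
      then have A': "A i \<in> sets borel" for i by auto
      have "(\<lambda>n. cinner (E (A n) f) f) sums cinner (E (\<Union>n. A n) f) f"
        by (rule bounded_linear.sums[OF cinner.bounded_linear_left E_sums]) (use A in auto)
      then have "(\<lambda>n. Re (cinner (E (A n) f) f)) sums Re (cinner (E (\<Union>n. A n) f) f)"
        by (rule sums_Re)
      then show "(\<Sum>i. ennreal (Re (cinner (E (A i) f) f))) = ennreal (Re (cinner (E (\<Union>i. A i) f) f))"
        by (intro suminf_ennreal_eq) (simp_all add: cinner_E[OF A'])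
    qed
  qed (use S in auto)
  then show ?thesis by (simp add: cinner_E[OF S])
qed

lemma finite_mu [simp]: "finite_measure (mu f)"
  by (rule finite_measureI) (simp add: emeasure_mu)

lemma measure_mu: "S \<in> sets borel \<Longrightarrow> measure (mu f) S = (norm (E S f))\<^sup>2"
  by (simp add: measure_def emeasure_mu)

lemma mu_E: "S \<in> sets borel \<Longrightarrow> T \<in> sets borel \<Longrightarrow> emeasure (mu (E S f)) T = emeasure (mu f) (S \<inter> T)"
  by (simp add: emeasure_mu E_Int[symmetric] Int_commute)

lemma integrable_mu_bounded:
  fixes h :: "real \<Rightarrow> real"
  shows "h \<in> borel_measurable borel \<Longrightarrow> (\<And>x. \<bar>h x\<bar> \<le> B) \<Longrightarrow> integrable (mu f) h"
  by (rule finite_measure.integrable_const_bound[of _ _ B]) auto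

subsection \<open>Simple functions\<close>

text \<open>The operator \<open>\<integral> s dE\<close> of a simple function \<open>s\<close>.\<close>

definition sop :: "(real \<Rightarrow> real) \<Rightarrow> 'h \<Rightarrow> 'h" where
  "sop s f = (\<Sum>y\<in>range s. y *\<^sub>R E (s -` {y}) f)"

abbreviation "simple \<equiv> simple_function (borel :: real measure)"

lemma simpleD:
  fixes s :: "real \<Rightarrow> real"
  assumes "simple s"
  shows simple_finite: "finite (range s)" and simple_vimage: "s -` {y} \<in> sets borel"
    and simple_measurable: "s \<in> borel_measurable borel"
    and simple_bounded: "\<exists>B. \<forall>x. \<bar>s x\<bar> \<le> B"
proof -
  show f: "finite (range s)" using assms by (simp add: simple_function_def)
  show m: "s \<in> borel_measurable borel" using assms by (rule borel_measurable_simple_function)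
  show "s -` {y} \<in> sets borel" using measurable_sets[OF m, of "{y}"] by simp
  have "finite ((\<lambda>y. \<bar>y\<bar>) ` range s)" using f by simp
  then have "\<bar>s x\<bar> \<le> Max ((\<lambda>y. \<bar>y\<bar>) ` range s)" for x by (intro Max_ge) auto
  then show "\<exists>B. \<forall>x. \<bar>s x\<bar> \<le> B" by blast
qed

lemma sop_clin: "simple s \<Longrightarrow> clin (sop s)"
  unfolding clin_def sop_def
  by (simp add: clinD[OF E_clin[OF simple_vimage]] scaleR_add_right sum.distrib scaleC_scaleR[symmetric]
      clin_sum[of "\<lambda>x. _ *\<^sub>C x", symmetric] clin_def scaleC_add_right scaleC_scaleC mult.commute)

lemma sop_bounded_linear: "simple s \<Longrightarrow> bounded_linear (sop s)"
  unfolding sop_def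
  by (intro bounded_linear_sum bounded_linear_scaleR_right[THEN bounded_linear_compose] E_bounded_linear simple_vimage)

lemma sop_sym: "simple s \<Longrightarrow> cinner (sop s f) g = cinner f (sop s g)"
  by (simp add: sop_def cinner.sum_left cinner.sum_right cinner_scaleR_left cinner_scaleR_right E_sym simple_vimage)

lemma sop_indicator:
  assumes T: "T \<in> sets borel" shows "sop (indicator T) f = E T f"
proof -
  have "sop (indicator T) f = (\<Sum>y\<in>{0,1}. y *\<^sub>R E ((indicator T :: real \<Rightarrow> real) -` {y}) f)"
    unfolding sop_def
  proof (rule sum.mono_neutral_left)
    show "\<forall>y\<in>{0,1} - range (indicator T). y *\<^sub>R E ((indicator T :: real \<Rightarrow> real) -` {y}) f = 0"
    proof
      fix y assume "y \<in> {0,1} - range (indicator T :: real \<Rightarrow> real)"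
      then have "(indicator T :: real \<Rightarrow> real) -` {y} = {}" by auto
      then show "y *\<^sub>R E ((indicator T :: real \<Rightarrow> real) -` {y}) f = 0" by (simp only: E_empty scaleR_zero_right)
    qed
  qed (auto simp: indicator_def)
  also have "\<dots> = E ((indicator T :: real \<Rightarrow> real) -` {1}) f" by simp
  also have "(indicator T :: real \<Rightarrow> real) -` {1} = T" by (auto simp: indicator_def)
  finally show ?thesis .
qed

lemma simple_indicator: "T \<in> sets borel \<Longrightarrow> simple (indicator T)"
  by (rule simple_function_indicator) auto

lemma sop_one: "sop (\<lambda>_. 1) f = f"
  using sop_indicator[of UNIV f] by (simp add: E_UNIV indicator_def[abs_def])

lemma simple_eq_sum:
  fixes s :: "real \<Rightarrow> real"
  assumes "simple s" shows "s x = (\<Sum>y\<in>range s. y * indicator (s -` {y}) x)"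
proof -
  have "(\<Sum>y\<in>range s. y * indicator (s -` {y}) x) = (\<Sum>y\<in>{s x}. y * indicator (s -` {y}) x)"
    by (rule sum.mono_neutral_right) (auto simp: simple_finite[OF assms])
  then show ?thesis by simp
qed

text \<open>The multiplicativity of \<open>E\<close>, expressed with three factors: the limits of this identity give the
  inner products \<open>\<langle>\<phi>(E) f, \<psi>(E) f\<rangle>\<close>, the scalar measure of \<open>\<phi>(E) f\<close> and the composition
  \<open>\<psi>(E) \<phi>(E) f\<close>.\<close>

lemma sop_triple:
  assumes s: "simple s" and t: "simple t" and r: "simple r"
  shows "cinner (sop t (sop s f)) (sop r f) = of_real (\<integral>x. t x * s x * r x \<partial>mu f)"
proof -
  let ?A = "\<lambda>y. t -` {y}" and ?B = "\<lambda>z. s -` {z}" and ?C = "\<lambda>w. r -` {w}"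
  note [measurable] = simple_vimage[OF s] simple_vimage[OF t] simple_vimage[OF r]
  have tri: "cinner (E (?A y) (E (?B z) f)) (E (?C w) f) = of_real (measure (mu f) (?A y \<inter> ?B z \<inter> ?C w))" for y z w
  proof -
    have "cinner (E (?A y) (E (?B z) f)) (E (?C w) f) = cinner (E (?C w \<inter> (?A y \<inter> ?B z)) f) f"
      by (simp add: E_Int E_sym)
    then show ?thesis by (simp add: cinner_E measure_mu Int_ac)
  qed
  have "cinner (sop t (sop s f)) (sop r f)
      = (\<Sum>w\<in>range r. \<Sum>y\<in>range t. \<Sum>z\<in>range s. of_real (w * y * z * measure (mu f) (?A y \<inter> ?B z \<inter> ?C w)))"
    unfolding sop_def
    by (simp add: clin_sum[OF E_clin] clin_scaleR[OF E_clin] simple_vimage[OF t] cinner.sum_left cinner.sum_right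
        cinner_scaleR_left cinner_scaleR_right tri sum_distrib_left mult_ac scaleR_sum_right)
  also have "\<dots> = of_real (\<Sum>w\<in>range r. \<Sum>y\<in>range t. \<Sum>z\<in>range s. w * y * z * measure (mu f) (?A y \<inter> ?B z \<inter> ?C w))"
    by simp
  also have "(\<Sum>w\<in>range r. \<Sum>y\<in>range t. \<Sum>z\<in>range s. w * y * z * measure (mu f) (?A y \<inter> ?B z \<inter> ?C w))
     = (\<integral>x. (\<Sum>w\<in>range r. \<Sum>y\<in>range t. \<Sum>z\<in>range s. w * y * z * indicator (?A y \<inter> ?B z \<inter> ?C w) x) \<partial>mu f)"
  proof -
    have i: "integrable (mu f) (\<lambda>x. w * y * z * indicator (?A y \<inter> ?B z \<inter> ?C w) x)" for y z w :: real
      by (rule integrable_mult_right, rule integrable_real_indicator) (auto simp: emeasure_mu)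
    have "(\<integral>x. (\<Sum>w\<in>range r. \<Sum>y\<in>range t. \<Sum>z\<in>range s. w * y * z * indicator (?A y \<inter> ?B z \<inter> ?C w) x) \<partial>mu f) = (\<Sum>w\<in>range r. (\<integral>x. (\<Sum>y\<in>range t. \<Sum>z\<in>range s. w * y * z * indicator (?A y \<inter> ?B z \<inter> ?C w) x) \<partial>mu f))"
      by (intro Bochner_Integration.integral_sum Bochner_Integration.integrable_sum i)
    also have "\<dots> = (\<Sum>w\<in>range r. \<Sum>y\<in>range t. (\<integral>x. (\<Sum>z\<in>range s. w * y * z * indicator (?A y \<inter> ?B z \<inter> ?C w) x) \<partial>mu f))"
      by (intro sum.cong refl Bochner_Integration.integral_sum Bochner_Integration.integrable_sum i)
    also have "\<dots> = (\<Sum>w\<in>range r. \<Sum>y\<in>range t. \<Sum>z\<in>range s. (\<integral>x. w * y * z * indicator (?A y \<inter> ?B z \<inter> ?C w) x \<partial>mu f))"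
      by (intro sum.cong refl Bochner_Integration.integral_sum Bochner_Integration.integrable_sum i)
    also have "\<dots> = (\<Sum>w\<in>range r. \<Sum>y\<in>range t. \<Sum>z\<in>range s. w * y * z * measure (mu f) (?A y \<inter> ?B z \<inter> ?C w))"
      by simp
    finally show ?thesis ..
  qed
  also have "\<dots> = (\<integral>x. t x * s x * r x \<partial>mu f)"
  proof (rule Bochner_Integration.integral_cong[OF refl])
    fix x
    have "t x * s x * r x = (\<Sum>w\<in>range r. w * indicator (?C w) x) * ((\<Sum>y\<in>range t. y * indicator (?A y) x) * (\<Sum>z\<in>range s. z * indicator (?B z) x))"
      by (simp only: simple_eq_sum[OF s, symmetric] simple_eq_sum[OF t, symmetric] simple_eq_sum[OF r, symmetric] mult_ac)
    also have "\<dots> = (\<Sum>w\<in>range r. \<Sum>y\<in>range t. \<Sum>z\<in>range s. w * y * z * indicator (?A y \<inter> ?B z \<inter> ?C w) x)"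
      unfolding sum_product
      unfolding sum_distrib_left by (simp add: indicator_inter_arith mult_ac)
    finally show "(\<Sum>w\<in>range r. \<Sum>y\<in>range t. \<Sum>z\<in>range s. w * y * z * indicator (?A y \<inter> ?B z \<inter> ?C w) x) = t x * s x * r x" ..
  qed
  finally show ?thesis .
qed

lemma sop_cinner:
  assumes "simple s" "simple r"
  shows "cinner (sop s f) (sop r f) = of_real (\<integral>x. s x * r x \<partial>mu f)"
  using sop_triple[OF assms(1) _ assms(2), of "\<lambda>_. 1" f] by (simp add: sop_one)

lemma sop_quadratic: "simple s \<Longrightarrow> cinner (sop s f) f = of_real (\<integral>x. s x \<partial>mu f)"
  using sop_cinner[of s "\<lambda>_. 1" f] by (simp add: sop_one)


lemma simple_integrable:
  fixes s :: "real \<Rightarrow> real"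
  shows "simple s \<Longrightarrow> integrable (mu f) s"
  using simple_bounded[of s] simple_measurable[of s] by (auto intro: integrable_mu_bounded)

lemma simple_mult_integrable:
  fixes s :: "real \<Rightarrow> real"
  assumes "simple s" "integrable (mu f) h" shows "integrable (mu f) (\<lambda>x. h x * s x)"
proof -
  obtain B where B: "\<And>x. \<bar>s x\<bar> \<le> B" using simple_bounded[OF assms(1)] by blast
  have [measurable]: "s \<in> borel_measurable borel" "h \<in> borel_measurable borel"
    using simple_measurable[OF assms(1)] borel_measurable_integrable[OF assms(2)] by simp_all
  show ?thesis
  proof (rule Bochner_Integration.integrable_bound)
    show "integrable (mu f) (\<lambda>x. B * h x)" using assms(2) by simp
    show "AE x in mu f. norm (h x * s x) \<le> norm (B * h x)"
    proof (rule AE_I2)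
      fix x
      have "\<bar>s x\<bar> \<le> \<bar>B\<bar>" using B[of x] by linarith
      then show "norm (h x * s x) \<le> norm (B * h x)" by (simp add: abs_mult mult.commute[of "\<bar>B\<bar>"] mult_left_mono)
    qed
  qed simp
qed

lemma sop_norm: "simple s \<Longrightarrow> (norm (sop s f))\<^sup>2 = (\<integral>x. (s x)\<^sup>2 \<partial>mu f)"
  unfolding Re_cinner_same[symmetric] by (simp add: sop_cinner power2_eq_square)

lemma sop_diff_norm:
  assumes s: "simple s" and t: "simple t"
  shows "(norm (sop s f - sop t f))\<^sup>2 = (\<integral>x. (s x - t x)\<^sup>2 \<partial>mu f)"
proof -
  note i = simple_mult_integrable[OF s simple_integrable[OF s]] simple_mult_integrable[OF t simple_integrable[OF t]]
      simple_mult_integrable[OF t simple_integrable[OF s]]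
  have "(\<integral>x. (s x - t x)\<^sup>2 \<partial>mu f) = (\<integral>x. (s x * s x + t x * t x) - 2 * (s x * t x) \<partial>mu f)"
    by (simp add: power2_eq_square algebra_simps)
  also have "\<dots> = (\<integral>x. s x * s x \<partial>mu f) + (\<integral>x. t x * t x \<partial>mu f) - 2 * (\<integral>x. s x * t x \<partial>mu f)"
    using i by simp
  also have "\<dots> = (norm (sop s f - sop t f))\<^sup>2"
    unfolding norm_diff_square sop_norm[OF s] sop_norm[OF t] sop_cinner[OF s t] Re_complex_of_real
    by (simp add: power2_eq_square)
  finally show ?thesis ..
qed

subsection \<open>Unbounded functions\<close>

text \<open>A fixed sequence of simple functions converging to \<open>\<phi>\<close> and dominated by \<open>2 \<bar>\<phi>\<bar>\<close>. As it does not depend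
  on the vector, the linearity of \<open>spec \<phi>\<close> follows from that of the \<open>sop\<close>.\<close>

definition sseq :: "(real \<Rightarrow> real) \<Rightarrow> nat \<Rightarrow> real \<Rightarrow> real" where
  "sseq \<phi> = (SOME F. (\<forall>i. simple (F i)) \<and> (\<forall>x. (\<lambda>i. F i x) \<longlonglongrightarrow> \<phi> x) \<and> (\<forall>i x. \<bar>F i x\<bar> \<le> 2 * \<bar>\<phi> x\<bar>))"

definition spec :: "(real \<Rightarrow> real) \<Rightarrow> 'h \<Rightarrow> 'h" where
  "spec \<phi> f = lim (\<lambda>n. sop (sseq \<phi> n) f)"

lemma sseq:
  assumes "\<phi> \<in> borel_measurable borel"
  shows sseq_simple: "simple (sseq \<phi> n)" and sseq_lim: "(\<lambda>i. sseq \<phi> i x) \<longlonglongrightarrow> \<phi> x"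
    and sseq_bound: "\<bar>sseq \<phi> n x\<bar> \<le> 2 * \<bar>\<phi> x\<bar>"
proof -
  have "\<exists>F. (\<forall>i. simple (F i)) \<and> (\<forall>x. (\<lambda>i. F i x) \<longlonglongrightarrow> \<phi> x) \<and> (\<forall>i x. \<bar>F i x\<bar> \<le> 2 * \<bar>\<phi> x\<bar>)"
    using borel_measurable_implies_sequence_metric[OF assms, of 0] by (auto simp: dist_real_def)
  from someI_ex[OF this, folded sseq_def] show "simple (sseq \<phi> n)" "(\<lambda>i. sseq \<phi> i x) \<longlonglongrightarrow> \<phi> x" "\<bar>sseq \<phi> n x\<bar> \<le> 2 * \<bar>\<phi> x\<bar>"
    by blast+
qed

lemma sseq_integral_lim:
  assumes m: "\<phi> \<in> borel_measurable borel" "h \<in> borel_measurable borel"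
    and i: "integrable (mu f) (\<lambda>x. \<phi> x * h x)"
  shows "(\<lambda>n. \<integral>x. sseq \<phi> n x * h x \<partial>mu f) \<longlonglongrightarrow> (\<integral>x. \<phi> x * h x \<partial>mu f)"
proof (rule integral_dominated_convergence)
  note [measurable] = m simple_measurable[OF sseq_simple[OF m(1)]]
  show "(\<lambda>x. \<phi> x * h x) \<in> borel_measurable (mu f)" by simp
  show "(\<lambda>x. sseq \<phi> n x * h x) \<in> borel_measurable (mu f)" for n by simp
  show "integrable (mu f) (\<lambda>x. 2 * \<bar>\<phi> x * h x\<bar>)" using i by simp
  show "AE x in mu f. (\<lambda>n. sseq \<phi> n x * h x) \<longlonglongrightarrow> \<phi> x * h x"
    by (intro AE_I2 tendsto_intros sseq_lim m)
  show "AE x in mu f. norm (sseq \<phi> n x * h x) \<le> 2 * \<bar>\<phi> x * h x\<bar>" for n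
    by (rule AE_I2) (simp add: abs_mult mult.assoc[symmetric] mult_right_mono sseq_bound[OF m(1)])
qed

abbreviation "D \<phi> \<equiv> spectral_domain E \<phi>"

lemma D_iff:
  assumes [measurable]: "\<phi> \<in> borel_measurable borel"
  shows "f \<in> D \<phi> \<longleftrightarrow> integrable (mu f) (\<lambda>x. (\<phi> x)\<^sup>2)"
  unfolding spectral_domain_def by (simp add: integrable_iff_bounded)

lemma D_prod_integrable:
  assumes m [measurable]: "\<phi> \<in> borel_measurable borel" "\<psi> \<in> borel_measurable borel"
    and "f \<in> D \<phi>" "f \<in> D \<psi>"
  shows "integrable (mu f) (\<lambda>x. \<phi> x * \<psi> x)"
proof (rule Bochner_Integration.integrable_bound)
  show "integrable (mu f) (\<lambda>x. (\<phi> x)\<^sup>2 + (\<psi> x)\<^sup>2)"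
    using assms by (simp add: D_iff)
  have "\<bar>a * b\<bar> \<le> a\<^sup>2 + b\<^sup>2" for a b :: real
  proof -
    have "2 * \<bar>a * b\<bar> \<le> a\<^sup>2 + b\<^sup>2" using sum_squares_bound[of "\<bar>a\<bar>" "\<bar>b\<bar>"] by (simp add: abs_mult)
    then show ?thesis using abs_ge_zero[of "a * b"] by linarith
  qed
  then show "AE x in mu f. norm (\<phi> x * \<psi> x) \<le> norm ((\<phi> x)\<^sup>2 + (\<psi> x)\<^sup>2)"
    by (intro AE_I2) simp
qed simp

lemma D_bounded:
  assumes [measurable]: "\<phi> \<in> borel_measurable borel" and "\<And>x. \<bar>\<phi> x\<bar> \<le> B"
  shows "f \<in> D \<phi>"
proof -
  have "\<bar>(\<phi> x)\<^sup>2\<bar> \<le> B\<^sup>2" for x using power_mono[OF assms(2)[of x], of 2] by simp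
  then have "integrable (mu f) (\<lambda>x. (\<phi> x)\<^sup>2)" by (intro integrable_mu_bounded[of _ "B\<^sup>2"]) measurable
  then show ?thesis by (simp add: D_iff)
qed

lemma D_one: "f \<in> D (\<lambda>_. 1)" by (rule D_bounded[of _ 1]) auto

lemma D_integrable: "\<phi> \<in> borel_measurable borel \<Longrightarrow> f \<in> D \<phi> \<Longrightarrow> integrable (mu f) \<phi>"
  using D_prod_integrable[of \<phi> "\<lambda>_. 1" f] D_one by simp

text \<open>The isometry \<open>\<parallel>sop s f - sop t f\<parallel>\<^sup>2 = \<integral> (s - t)\<^sup>2 d\<mu>\<^sub>f\<close> turns convergence in \<open>L\<^sup>2(\<mu>\<^sub>f)\<close>, which holds by
  domination, into convergence of the vectors.\<close>

lemma spec_lim: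
  assumes m [measurable]: "\<phi> \<in> borel_measurable borel" and f: "f \<in> D \<phi>"
  shows "(\<lambda>n. sop (sseq \<phi> n) f) \<longlonglongrightarrow> spec \<phi> f"
proof -
  note sm [measurable] = simple_measurable[OF sseq_simple[OF m]]
  define e where "e n = (\<integral>x. (sseq \<phi> n x - \<phi> x)\<^sup>2 \<partial>mu f)" for n
  have bd: "(sseq \<phi> n x - \<phi> x)\<^sup>2 \<le> 9 * (\<phi> x)\<^sup>2" for n x
  proof -
    have "\<bar>sseq \<phi> n x - \<phi> x\<bar> \<le> 3 * \<bar>\<phi> x\<bar>" using sseq_bound[OF m, of n x] by linarith
    then show ?thesis using power_mono[of "\<bar>sseq \<phi> n x - \<phi> x\<bar>" "3 * \<bar>\<phi> x\<bar>" 2] by (simp add: power_mult_distrib)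
  qed
  have i9: "integrable (mu f) (\<lambda>x. 9 * (\<phi> x)\<^sup>2)" using f by (simp add: D_iff)
  have ie: "integrable (mu f) (\<lambda>x. (sseq \<phi> n x - \<phi> x)\<^sup>2)" for n
    by (rule Bochner_Integration.integrable_bound[OF i9]) (auto simp: bd)
  have "e \<longlonglongrightarrow> (\<integral>x. 0 \<partial>mu f)" unfolding e_def
  proof (rule integral_dominated_convergence[OF _ _ i9])
    show "AE x in mu f. (\<lambda>n. (sseq \<phi> n x - \<phi> x)\<^sup>2) \<longlonglongrightarrow> 0"
    proof (rule AE_I2)
      fix x
      have "(\<lambda>n. (sseq \<phi> n x - \<phi> x)\<^sup>2) \<longlonglongrightarrow> (\<phi> x - \<phi> x)\<^sup>2" by (intro tendsto_intros sseq_lim m)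
      then show "(\<lambda>n. (sseq \<phi> n x - \<phi> x)\<^sup>2) \<longlonglongrightarrow> 0" by simp
    qed
  qed (auto simp: bd)
  then have e0: "e \<longlonglongrightarrow> 0" by simp
  have est: "(norm (sop (sseq \<phi> i) f - sop (sseq \<phi> j) f))\<^sup>2 \<le> 2 * e i + 2 * e j" for i j
  proof -
    have "(norm (sop (sseq \<phi> i) f - sop (sseq \<phi> j) f))\<^sup>2 = (\<integral>x. (sseq \<phi> i x - sseq \<phi> j x)\<^sup>2 \<partial>mu f)"
      by (rule sop_diff_norm; rule sseq_simple[OF m])
    also have "\<dots> \<le> (\<integral>x. 2 * (sseq \<phi> i x - \<phi> x)\<^sup>2 + 2 * (sseq \<phi> j x - \<phi> x)\<^sup>2 \<partial>mu f)"
    proof (rule integral_mono')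
      show "integrable (mu f) (\<lambda>x. 2 * (sseq \<phi> i x - \<phi> x)\<^sup>2 + 2 * (sseq \<phi> j x - \<phi> x)\<^sup>2)" using ie by simp
      have "(a - b)\<^sup>2 \<le> 2 * (a - c)\<^sup>2 + 2 * (b - c)\<^sup>2" for a b c :: real
        using zero_le_power2[of "(a - c) + (b - c)"] by (simp add: power2_eq_square algebra_simps)
      then show "(sseq \<phi> i x - sseq \<phi> j x)\<^sup>2 \<le> 2 * (sseq \<phi> i x - \<phi> x)\<^sup>2 + 2 * (sseq \<phi> j x - \<phi> x)\<^sup>2" for x .
    qed simp
    also have "\<dots> = 2 * e i + 2 * e j" unfolding e_def using ie by simp
    finally show ?thesis .
  qed
  have "Cauchy (\<lambda>n. sop (sseq \<phi> n) f)"
  proof (rule metric_CauchyI)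
    fix \<epsilon> :: real assume \<epsilon>: "\<epsilon> > 0"
    then have "\<forall>\<^sub>F n in sequentially. e n < \<epsilon>\<^sup>2 / 4" by (intro order_tendstoD(2)[OF e0]) simp
    then obtain N where N: "\<And>n. n \<ge> N \<Longrightarrow> e n < \<epsilon>\<^sup>2 / 4" unfolding eventually_sequentially by blast
    have "dist (sop (sseq \<phi> i) f) (sop (sseq \<phi> j) f) < \<epsilon>" if "i \<ge> N" "j \<ge> N" for i j
    proof -
      have "(norm (sop (sseq \<phi> i) f - sop (sseq \<phi> j) f))\<^sup>2 < \<epsilon>\<^sup>2" using est[of i j] N[OF that(1)] N[OF that(2)] by argo
      then show ?thesis using \<epsilon> by (simp add: dist_norm power2_less_imp_less)
    qed
    then show "\<exists>M. \<forall>m\<ge>M. \<forall>n\<ge>M. dist (sop (sseq \<phi> m) f) (sop (sseq \<phi> n) f) < \<epsilon>" by blast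
  qed
  then show ?thesis unfolding spec_def by (simp add: Cauchy_convergent_iff convergent_LIMSEQ_iff)
qed

text \<open>The limit in \<open>sop_triple\<close> is taken one factor at a time: here in \<open>s\<close>, then in \<open>r\<close>
  (\<open>spec_cinner_sop\<close>), finally in \<open>t\<close> (\<open>spec_cinner3\<close>).\<close>

lemma spec_cinner_sop2:
  assumes m [measurable]: "\<phi> \<in> borel_measurable borel" and f: "f \<in> D \<phi>" and t: "simple t" and r: "simple r"
  shows "cinner (sop t (spec \<phi> f)) (sop r f) = of_real (\<integral>x. t x * \<phi> x * r x \<partial>mu f)"
proof (rule LIMSEQ_unique)
  note [measurable] = simple_measurable[OF t] simple_measurable[OF r]
  show "(\<lambda>n. cinner (sop t (sop (sseq \<phi> n) f)) (sop r f)) \<longlonglongrightarrow> cinner (sop t (spec \<phi> f)) (sop r f)"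
    by (intro cinner.tendsto bounded_linear.tendsto[OF sop_bounded_linear[OF t]] spec_lim tendsto_const assms)
  have "(\<lambda>n. \<integral>x. sseq \<phi> n x * (t x * r x) \<partial>mu f) \<longlonglongrightarrow> (\<integral>x. \<phi> x * (t x * r x) \<partial>mu f)"
    using simple_mult_integrable[OF r simple_mult_integrable[OF t D_integrable[OF m f]]]
    by (intro sseq_integral_lim m) (simp_all add: mult_ac)
  then show "(\<lambda>n. cinner (sop t (sop (sseq \<phi> n) f)) (sop r f)) \<longlonglongrightarrow> of_real (\<integral>x. t x * \<phi> x * r x \<partial>mu f)"
    by (simp add: sop_triple[OF sseq_simple[OF m] t r] tendsto_of_real_iff mult_ac)
qed

lemma spec_cinner_sop:
  assumes m [measurable]: "\<phi> \<in> borel_measurable borel" "\<xi> \<in> borel_measurable borel"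
    and f: "f \<in> D \<phi>" "f \<in> D \<xi>" and t: "simple t"
  shows "cinner (sop t (spec \<phi> f)) (spec \<xi> f) = of_real (\<integral>x. t x * \<phi> x * \<xi> x \<partial>mu f)"
proof (rule LIMSEQ_unique)
  note [measurable] = simple_measurable[OF t]
  show "(\<lambda>n. cinner (sop t (spec \<phi> f)) (sop (sseq \<xi> n) f)) \<longlonglongrightarrow> cinner (sop t (spec \<phi> f)) (spec \<xi> f)"
    by (intro cinner.tendsto spec_lim tendsto_const assms)
  have "(\<lambda>n. \<integral>x. sseq \<xi> n x * (\<phi> x * t x) \<partial>mu f) \<longlonglongrightarrow> (\<integral>x. \<xi> x * (\<phi> x * t x) \<partial>mu f)"
    using simple_mult_integrable[OF t D_prod_integrable[OF m f]]
    by (intro sseq_integral_lim m) (simp_all add: mult_ac)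
  then show "(\<lambda>n. cinner (sop t (spec \<phi> f)) (sop (sseq \<xi> n) f)) \<longlonglongrightarrow> of_real (\<integral>x. t x * \<phi> x * \<xi> x \<partial>mu f)"
    by (simp add: spec_cinner_sop2[OF m(1) f(1) t sseq_simple[OF m(2)]] tendsto_of_real_iff mult_ac)
qed

lemma spec_cinner:
  assumes "\<phi> \<in> borel_measurable borel" "\<xi> \<in> borel_measurable borel" "f \<in> D \<phi>" "f \<in> D \<xi>"
  shows "cinner (spec \<phi> f) (spec \<xi> f) = of_real (\<integral>x. \<phi> x * \<xi> x \<partial>mu f)"
  using spec_cinner_sop[OF assms, of "\<lambda>_. 1"] by (simp add: sop_one)

lemma spec_norm:
  assumes "\<phi> \<in> borel_measurable borel" "f \<in> D \<phi>"
  shows "(norm (spec \<phi> f))\<^sup>2 = (\<integral>x. (\<phi> x)\<^sup>2 \<partial>mu f)"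
  unfolding Re_cinner_same[symmetric] by (simp add: spec_cinner assms power2_eq_square)

lemma mu_spec:
  assumes m [measurable]: "\<phi> \<in> borel_measurable borel" and f: "f \<in> D \<phi>"
  shows "mu (spec \<phi> f) = density (mu f) (\<lambda>x. ennreal ((\<phi> x)\<^sup>2))"
proof (rule measure_eqI)
  fix T assume "T \<in> sets (mu (spec \<phi> f))"
  then have T [measurable]: "T \<in> sets borel" by simp
  have i: "integrable (mu f) (\<lambda>x. (\<phi> x)\<^sup>2 * indicator T x)"
    using simple_mult_integrable[OF simple_indicator[OF T]] f by (simp add: D_iff)
  have "of_real ((norm (E T (spec \<phi> f)))\<^sup>2) = (of_real (\<integral>x. indicator T x * \<phi> x * \<phi> x \<partial>mu f) :: complex)"
    using spec_cinner_sop[OF m m f f simple_indicator[OF T]] by (simp only: sop_indicator[OF T] cinner_E[OF T])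
  then have "(norm (E T (spec \<phi> f)))\<^sup>2 = (\<integral>x. (\<phi> x)\<^sup>2 * indicator T x \<partial>mu f)"
    by (simp only: of_real_eq_iff) (simp add: power2_eq_square mult_ac)
  moreover have "emeasure (density (mu f) (\<lambda>x. ennreal ((\<phi> x)\<^sup>2))) T = ennreal (\<integral>x. (\<phi> x)\<^sup>2 * indicator T x \<partial>mu f)"
    using i by (simp add: emeasure_density nn_integral_eq_integral[symmetric] ennreal_mult ennreal_indicator)
  ultimately show "emeasure (mu (spec \<phi> f)) T = emeasure (density (mu f) (\<lambda>x. ennreal ((\<phi> x)\<^sup>2))) T"
    by (simp add: emeasure_mu)
qed simp

lemma spec_cinner3:
  assumes m [measurable]: "\<phi> \<in> borel_measurable borel" "\<psi> \<in> borel_measurable borel" "\<xi> \<in> borel_measurable borel"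
    and f: "f \<in> D \<phi>" "spec \<phi> f \<in> D \<psi>" "f \<in> D \<xi>" and i: "integrable (mu f) (\<lambda>x. \<psi> x * \<phi> x * \<xi> x)"
  shows "cinner (spec \<psi> (spec \<phi> f)) (spec \<xi> f) = of_real (\<integral>x. \<psi> x * \<phi> x * \<xi> x \<partial>mu f)"
proof (rule LIMSEQ_unique)
  show "(\<lambda>n. cinner (sop (sseq \<psi> n) (spec \<phi> f)) (spec \<xi> f)) \<longlonglongrightarrow> cinner (spec \<psi> (spec \<phi> f)) (spec \<xi> f)"
    by (intro cinner.tendsto spec_lim tendsto_const assms)
  have "(\<lambda>n. \<integral>x. sseq \<psi> n x * (\<phi> x * \<xi> x) \<partial>mu f) \<longlonglongrightarrow> (\<integral>x. \<psi> x * (\<phi> x * \<xi> x) \<partial>mu f)"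
    using i by (intro sseq_integral_lim m) (simp_all add: mult_ac)
  then show "(\<lambda>n. cinner (sop (sseq \<psi> n) (spec \<phi> f)) (spec \<xi> f)) \<longlonglongrightarrow> of_real (\<integral>x. \<psi> x * \<phi> x * \<xi> x \<partial>mu f)"
    by (simp add: spec_cinner_sop[OF m(1,3) f(1,3) sseq_simple[OF m(2)]] tendsto_of_real_iff mult_ac)
qed

lemma spec_D_iff:
  assumes m [measurable]: "\<phi> \<in> borel_measurable borel" "\<psi> \<in> borel_measurable borel" and f: "f \<in> D \<phi>"
  shows "spec \<phi> f \<in> D \<psi> \<longleftrightarrow> f \<in> D (\<lambda>x. \<psi> x * \<phi> x)"
  unfolding spectral_domain_def
  by (simp add: mu_spec[OF m(1) f] nn_integral_density power_mult_distrib ennreal_mult mult.commute)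

text \<open>Both sides have the same norm, and their inner product is its square.\<close>

lemma spec_spec:
  assumes m [measurable]: "\<phi> \<in> borel_measurable borel" "\<psi> \<in> borel_measurable borel"
    and f: "f \<in> D \<phi>" and fc: "f \<in> D (\<lambda>x. \<psi> x * \<phi> x)"
  shows "spec \<psi> (spec \<phi> f) = spec (\<lambda>x. \<psi> x * \<phi> x) f"
proof -
  define \<xi> where "\<xi> = (\<lambda>x. \<psi> x * \<phi> x)"
  have [measurable]: "\<xi> \<in> borel_measurable borel" unfolding \<xi>_def by measurable
  have fc: "f \<in> D \<xi>" using fc by (simp add: \<xi>_def)
  have d: "spec \<phi> f \<in> D \<psi>" using spec_D_iff[OF m f] fc by (simp add: \<xi>_def)
  have i: "integrable (mu f) (\<lambda>x. (\<xi> x)\<^sup>2)" using fc by (simp add: D_iff)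
  have 1: "(norm (spec \<psi> (spec \<phi> f)))\<^sup>2 = (\<integral>x. (\<xi> x)\<^sup>2 \<partial>mu f)"
    by (simp add: spec_norm[OF m(2) d] mu_spec[OF m(1) f] integral_real_density \<xi>_def power_mult_distrib mult.commute)
  have 2: "(norm (spec \<xi> f))\<^sup>2 = (\<integral>x. (\<xi> x)\<^sup>2 \<partial>mu f)" by (simp add: spec_norm fc)
  have 3: "cinner (spec \<psi> (spec \<phi> f)) (spec \<xi> f) = of_real (\<integral>x. (\<xi> x)\<^sup>2 \<partial>mu f)"
    using spec_cinner3[OF m(1,2) _ f d fc] i by (simp add: \<xi>_def power2_eq_square mult_ac)
  have "(norm (spec \<psi> (spec \<phi> f) - spec \<xi> f))\<^sup>2 = 0"
    by (simp add: norm_diff_square 1 2 3)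
  then show ?thesis by (simp add: \<xi>_def)
qed

text \<open>By Fatou's lemma the domain consists of the vectors on which the approximating simple operators
  stay bounded, which makes it evidently a subspace.\<close>

lemma D_I:
  assumes m [measurable]: "\<phi> \<in> borel_measurable borel" and B: "\<And>n. norm (sop (sseq \<phi> n) h) \<le> B"
  shows "h \<in> D \<phi>"
proof -
  note sm [measurable] = simple_measurable[OF sseq_simple[OF m]]
  have "(\<integral>\<^sup>+x. ennreal ((\<phi> x)\<^sup>2) \<partial>mu h) = (\<integral>\<^sup>+x. liminf (\<lambda>n. ennreal ((sseq \<phi> n x)\<^sup>2)) \<partial>mu h)"
    by (intro nn_integral_cong lim_imp_Liminf[symmetric] tendsto_ennrealI tendsto_intros sseq_lim m) simp
  also have "\<dots> \<le> liminf (\<lambda>n. \<integral>\<^sup>+x. ennreal ((sseq \<phi> n x)\<^sup>2) \<partial>mu h)"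
    by (rule nn_integral_liminf) measurable
  also have "\<dots> \<le> liminf (\<lambda>n. ennreal (B\<^sup>2))"
  proof (rule Liminf_mono, rule always_eventually, rule allI)
    fix n
    have "(\<integral>\<^sup>+x. ennreal ((sseq \<phi> n x)\<^sup>2) \<partial>mu h) = ennreal (\<integral>x. (sseq \<phi> n x)\<^sup>2 \<partial>mu h)"
      using simple_mult_integrable[OF sseq_simple[OF m, of n] simple_integrable[OF sseq_simple[OF m, of n]]]
      by (intro nn_integral_eq_integral) (simp_all add: power2_eq_square)
    also have "\<dots> = ennreal ((norm (sop (sseq \<phi> n) h))\<^sup>2)" by (simp add: sop_norm sseq_simple m)
    also have "\<dots> \<le> ennreal (B\<^sup>2)" using power_mono[OF B[of n], of 2] by (intro ennreal_leI) simp
    finally show "(\<integral>\<^sup>+x. ennreal ((sseq \<phi> n x)\<^sup>2) \<partial>mu h) \<le> ennreal (B\<^sup>2)" .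
  qed
  also have "\<dots> < \<infinity>" by (simp add: Liminf_const)
  finally show ?thesis by (simp add: spectral_domain_def)
qed

lemma D_sop_bounded:
  assumes "\<phi> \<in> borel_measurable borel" "f \<in> D \<phi>" shows "\<exists>B. \<forall>n. norm (sop (sseq \<phi> n) f) \<le> B"
  using convergent_imp_Bseq[OF convergentI[OF spec_lim[OF assms]]] unfolding Bseq_def by blast

lemma D_add:
  assumes m: "\<phi> \<in> borel_measurable borel" and f: "f \<in> D \<phi>" "g \<in> D \<phi>"
  shows "f + g \<in> D \<phi>"
proof -
  obtain B1 B2 where B: "\<And>n. norm (sop (sseq \<phi> n) f) \<le> B1" "\<And>n. norm (sop (sseq \<phi> n) g) \<le> B2"
    using D_sop_bounded[OF m f(1)] D_sop_bounded[OF m f(2)] by blast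
  show ?thesis
    by (rule D_I[OF m, of _ "B1 + B2"]) (simp add: clin_add[OF sop_clin[OF sseq_simple[OF m]]] norm_triangle_le add_mono B)
qed

lemma D_scaleC:
  assumes m: "\<phi> \<in> borel_measurable borel" and f: "f \<in> D \<phi>"
  shows "c *\<^sub>C f \<in> D \<phi>"
proof -
  obtain B1 where B: "\<And>n. norm (sop (sseq \<phi> n) f) \<le> B1" using D_sop_bounded[OF m f(1)] by blast
  show ?thesis
    by (rule D_I[OF m, of _ "cmod c * B1"]) (simp add: clin_scaleC[OF sop_clin[OF sseq_simple[OF m]]] norm_scaleC mult_left_mono B)
qed

lemma D_csubspace: "\<phi> \<in> borel_measurable borel \<Longrightarrow> csubspace (D \<phi>)"
  unfolding csubspace_def using D_add D_scaleC[of \<phi> _] D_I[of \<phi> 0 0]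
  by (auto simp: clin_zero[OF sop_clin[OF sseq_simple]])

lemma spec_add:
  assumes m: "\<phi> \<in> borel_measurable borel" and f: "f \<in> D \<phi>" "g \<in> D \<phi>"
  shows "spec \<phi> (f + g) = spec \<phi> f + spec \<phi> g"
proof (rule LIMSEQ_unique)
  show "(\<lambda>n. sop (sseq \<phi> n) (f + g)) \<longlonglongrightarrow> spec \<phi> (f + g)" by (rule spec_lim[OF m D_add[OF m f]])
  show "(\<lambda>n. sop (sseq \<phi> n) (f + g)) \<longlonglongrightarrow> spec \<phi> f + spec \<phi> g"
    unfolding clin_add[OF sop_clin[OF sseq_simple[OF m]]] by (intro tendsto_add spec_lim m f)
qed

lemma spec_scaleC:
  assumes m: "\<phi> \<in> borel_measurable borel" and f: "f \<in> D \<phi>"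
  shows "spec \<phi> (c *\<^sub>C f) = c *\<^sub>C spec \<phi> f"
proof (rule LIMSEQ_unique)
  show "(\<lambda>n. sop (sseq \<phi> n) (c *\<^sub>C f)) \<longlonglongrightarrow> spec \<phi> (c *\<^sub>C f)" by (rule spec_lim[OF m D_scaleC[OF m f]])
  show "(\<lambda>n. sop (sseq \<phi> n) (c *\<^sub>C f)) \<longlonglongrightarrow> c *\<^sub>C spec \<phi> f"
    unfolding clin_scaleC[OF sop_clin[OF sseq_simple[OF m]]] by (intro tendsto_scaleC spec_lim m f)
qed

lemma spec_sym:
  assumes m: "\<phi> \<in> borel_measurable borel" and f: "f \<in> D \<phi>" "g \<in> D \<phi>"
  shows "cinner (spec \<phi> f) g = cinner f (spec \<phi> g)"
proof (rule LIMSEQ_unique)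
  show "(\<lambda>n. cinner (sop (sseq \<phi> n) f) g) \<longlonglongrightarrow> cinner (spec \<phi> f) g"
    by (intro cinner.tendsto spec_lim m f tendsto_const)
  show "(\<lambda>n. cinner (sop (sseq \<phi> n) f) g) \<longlonglongrightarrow> cinner f (spec \<phi> g)"
    unfolding sop_sym[OF sseq_simple[OF m]] by (intro cinner.tendsto spec_lim m f tendsto_const)
qed

text \<open>The difference of the two sides is orthogonal to each of the three vectors, hence to itself.\<close>

lemma spec_fun_add:
  assumes m [measurable]: "\<phi> \<in> borel_measurable borel" "\<psi> \<in> borel_measurable borel"
    and f: "f \<in> D \<phi>" "f \<in> D \<psi>" "f \<in> D (\<lambda>x. \<phi> x + \<psi> x)"
  shows "spec (\<lambda>x. \<phi> x + \<psi> x) f = spec \<phi> f + spec \<psi> f"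
proof -
  define \<xi> where "\<xi> = (\<lambda>x. \<phi> x + \<psi> x)"
  have [measurable]: "\<xi> \<in> borel_measurable borel" unfolding \<xi>_def by measurable
  note f = f[folded \<xi>_def]
  note i = D_prod_integrable[OF _ _ f(1) f(1)] D_prod_integrable[OF _ _ f(1) f(2)] D_prod_integrable[OF _ _ f(2) f(1)] D_prod_integrable[OF _ _ f(2) f(2)]
    D_prod_integrable[OF _ _ f(3) f(1)] D_prod_integrable[OF _ _ f(3) f(2)] D_prod_integrable[OF _ _ f(3) f(3)]
  define d where "d = spec \<xi> f - (spec \<phi> f + spec \<psi> f)"
  have o: "cinner d (spec \<theta> f) = 0" if t: "\<theta> \<in> borel_measurable borel" "f \<in> D \<theta>" for \<theta>
  proof -
    have "(\<integral>x. \<xi> x * \<theta> x \<partial>mu f) = (\<integral>x. \<phi> x * \<theta> x + \<psi> x * \<theta> x \<partial>mu f)" by (simp add: \<xi>_def distrib_right)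
    also have "\<dots> = (\<integral>x. \<phi> x * \<theta> x \<partial>mu f) + (\<integral>x. \<psi> x * \<theta> x \<partial>mu f)"
      by (intro Bochner_Integration.integral_add D_prod_integrable m f t)
    finally show ?thesis
      by (simp add: d_def cinner.diff_left cinner.add_left spec_cinner m f t)
  qed
  have "cinner d d = 0" by (subst (2) d_def) (simp add: cinner.diff_right cinner.add_right o m f)
  then have "d = 0" by (simp add: cinner_same)
  then show ?thesis by (simp add: d_def \<xi>_def)
qed

lemma spec_eqI:
  assumes m [measurable]: "\<phi> \<in> borel_measurable borel" "\<psi> \<in> borel_measurable borel"
    and f: "f \<in> D \<phi>" "f \<in> D \<psi>" and ae: "AE x in mu f. \<phi> x = \<psi> x"
  shows "spec \<phi> f = spec \<psi> f"
proof -
  have "(\<integral>x. \<phi> x * \<phi> x \<partial>mu f) = (\<integral>x. \<phi> x * \<psi> x \<partial>mu f)" "(\<integral>x. \<psi> x * \<psi> x \<partial>mu f) = (\<integral>x. \<phi> x * \<psi> x \<partial>mu f)"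
    by (rule integral_cong_AE; use ae in auto)+
  then have "(norm (spec \<phi> f - spec \<psi> f))\<^sup>2 = 0"
    unfolding norm_diff_square spec_norm[OF m(1) f(1)] spec_norm[OF m(2) f(2)] spec_cinner[OF m f]
    by (simp add: power2_eq_square)
  then show ?thesis by simp
qed

lemma spec_norm_mono:
  assumes m [measurable]: "\<phi> \<in> borel_measurable borel" "\<psi> \<in> borel_measurable borel"
    and f: "f \<in> D \<psi>" and ae: "AE x in mu f. \<bar>\<phi> x\<bar> \<le> \<bar>\<psi> x\<bar>"
  shows "f \<in> D \<phi>" and "norm (spec \<phi> f) \<le> norm (spec \<psi> f)"
proof -
  have ae2: "AE x in mu f. (\<phi> x)\<^sup>2 \<le> (\<psi> x)\<^sup>2" using ae by eventually_elim (simp add: abs_le_square_iff)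
  have i: "integrable (mu f) (\<lambda>x. (\<psi> x)\<^sup>2)" using f by (simp add: D_iff)
  show d: "f \<in> D \<phi>" unfolding D_iff[OF m(1)]
    by (rule Bochner_Integration.integrable_bound[OF i]) (use ae2 in auto)
  have "(norm (spec \<phi> f))\<^sup>2 \<le> (norm (spec \<psi> f))\<^sup>2"
    unfolding spec_norm[OF m(1) d] spec_norm[OF m(2) f]
    by (rule integral_mono_AE) (use d f ae2 in \<open>auto simp: D_iff\<close>)
  then show "norm (spec \<phi> f) \<le> norm (spec \<psi> f)" by (simp add: abs_le_square_iff[symmetric])
qed

lemma spec_simple:
  assumes s: "simple s" shows "spec s f = sop s f"
proof -
  have m: "s \<in> borel_measurable borel" using s by (rule simple_measurable)
  obtain B where "\<And>x. \<bar>s x\<bar> \<le> B" using simple_bounded[OF s] by blast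
  then have d: "f \<in> D s" by (rule D_bounded[OF m])
  have "cinner (spec s f) (sop s f) = of_real (\<integral>x. s x * s x \<partial>mu f)"
    using spec_cinner_sop2[OF m d _ s, of "\<lambda>_. 1"] by (simp add: sop_one)
  then have "(norm (spec s f - sop s f))\<^sup>2 = 0"
    unfolding norm_diff_square spec_norm[OF m d] sop_norm[OF s] by (simp add: power2_eq_square)
  then show ?thesis by simp
qed

lemma spec_one: "spec (\<lambda>_. 1) f = f"
  by (simp add: spec_simple sop_one)

lemma spec_form:
  assumes m: "\<phi> \<in> borel_measurable borel" and f: "f \<in> D \<phi>" "g \<in> D \<phi>"
  shows "cinner (spec \<phi> f) g = spectral_form E \<phi> f g"
proof (rule LIMSEQ_unique)
  show "(\<lambda>n. cinner (sop (sseq \<phi> n) f) g) \<longlonglongrightarrow> cinner (spec \<phi> f) g"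
    by (intro cinner.tendsto spec_lim m f tendsto_const)
  have eq: "cinner (sop (sseq \<phi> n) f) g = spectral_form E (sseq \<phi> n) f g" for n
    using polarization[OF sop_clin[OF sseq_simple[OF m]], of n f g]
    by (simp only: spectral_form_def sop_quadratic[OF sseq_simple[OF m]])
  show "(\<lambda>n. cinner (sop (sseq \<phi> n) f) g) \<longlonglongrightarrow> spectral_form E \<phi> f g"
    unfolding eq unfolding spectral_form_def
  proof (intro tendsto_intros)
    fix k
    let ?u = "f + \<i> ^ k *\<^sub>C g"
    have "integrable (mu ?u) \<phi>" by (intro D_integrable m D_add D_scaleC f)
    then show "(\<lambda>n. \<integral>x. sseq \<phi> n x \<partial>mu ?u) \<longlonglongrightarrow> (\<integral>x. \<phi> x \<partial>mu ?u)"
      using sseq_integral_lim[OF m, of "\<lambda>_. 1" ?u] by simp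
  qed simp
qed

text \<open>The truncations \<open>E {x. \<bar>\<phi> x\<bar> \<le> n} g\<close> lie in the domain, and the square of their distance to \<open>g\<close> is
  the measure of \<open>{x. \<bar>\<phi> x\<bar> > n}\<close>, which tends to \<open>0\<close>.\<close>

lemma D_dense:
  assumes m [measurable]: "\<phi> \<in> borel_measurable borel"
  shows "closure (D \<phi>) = UNIV"
proof -
  have "g \<in> closure (D \<phi>)" for g
    unfolding closure_sequential
  proof (intro exI conjI allI)
    define A where "A n = {x. \<bar>\<phi> x\<bar> \<le> real n}" for n
    have A [measurable]: "A n \<in> sets borel" for n unfolding A_def by measurable
    show "E (A n) g \<in> D \<phi>" for n
    proof -
      have "emeasure (mu (E (A n) g)) (- A n) = emeasure (mu g) (A n \<inter> - A n)"
        by (rule mu_E) auto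
      then have "emeasure (mu (E (A n) g)) (- A n) = 0" by simp
      then have "AE x in mu (E (A n) g). x \<in> A n"
        by (intro AE_I[of _ _ "- A n"]) auto
      then have "AE x in mu (E (A n) g). ennreal ((\<phi> x)\<^sup>2) \<le> ennreal ((real n)\<^sup>2)"
        by eventually_elim (auto simp: A_def intro!: ennreal_leI simp del: of_nat_power simp: abs_le_square_iff[symmetric])
      then have "(\<integral>\<^sup>+x. ennreal ((\<phi> x)\<^sup>2) \<partial>mu (E (A n) g)) \<le> (\<integral>\<^sup>+x. ennreal ((real n)\<^sup>2) \<partial>mu (E (A n) g))"
        by (rule nn_integral_mono_AE)
      also have "\<dots> < \<infinity>" by (simp add: emeasure_mu ennreal_mult_less_top)
      finally show ?thesis by (simp add: spectral_domain_def)
    qed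
    have "(\<lambda>n. measure (mu g) (- A n)) \<longlonglongrightarrow> measure (mu g) (\<Inter>n. - A n)"
      by (rule finite_measure.finite_Lim_measure_decseq) (auto simp: A_def decseq_def)
    moreover have "(\<Inter>n. - A n) = {}"
      using real_arch_simple by (auto simp: A_def)
    moreover have "measure (mu g) (- A n) = (norm (g - E (A n) g))\<^sup>2" for n
    proof -
      have "measure (mu g) (- A n) = (norm g)\<^sup>2 - (norm (E (A n) g))\<^sup>2"
        using finite_measure.finite_measure_compl[OF finite_mu, of "A n" g]
        by (simp add: measure_mu E_UNIV Compl_eq_Diff_UNIV)
      then show ?thesis
        by (simp add: norm_diff_square E_sym[symmetric] cinner_E)
    qed
    ultimately have "(\<lambda>n. (norm (g - E (A n) g))\<^sup>2) \<longlonglongrightarrow> 0" by simp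
    then have "(\<lambda>n. sqrt ((norm (g - E (A n) g))\<^sup>2)) \<longlonglongrightarrow> sqrt 0" by (rule tendsto_real_sqrt)
    then have "(\<lambda>n. g - E (A n) g) \<longlonglongrightarrow> 0" by (simp add: tendsto_norm_zero_iff)
    then have "(\<lambda>n. g - (g - E (A n) g)) \<longlonglongrightarrow> g - 0" by (intro tendsto_intros)
    then show "(\<lambda>n. E (A n) g) \<longlonglongrightarrow> g" by simp
  qed
  then show ?thesis by auto
qed

text \<open>The vector \<open>spec \<phi> f\<close> represents \<open>spectral_form E \<phi> f\<close>, and is the only one to do so because the
  domain is dense.\<close>

lemma app_spectral_integral:
  assumes m: "\<phi> \<in> borel_measurable borel" and f: "f \<in> D \<phi>"
  shows "app_op (spectral_integral E \<phi>) f = spec \<phi> f"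
proof -
  have "(THE v. \<forall>g\<in>D \<phi>. cinner v g = spectral_form E \<phi> f g) = spec \<phi> f"
  proof (rule the_equality)
    show "\<forall>g\<in>D \<phi>. cinner (spec \<phi> f) g = spectral_form E \<phi> f g" using spec_form[OF m f] by blast
    show "v = spec \<phi> f" if "\<forall>g\<in>D \<phi>. cinner v g = spectral_form E \<phi> f g" for v
      by (rule cinner_eq_dense_left[OF D_dense[OF m]]) (use that spec_form[OF m f] in auto)
  qed
  then show ?thesis by (simp add: spectral_integral_def)
qed

lemma dom_spectral_integral: "dom_op (spectral_integral E \<phi>) = D \<phi>"
  by (simp add: spectral_integral_def)

end

section \<open>The spectral theorem for positive contractions\<close>

text \<open>A formal complex combination of measures represents a complex measure; \<open>lval S\<close> is its
  value at \<open>S\<close> and \<open>lmom k\<close> its \<open>k\<close>-th moment.\<close>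

definition lval :: "real set \<Rightarrow> (complex \<times> real measure) list \<Rightarrow> complex" where
  "lval S xs = (\<Sum>(c, M)\<leftarrow>xs. c * of_real (measure M S))"

definition lmom :: "nat \<Rightarrow> (complex \<times> real measure) list \<Rightarrow> complex" where
  "lmom k xs = (\<Sum>(c, M)\<leftarrow>xs. c * of_real (\<integral>x. x ^ k \<partial>M))"

definition unit_interval_measure :: "real measure \<Rightarrow> bool" where
  "unit_interval_measure M \<longleftrightarrow> finite_measure M \<and> sets M = sets borel \<and> (AE x in M. x \<in> {0..1})"

definition lunit :: "(complex \<times> real measure) list \<Rightarrow> bool" where
  "lunit xs \<longleftrightarrow> (\<forall>(c, M)\<in>set xs. unit_interval_measure M)"

definition lscale :: "complex \<Rightarrow> (complex \<times> real measure) list \<Rightarrow> (complex \<times> real measure) list" where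
  "lscale a xs = map (\<lambda>(c, M). (a * c, M)) xs"

definition lcnj :: "(complex \<times> real measure) list \<Rightarrow> (complex \<times> real measure) list" where
  "lcnj xs = map (\<lambda>(c, M). (cnj c, M)) xs"

definition ldensity :: "(real \<Rightarrow> real) \<Rightarrow> (complex \<times> real measure) list \<Rightarrow> (complex \<times> real measure) list" where
  "ldensity h xs = map (\<lambda>(c, M). (c, density M (\<lambda>x. ennreal (h x)))) xs"

lemma lval_empty: "lval {} xs = 0"
  by (induction xs) (auto simp: lval_def)

lemma lval_append: "lval S (xs @ ys) = lval S xs + lval S ys"
  and lmom_append: "lmom k (xs @ ys) = lmom k xs + lmom k ys"
  and lunit_append: "lunit (xs @ ys) \<longleftrightarrow> lunit xs \<and> lunit ys"
  by (auto simp: lval_def lmom_def lunit_def)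

lemma lval_lscale: "lval S (lscale a xs) = a * lval S xs"
  and lmom_lscale: "lmom k (lscale a xs) = a * lmom k xs"
  and lunit_lscale: "lunit (lscale a xs) \<longleftrightarrow> lunit xs"
  by (induction xs) (auto simp: lval_def lmom_def lunit_def lscale_def algebra_simps)

lemma lval_lcnj: "lval S (lcnj xs) = cnj (lval S xs)"
  and lmom_lcnj: "lmom k (lcnj xs) = cnj (lmom k xs)"
  and lunit_lcnj: "lunit (lcnj xs) \<longleftrightarrow> lunit xs"
  by (induction xs) (auto simp: lval_def lmom_def lunit_def lcnj_def)

lemma lval_eqI:
  assumes "lunit xs" "lunit ys" and eq: "\<And>k. lmom k xs = lmom k ys" and S: "S \<in> sets borel"
  shows "lval S xs = lval S ys"
proof -
  define zs where "zs = xs @ lscale (-1) ys"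
  have u: "lunit zs" using assms by (simp add: zs_def lunit_append lunit_lscale)
  have z: "unit_interval_measure (snd (zs ! i))" if "i \<in> {0..<length zs}" for i
    using u that unfolding lunit_def by (metis (no_types, lifting) atLeastLessThan_iff case_prod_beta nth_mem)
  have "(\<Sum>i\<in>{0..<length zs}. fst (zs ! i) * of_real (measure (snd (zs ! i)) S)) = 0"
  proof (rule moments_determine)
    fix k
    have "lmom k zs = (\<Sum>i\<in>{0..<length zs}. fst (zs ! i) * of_real (\<integral>x. x ^ k \<partial>snd (zs ! i)))"
      by (simp add: lmom_def sum_list_sum_nth case_prod_beta)
    then show "(\<Sum>i\<in>{0..<length zs}. fst (zs ! i) * of_real (\<integral>x. x ^ k \<partial>snd (zs ! i))) = 0"
      by (simp add: zs_def lmom_append lmom_lscale eq)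
  qed (use z S in \<open>auto simp: unit_interval_measure_def\<close>)
  then have "lval S zs = 0" by (simp add: lval_def sum_list_sum_nth case_prod_beta)
  then show ?thesis by (simp add: zs_def lval_append lval_lscale)
qed

lemma unit_interval_measure_density:
  assumes M: "unit_interval_measure M" and h: "h \<in> borel_measurable borel" "\<And>x. 0 \<le> h x" "\<And>x. h x \<le> 1"
  shows "unit_interval_measure (density M (\<lambda>x. ennreal (h x)))"
proof -
  have s [measurable_cong]: "sets M = sets borel" and ae: "AE x in M. x \<in> {0..1}" using M by (auto simp: unit_interval_measure_def)
  interpret finite_measure M using M by (simp add: unit_interval_measure_def)
  note [measurable] = h(1)
  have "emeasure (density M (\<lambda>x. ennreal (h x))) (space M) = (\<integral>\<^sup>+x. ennreal (h x) \<partial>M)"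
    by (simp add: emeasure_density cong: nn_integral_cong)
  also have "\<dots> \<le> (\<integral>\<^sup>+x. 1 \<partial>M)" using h by (intro nn_integral_mono) (simp add: ennreal_le_1)
  also have "\<dots> < \<infinity>" using emeasure_finite[of "space M"] by (simp add: less_top[symmetric])
  finally have "finite_measure (density M (\<lambda>x. ennreal (h x)))" by (intro finite_measureI) auto
  moreover have "AE x in density M (\<lambda>x. ennreal (h x)). x \<in> {0..1}"
    using ae by (subst AE_density) auto
  ultimately show ?thesis by (simp add: unit_interval_measure_def s)
qed

lemma lunit_ldensity:
  assumes "lunit xs" and h: "h \<in> borel_measurable borel" "\<And>x. 0 \<le> h x" "\<And>x. h x \<le> 1"
  shows "lunit (ldensity h xs)"
  using assms(1) unit_interval_measure_density[OF _ h] by (auto simp: lunit_def ldensity_def)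

lemma lmom_ldensity:
  assumes "lunit xs" and h: "h \<in> borel_measurable borel" "\<And>x. 0 \<le> h x"
  shows "lmom k (ldensity h xs) = (\<Sum>(c, M)\<leftarrow>xs. c * of_real (\<integral>x. h x * x ^ k \<partial>M))"
proof -
  have "(\<integral>x. x ^ k \<partial>density M (\<lambda>x. ennreal (h x))) = (\<integral>x. h x * x ^ k \<partial>M)" if "(c, M) \<in> set xs" for c M
  proof -
    have [measurable_cong]: "sets M = sets borel" using that assms(1) by (auto simp: lunit_def unit_interval_measure_def)
    note [measurable] = h(1)
    show ?thesis by (subst integral_real_density) (auto simp: h)
  qed
  then show ?thesis unfolding lmom_def ldensity_def by (auto simp: o_def case_prod_beta intro!: arg_cong[where f = sum_list])
qed

lemma lval_ldensity:
  assumes "lunit xs" and h: "h \<in> borel_measurable borel" "\<And>x. 0 \<le> h x" "\<And>x. h x \<le> 1" and S: "S \<in> sets borel"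
  shows "lval S (ldensity h xs) = (\<Sum>(c, M)\<leftarrow>xs. c * of_real (\<integral>x. indicator S x * h x \<partial>M))"
proof -
  have "measure (density M (\<lambda>x. ennreal (h x))) S = (\<integral>x. indicator S x * h x \<partial>M)" if "(c, M) \<in> set xs" for c M
  proof -
    have s [measurable_cong]: "sets M = sets borel" and u: "unit_interval_measure M" using that assms(1) by (auto simp: lunit_def unit_interval_measure_def)
    note [measurable] = h(1) S
    have "measure (density M (\<lambda>x. ennreal (h x))) S = (\<integral>x. indicator S x \<partial>density M (\<lambda>x. ennreal (h x)))"
      using sets_eq_imp_space_eq[OF s] by (simp add: s S)
    also have "\<dots> = (\<integral>x. h x * indicator S x \<partial>M)"
      by (subst integral_real_density) (auto simp: h)
    finally show ?thesis by (simp add: mult.commute)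
  qed
  then show ?thesis unfolding lval_def ldensity_def by (auto simp: o_def case_prod_beta intro!: arg_cong[where f = sum_list])
qed

locale positive_contraction =
  fixes B :: "'h::complex_hilbert_space \<Rightarrow> 'h"
  assumes B_clin: "clin B" and B_sym: "cinner (B f) g = cinner f (B g)"
    and B_pos: "0 \<le> Re (cinner (B f) f)" and B_le: "Re (cinner (B f) f) \<le> (norm f)\<^sup>2"
begin

definition C :: "'h \<Rightarrow> 'h" where "C f = f - B f"

lemma C_clin: "clin C"
  unfolding clin_def C_def by (simp add: clinD[OF B_clin] scaleC_diff_right)

lemma C_sym: "cinner (C f) g = cinner f (C g)"
  by (simp add: C_def cinner.diff_left cinner.diff_right B_sym)

lemma C_pos: "0 \<le> Re (cinner (C f) f)"
  using B_le[of f] by (simp add: C_def cinner.diff_left Re_cinner_same)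

lemma BC_commute: "B (C f) = C (B f)"
  by (simp add: C_def clinD[OF B_clin])

lemma B_plus_C: "B f + C f = f"
  by (simp add: C_def)

lemma Bpow_clin: "clin (B ^^ n)"
  by (induction n) (use B_clin in \<open>auto simp: clin_def\<close>)

lemma Bpow_sym: "cinner ((B ^^ n) f) g = cinner f ((B ^^ n) g)"
  by (induction n arbitrary: f g) (auto simp: B_sym funpow_swap1)

lemma Cpow_sym: "cinner ((C ^^ n) f) g = cinner f ((C ^^ n) g)"
  by (induction n arbitrary: f g) (auto simp: C_sym funpow_swap1)

lemma B_Cpow: "B ((C ^^ n) f) = (C ^^ n) (B f)"
  by (induction n) (auto simp: BC_commute)

lemma Bpow_Cpow: "(B ^^ m) ((C ^^ n) f) = (C ^^ n) ((B ^^ m) f)"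
  by (induction m) (auto simp: B_Cpow)

definition bmom :: "'h \<Rightarrow> nat \<Rightarrow> nat \<Rightarrow> real" where
  "bmom f a b = Re (cinner ((B ^^ a) ((C ^^ b) f)) f)"

lemma bmom_rec: "bmom f a b = bmom f (Suc a) b + bmom f a (Suc b)"
proof -
  have "(B ^^ a) ((C ^^ b) f) = (B ^^ a) (B ((C ^^ b) f)) + (B ^^ a) (C ((C ^^ b) f))"
    by (simp only: clin_add[OF Bpow_clin, symmetric] B_plus_C)
  moreover have "(B ^^ a) (B x) = (B ^^ Suc a) x" for x by (simp add: funpow_swap1)
  moreover have "C ((C ^^ b) f) = (C ^^ Suc b) f" by simp
  ultimately show ?thesis unfolding bmom_def by (metis cinner.add_left plus_complex.sel(1))
qed

text \<open>Moving half of the factors to the other side of the inner product leaves at most one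
  factor \<open>B\<close> and one factor \<open>C\<close>, and \<open>\<langle>B C h, h\<rangle> = \<langle>C B h, B h\<rangle> + \<langle>B C h, C h\<rangle>\<close>.\<close>

lemma bmom_nonneg: "0 \<le> bmom f a b"
proof -
  define h where "h = (B ^^ (a div 2)) ((C ^^ (b div 2)) f)"
  define \<epsilon> \<eta> where "\<epsilon> = a mod 2" and "\<eta> = b mod 2"
  have a: "a = a div 2 + (\<epsilon> + a div 2)" and b: "b = b div 2 + (\<eta> + b div 2)" unfolding \<epsilon>_def \<eta>_def by presburger+
  have "(B ^^ a) ((C ^^ b) f) = (C ^^ (b div 2)) ((B ^^ (a div 2)) ((B ^^ \<epsilon>) ((C ^^ \<eta>) h)))"
    by (subst a, subst b) (simp add: funpow_add h_def Bpow_Cpow)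
  then have "bmom f a b = Re (cinner ((B ^^ \<epsilon>) ((C ^^ \<eta>) h)) h)"
    by (simp add: bmom_def Cpow_sym Bpow_sym) (simp add: h_def)
  moreover have "0 \<le> Re (cinner (B (C h)) h)"
  proof -
    have "cinner (B (C h)) h = cinner (B (C h)) (B h) + cinner (B (C h)) (C h)"
      by (simp only: cinner.add_right[symmetric] B_plus_C)
    then show ?thesis using C_pos[of "B h"] B_pos[of "C h"] by (simp add: BC_commute)
  qed
  moreover have "\<epsilon> = 0 \<or> \<epsilon> = 1" "\<eta> = 0 \<or> \<eta> = 1" unfolding \<epsilon>_def \<eta>_def by auto
  ultimately show ?thesis using B_pos[of h] C_pos[of h] by (auto simp: Re_cinner_same_ge0)
qed

definition \<mu> :: "'h \<Rightarrow> real measure" where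
  "\<mu> f = (SOME M. unit_interval_measure M \<and> (\<forall>k. (\<integral>x. x ^ k \<partial>M) = bmom f k 0))"

lemma \<mu>: shows \<mu>_unit: "unit_interval_measure (\<mu> f)" and \<mu>_moment: "(\<integral>x. x ^ k \<partial>\<mu> f) = bmom f k 0"
proof -
  have "\<exists>M. unit_interval_measure M \<and> (\<forall>k. (\<integral>x. x ^ k \<partial>M) = bmom f k 0)"
    using Hausdorff_moment[of "bmom f", OF bmom_rec bmom_nonneg] unfolding unit_interval_measure_def by blast
  from someI_ex[OF this] show "unit_interval_measure (\<mu> f)" "(\<integral>x. x ^ k \<partial>\<mu> f) = bmom f k 0"
    unfolding \<mu>_def by blast+
qed

lemma sets_\<mu> [simp, measurable_cong]: "sets (\<mu> f) = sets borel"
  using \<mu>_unit[of f] by (simp add: unit_interval_measure_def)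

lemma space_\<mu> [simp]: "space (\<mu> f) = UNIV"
  using sets_eq_imp_space_eq[OF sets_\<mu>[of f]] by simp

lemma finite_\<mu>: "finite_measure (\<mu> f)"
  using \<mu>_unit[of f] by (simp add: unit_interval_measure_def)

lemma AE_\<mu>: "AE x in \<mu> f. x \<in> {0..1}"
  using \<mu>_unit[of f] by (simp add: unit_interval_measure_def)

lemma moment_cinner: "of_real (\<integral>x. x ^ k \<partial>\<mu> f) = cinner ((B ^^ k) f) f"
proof -
  have "cinner ((B ^^ k) f) f = cnj (cinner ((B ^^ k) f) f)"
    by (metis Bpow_sym cinner_commute)
  then have "Im (cinner ((B ^^ k) f) f) = 0" by (metis Reals_cnj_iff complex_is_Real_iff)
  then show ?thesis by (simp add: \<mu>_moment bmom_def complex_eq_iff)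
qed

lemma measure_\<mu>_UNIV: "measure (\<mu> f) UNIV = (norm f)\<^sup>2"
  using \<mu>_moment[where k = 0, of f] by (simp add: bmom_def Re_cinner_same)

lemma measure_\<mu>_le: "measure (\<mu> f) S \<le> (norm f)\<^sup>2"
  using finite_measure.bounded_measure[OF finite_\<mu>, of f S] by (simp add: measure_\<mu>_UNIV)

text \<open>The polarized measures, a formal version of \<open>\<langle>G (\<cdot>) f, g\<rangle>\<close>. Every algebraic property of the form
  \<open>Q S f g\<close> below follows from \<open>lval_eqI\<close>, because the moments \<open>\<langle>B\<^sup>k f, g\<rangle>\<close> have it.\<close>

definition P :: "'h \<Rightarrow> 'h \<Rightarrow> (complex \<times> real measure) list" where
  "P f g = map (\<lambda>k. (\<i> ^ k / 4, \<mu> (f + \<i> ^ k *\<^sub>C g))) [0..<4]"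

lemma lunit_P: "lunit (P f g)"
  using \<mu>_unit by (auto simp: lunit_def P_def)

lemma sum_P: "(\<Sum>(c, M)\<leftarrow>P f g. c * of_real (\<Phi> M)) = (\<Sum>k<4. \<i> ^ k * of_real (\<Phi> (\<mu> (f + \<i> ^ k *\<^sub>C g)))) / 4"
  by (simp add: P_def numeral_eq_Suc add_divide_distrib)

lemma lmom_P: "lmom k (P f g) = cinner ((B ^^ k) f) g"
  unfolding lmom_def sum_P[of "\<lambda>M. \<integral>x. x ^ k \<partial>M"] moment_cinner
  by (rule polarization[OF Bpow_clin])

abbreviation "Q S f g \<equiv> lval S (P f g)"

lemma Q_add: "S \<in> sets borel \<Longrightarrow> Q S (f + f') g = Q S f g + Q S f' g"
  using lval_eqI[of "P (f + f') g" "P f g @ P f' g" S]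
  by (simp add: lunit_P lunit_append lmom_append lmom_P clin_add[OF Bpow_clin] cinner.add_left lval_append)

lemma Q_scale: "S \<in> sets borel \<Longrightarrow> Q S (a *\<^sub>C f) g = a * Q S f g"
  using lval_eqI[of "P (a *\<^sub>C f) g" "lscale a (P f g)" S]
  by (simp add: lunit_P lunit_lscale lmom_lscale lmom_P clin_scaleC[OF Bpow_clin] cinner_scaleC_left lval_lscale)

lemma Q_herm: "S \<in> sets borel \<Longrightarrow> Q S g f = cnj (Q S f g)"
  using lval_eqI[of "P g f" "lcnj (P f g)" S]
  by (simp add: lunit_P lunit_lcnj lmom_lcnj lmom_P lval_lcnj) (metis Bpow_sym cinner_commute)

lemma Q_diag: "S \<in> sets borel \<Longrightarrow> Q S f f = of_real (measure (\<mu> f) S)"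
  using lval_eqI[of "P f f" "[(1, \<mu> f)]" S] lunit_P \<mu>_unit
  by (simp add: lmom_P lval_def lunit_def) (simp add: lmom_def moment_cinner)

lemma Q_UNIV: "Q UNIV f g = cinner f g"
proof -
  have "lval UNIV xs = lmom 0 xs" if "lunit xs" for xs
  proof -
    have "space M = UNIV" if "(c, M) \<in> set xs" for c M
      using \<open>lunit xs\<close> that sets_eq_imp_space_eq[of M borel] by (auto simp: lunit_def unit_interval_measure_def)
    then show ?thesis unfolding lval_def lmom_def by (auto intro!: arg_cong[where f = sum_list])
  qed
  from this[OF lunit_P] show ?thesis by (simp add: lmom_P)
qed

text \<open>The polarization formula gives \<open>\<bar>Q S f g\<bar> \<le> (\<parallel>f\<parallel> + \<parallel>g\<parallel>)\<^sup>2\<close>; homogeneity in \<open>g\<close> reduces the claim to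
  unit vectors.\<close>

lemma Q_bound:
  assumes S: "S \<in> sets borel" shows "cmod (Q S f g) \<le> (norm f + 1)\<^sup>2 * norm g"
proof -
  have crude: "cmod (Q S f g) \<le> (norm f + norm g)\<^sup>2" for f g
  proof -
    have "cmod (Q S f g) = cmod (\<Sum>k<4. \<i> ^ k * of_real (measure (\<mu> (f + \<i> ^ k *\<^sub>C g)) S)) / 4"
      unfolding lval_def sum_P by (simp add: norm_divide)
    also have "cmod (\<Sum>k<4. \<i> ^ k * of_real (measure (\<mu> (f + \<i> ^ k *\<^sub>C g)) S))
        \<le> (\<Sum>k<(4::nat). (norm f + norm g)\<^sup>2)"
    proof (rule sum_norm_le)
      fix k :: nat
      have "measure (\<mu> (f + \<i> ^ k *\<^sub>C g)) S \<le> (norm (f + \<i> ^ k *\<^sub>C g))\<^sup>2" by (rule measure_\<mu>_le)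
      also have "\<dots> \<le> (norm f + norm g)\<^sup>2"
        using norm_triangle_ineq[of f "\<i> ^ k *\<^sub>C g"] by (intro power_mono) (auto simp: norm_scaleC norm_power)
      finally show "cmod (\<i> ^ k * of_real (measure (\<mu> (f + \<i> ^ k *\<^sub>C g)) S)) \<le> (norm f + norm g)\<^sup>2"
        by (simp add: norm_mult norm_power)
    qed
    finally show ?thesis by simp
  qed
  have sc: "Q S f (a *\<^sub>C h) = cnj a * Q S f h" for a h
    by (simp add: Q_herm[OF S, of f] Q_scale[OF S])
  show ?thesis
  proof (cases "g = 0")
    case True
    then show ?thesis using sc[of 0 g] by (simp add: scaleC_zero_left)
  next
    case False
    define h where "h = (1 / norm g) *\<^sub>R g"
    have g: "g = of_real (norm g) *\<^sub>C h" using False by (simp add: h_def scaleC_of_real)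
    have "norm h = 1" using False by (simp add: h_def)
    then have "cmod (Q S f h) \<le> (norm f + 1)\<^sup>2" using crude[of f h] by simp
    then have "norm g * cmod (Q S f h) \<le> (norm f + 1)\<^sup>2 * norm g"
      by (simp add: mult.commute mult_left_mono)
    moreover have "cmod (Q S f g) = norm g * cmod (Q S f h)"
      by (subst g) (simp add: sc norm_mult)
    ultimately show ?thesis by simp
  qed
qed

definition G :: "real set \<Rightarrow> 'h \<Rightarrow> 'h" where
  "G S f = (SOME u. \<forall>g. cinner u g = Q S f g)"

lemma G:
  assumes S: "S \<in> sets borel" shows "cinner (G S f) g = Q S f g"
proof -
  have lin: "linear_functional_on UNIV (\<lambda>g. Q S g f)"
    by (simp add: linear_functional_on_def Q_add[OF S] Q_scale[OF S])
  have "cmod (Q S g f) \<le> (norm f + 1)\<^sup>2 * norm g" for g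
    using Q_bound[OF S, of f g] by (simp add: Q_herm[OF S, of g f])
  from Riesz_representation_subspace[OF _ lin this] obtain u where "\<And>g. cinner g u = Q S g f"
    by (auto simp: csubspace_def)
  then have "\<forall>g. cinner u g = Q S f g" by (metis Q_herm[OF S] cinner_commute)
  then have "\<forall>g. cinner (G S f) g = Q S f g" unfolding G_def by (rule someI)
  then show ?thesis by blast
qed

lemma eq_by_cinner: "(\<And>g. cinner u g = cinner v g) \<Longrightarrow> u = v" for u v :: 'h
  by (rule cinner_eq_dense_left[of UNIV]) auto

lemma G_clin: "S \<in> sets borel \<Longrightarrow> clin (G S)"
  unfolding clin_def by (auto intro!: eq_by_cinner simp: G Q_add Q_scale cinner.add_left cinner_scaleC_left)

lemma G_sym: "S \<in> sets borel \<Longrightarrow> cinner (G S f) g = cinner f (G S g)"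
  by (metis G Q_herm cinner_commute)

text \<open>Multiplicativity in two steps. The complex measure \<open>\<langle>G (\<cdot>) B\<^sup>j f, g\<rangle>\<close> has density \<open>x\<^sup>j\<close> with
  respect to \<open>\<langle>G (\<cdot>) f, g\<rangle>\<close>, because their moments agree. Evaluated at \<open>S\<close> this computes the moments
  of \<open>\<langle>G (\<cdot>) f, G S g\<rangle>\<close> and identifies it with the restriction of \<open>\<langle>G (\<cdot>) f, g\<rangle>\<close> to \<open>S\<close>.\<close>

lemma G_mult:
  assumes S [measurable]: "S \<in> sets borel" and T [measurable]: "T \<in> sets borel"
  shows "cinner (G T f) (G S g) = cinner (G (S \<inter> T) f) g"
proof -
  define clip where "clip x = max 0 (min 1 x)" for x :: real
  have clip [measurable]: "clip \<in> borel_measurable borel" unfolding clip_def by measurable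
  have clip01: "0 \<le> clip x ^ j" "clip x ^ j \<le> 1" for x j by (auto simp: clip_def intro!: power_le_one)
  have aeclip: "AE x in M. clip x = x" if "unit_interval_measure M" for M
  proof -
    have "AE x in M. x \<in> {0..1}" using that by (simp add: unit_interval_measure_def)
    then show ?thesis by eventually_elim (simp add: clip_def)
  qed
  have sl: "(\<Sum>(c, M)\<leftarrow>xs. c * of_real (\<integral>x. h x \<partial>M)) = (\<Sum>(c, M)\<leftarrow>xs. c * of_real (\<integral>x. h' x \<partial>M))"
    if xs: "lunit xs" and h: "h \<in> borel_measurable borel" "h' \<in> borel_measurable borel" "\<And>x. clip x = x \<Longrightarrow> h x = h' x"
    for xs :: "(complex \<times> real measure) list" and h h' :: "real \<Rightarrow> real"
  proof -
    have "(\<integral>x. h x \<partial>M) = (\<integral>x. h' x \<partial>M)" if "(c, M) \<in> set xs" for c M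
    proof (rule integral_cong_AE)
      have u: "unit_interval_measure M" using xs that by (auto simp: lunit_def)
      then have s: "sets M = sets borel" by (simp add: unit_interval_measure_def)
      show "h \<in> borel_measurable M" "h' \<in> borel_measurable M"
        using h(1,2) measurable_cong_sets[OF s refl] by auto
      show "AE x in M. h x = h' x" using aeclip[OF u] by eventually_elim (rule h(3))
    qed
    then show ?thesis by (auto intro!: arg_cong[where f = sum_list])
  qed
  have 1: "Q S ((B ^^ j) f) g = lval S (ldensity (\<lambda>x. clip x ^ j) (P f g))" for j
  proof (rule lval_eqI[OF lunit_P lunit_ldensity[OF lunit_P] _ S])
    show "lmom k (P ((B ^^ j) f) g) = lmom k (ldensity (\<lambda>x. clip x ^ j) (P f g))" for k
    proof -
      have "lmom k (ldensity (\<lambda>x. clip x ^ j) (P f g)) = (\<Sum>(c, M)\<leftarrow>P f g. c * of_real (\<integral>x. clip x ^ j * x ^ k \<partial>M))"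
        by (rule lmom_ldensity[OF lunit_P]) (auto simp: clip01)
      also have "\<dots> = lmom (k + j) (P f g)"
        unfolding lmom_def by (rule sl[OF lunit_P]) (simp_all add: power_add mult.commute)
      finally show ?thesis by (simp add: lmom_P funpow_add)
    qed
  qed (auto simp: clip01)
  have 2: "lval T (P f (G S g)) = lval T (ldensity (indicator S) (P f g))"
  proof (rule lval_eqI[OF lunit_P lunit_ldensity[OF lunit_P] _ T])
    show "lmom j (P f (G S g)) = lmom j (ldensity (indicator S) (P f g))" for j
    proof -
      have "lmom j (P f (G S g)) = Q S ((B ^^ j) f) g" by (simp add: lmom_P G_sym[OF S, symmetric] G[OF S])
      also have "\<dots> = (\<Sum>(c, M)\<leftarrow>P f g. c * of_real (\<integral>x. indicator S x * clip x ^ j \<partial>M))"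
        unfolding 1 by (rule lval_ldensity[OF lunit_P]) (auto simp: clip01)
      also have "\<dots> = (\<Sum>(c, M)\<leftarrow>P f g. c * of_real (\<integral>x. indicator S x * x ^ j \<partial>M))"
        by (rule sl[OF lunit_P]) simp_all
      also have "\<dots> = lmom j (ldensity (indicator S) (P f g))"
        by (rule lmom_ldensity[OF lunit_P, symmetric]) auto
      finally show ?thesis .
    qed
  qed (auto simp: indicator_def)
  also have "\<dots> = (\<Sum>(c, M)\<leftarrow>P f g. c * of_real (\<integral>x. indicator T x * indicator S x \<partial>M))"
    by (rule lval_ldensity[OF lunit_P]) (auto simp: indicator_def)
  also have "\<dots> = Q (S \<inter> T) f g"
    unfolding lval_def sum_P[of "\<lambda>M. \<integral>x. indicator T x * indicator S x \<partial>M"] sum_P[of "\<lambda>M. measure M (S \<inter> T)"]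
    by (simp add: indicator_inter_arith[symmetric] Int_commute)
  finally show ?thesis by (simp add: G)
qed

lemma G_norm: "S \<in> sets borel \<Longrightarrow> (norm (G S f))\<^sup>2 = measure (\<mu> f) S"
  using G_mult[of S S f f] by (simp add: Re_cinner_same[symmetric] G Q_diag)

lemma G_pvm: "projection_valued_measure G"
proof -
  have G2: "G S (G T f) = G (S \<inter> T) f" if "S \<in> sets borel" "T \<in> sets borel" for S T f
    by (rule eq_by_cinner) (use that in \<open>simp add: G_sym[of S] G_mult\<close>)
  have empty: "G {} f = 0" for f
    by (rule eq_by_cinner) (simp add: G lval_empty cinner.zero_left)
  have univ: "G UNIV f = f" for f
    by (rule eq_by_cinner) (simp add: G Q_UNIV)
  have sums: "(\<lambda>n. G (A n) f) sums G (\<Union>n. A n) f" if A: "range A \<subseteq> sets borel" "disjoint_family A" for A :: "nat \<Rightarrow> real set" and f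
  proof -
    have Ai [measurable]: "A i \<in> sets borel" for i using A by auto
    define U where "U = (\<Union>n. A n)"
    have U [measurable]: "U \<in> sets borel" unfolding U_def by measurable
    have UA: "cinner (G U f) (G (A i) f) = of_real (measure (\<mu> f) (A i))" for i
    proof -
      have "A i \<inter> U = A i" by (auto simp: U_def)
      then show ?thesis by (simp add: G_mult) (simp add: G Q_diag)
    qed
    have AA: "cinner (G (A i) f) (G (A j) f) = (if i = j then of_real (measure (\<mu> f) (A i)) else 0)" for i j
    proof (cases "i = j")
      case True then show ?thesis by (simp add: G_mult) (simp add: G Q_diag)
    next
      case False
      then have "A j \<inter> A i = {}" using A(2) by (auto simp: disjoint_family_on_def)
      then show ?thesis using False by (simp add: G_mult) (simp add: G lval_empty)
    qed
    have eq: "(norm (G U f - (\<Sum>i<n. G (A i) f)))\<^sup>2 = measure (\<mu> f) U - (\<Sum>i<n. measure (\<mu> f) (A i))" for n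
    proof -
      have "(norm (\<Sum>i<n. G (A i) f))\<^sup>2 = (\<Sum>i<n. measure (\<mu> f) (A i))"
        unfolding Re_cinner_same[symmetric] by (simp add: cinner.sum_left cinner.sum_right AA)
      then show ?thesis
        by (simp add: norm_diff_square G_norm cinner.sum_right UA)
    qed
    have "(\<lambda>n. \<Sum>i<n. measure (\<mu> f) (A i)) \<longlonglongrightarrow> measure (\<mu> f) U"
      using finite_measure.finite_measure_UNION[OF finite_\<mu>, of A f] A unfolding sums_def U_def by simp
    then have "(\<lambda>n. measure (\<mu> f) U - (\<Sum>i<n. measure (\<mu> f) (A i))) \<longlonglongrightarrow> measure (\<mu> f) U - measure (\<mu> f) U"
      by (intro tendsto_intros)
    then have "(\<lambda>n. (norm (G U f - (\<Sum>i<n. G (A i) f)))\<^sup>2) \<longlonglongrightarrow> 0" unfolding eq by simp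
    then have "(\<lambda>n. sqrt ((norm (G U f - (\<Sum>i<n. G (A i) f)))\<^sup>2)) \<longlonglongrightarrow> sqrt 0" by (rule tendsto_real_sqrt)
    then have "(\<lambda>n. G U f - (\<Sum>i<n. G (A i) f)) \<longlonglongrightarrow> 0" by (simp add: tendsto_norm_zero_iff)
    then have "(\<lambda>n. G U f - (G U f - (\<Sum>i<n. G (A i) f))) \<longlonglongrightarrow> G U f - 0" by (intro tendsto_intros)
    then show ?thesis unfolding sums_def by (simp add: U_def)
  qed
  show ?thesis
    unfolding projection_valued_measure_def linear_op_UNIV
    by (auto simp: G_clin G2 G_sym sums empty univ)
qed

sublocale pvm G by (rule pvm.intro[OF G_pvm])

lemma mu_eq_\<mu>: "scalar_measure G f = \<mu> f"
proof (rule measure_eqI)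
  fix S assume "S \<in> sets (scalar_measure G f)"
  then show "emeasure (scalar_measure G f) S = emeasure (\<mu> f) S"
    by (simp add: emeasure_mu G_norm finite_measure.emeasure_eq_measure[OF finite_\<mu>])
qed simp

lemma D_AE_bounded:
  assumes [measurable]: "\<phi> \<in> borel_measurable borel" and bd: "\<And>x. x \<in> {0..1} \<Longrightarrow> \<bar>\<phi> x\<bar> \<le> b"
  shows "f \<in> D \<phi>"
proof -
  have "AE x in scalar_measure G f. norm ((\<phi> x)\<^sup>2) \<le> b\<^sup>2"
    unfolding mu_eq_\<mu> using AE_\<mu>[of f]
  proof eventually_elim
    case (elim x)
    then show ?case using power_mono[OF bd[OF elim], of 2] by simp
  qed
  then have "integrable (scalar_measure G f) (\<lambda>x. (\<phi> x)\<^sup>2)"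
    by (intro finite_measure.integrable_const_bound[OF finite_mu]) auto
  then show ?thesis by (simp add: D_iff)
qed

lemma D_id: "f \<in> D (\<lambda>x. x)"
  by (rule D_AE_bounded[of _ 1]) auto

lemma spec_id: "spec (\<lambda>x. x) f = B f"
proof (rule eq_by_cinner)
  fix g
  have "cinner (spec (\<lambda>x. x) f) g = spectral_form G (\<lambda>x. x) f g" by (rule spec_form) (auto simp: D_id)
  also have "\<dots> = lmom 1 (P f g)"
    unfolding lmom_def sum_P[of "\<lambda>M. \<integral>x. x ^ 1 \<partial>M"] spectral_form_def mu_eq_\<mu> by simp
  finally show "cinner (spec (\<lambda>x. x) f) g = cinner (B f) g" by (simp add: lmom_P)
qed

end

section \<open>The spectral theorem for positive self-adjoint operators\<close>

lemma self_adjoint_sym: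
  assumes "self_adjoint_op L" "f \<in> dom_op L" "g \<in> dom_op L"
  shows "cinner (app_op L f) g = cinner f (app_op L g)"
proof -
  have dense: "closure (dom_op L) = UNIV" and adj: "op_eq (adjoint_op L) L" using assms by (auto simp: self_adjoint_op_def)
  have g: "g \<in> dom_op (adjoint_op L)" using adj assms(3) by (simp add: op_eq_def)
  then obtain z where z: "\<forall>f\<in>dom_op L. cinner (app_op L f) g = cinner f z" by (auto simp: adjoint_op_def)
  have "app_op (adjoint_op L) g = z"
    unfolding adjoint_op_def snd_conv
    by (rule the_equality) (use z in \<open>auto intro!: cinner_eq_dense[OF dense]\<close>)
  then have "app_op L g = z" using adj g by (simp add: op_eq_def)
  then show ?thesis using z assms(2) by simp
qed

lemma self_adjoint_maximal:
  assumes "self_adjoint_op L" and z: "\<And>f. f \<in> dom_op L \<Longrightarrow> cinner (app_op L f) g = cinner f z"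
  shows "g \<in> dom_op L" and "app_op L g = z"
proof -
  have dense: "closure (dom_op L) = UNIV" and adj: "op_eq (adjoint_op L) L" using assms by (auto simp: self_adjoint_op_def)
  have "g \<in> dom_op (adjoint_op L)" using z by (auto simp: adjoint_op_def)
  then show g: "g \<in> dom_op L" using adj by (simp add: op_eq_def)
  show "app_op L g = z"
    by (rule cinner_eq_dense[OF dense]) (simp add: self_adjoint_sym[OF assms(1) _ g, symmetric] z)
qed

locale positive_self_adjoint =
  fixes L :: "'h::complex_hilbert_space unbounded_op"
  assumes sa: "self_adjoint_op L" and pos: "positive_op L"
begin

abbreviation "V \<equiv> dom_op L"
abbreviation "T \<equiv> app_op L"

lemma V0: "0 \<in> V" and V_add: "f \<in> V \<Longrightarrow> g \<in> V \<Longrightarrow> f + g \<in> V" and V_scale: "f \<in> V \<Longrightarrow> c *\<^sub>C f \<in> V"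
  and T_add: "f \<in> V \<Longrightarrow> g \<in> V \<Longrightarrow> T (f + g) = T f + T g"
  and T_scale: "f \<in> V \<Longrightarrow> T (c *\<^sub>C f) = c *\<^sub>C T f"
  using sa by (auto simp: self_adjoint_op_def linear_op_def csubspace_def)

lemma V_diff: "f \<in> V \<Longrightarrow> g \<in> V \<Longrightarrow> f - g \<in> V" and T_diff: "f \<in> V \<Longrightarrow> g \<in> V \<Longrightarrow> T (f - g) = T f - T g"
  using V_add[of f "(-1) *\<^sub>C g"] T_add[of f "(-1) *\<^sub>C g"] V_scale[of g "-1"] T_scale[of g "-1"]
  by (simp_all add: scaleC_minus_one)

lemma T_pos: "f \<in> V \<Longrightarrow> 0 \<le> Re (cinner (T f) f)"
  using pos by (auto simp: positive_op_def complex_nonneg_Reals_iff)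

definition N :: "'h \<Rightarrow> 'h" where "N f = f + T f"

lemma N_diff: "f \<in> V \<Longrightarrow> g \<in> V \<Longrightarrow> N (f - g) = N f - N g"
  by (simp add: N_def T_diff)

lemma N_lower:
  assumes f: "f \<in> V" shows "norm f \<le> norm (N f)"
proof -
  have "(norm f)\<^sup>2 \<le> (norm (N f))\<^sup>2"
    using T_pos[OF f] cinner_commute[of f "T f"] by (simp add: N_def norm_add_square)
  then show ?thesis by (rule power2_le_imp_le) simp
qed

text \<open>\<open>I + L\<close> is onto: its range is closed, because \<open>I + L\<close> is bounded below and \<open>L\<close> is closed, and
  dense, because a vector orthogonal to it is an eigenvector of \<open>L\<close> for \<open>- 1\<close>.\<close>

lemma N_surj: "\<exists>f\<in>V. N f = h"
proof -
  define W where "W = N ` V"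
  have W: "csubspace W"
    unfolding csubspace_def
  proof (intro conjI ballI allI)
    have "N 0 = 0" using T_diff[OF V0 V0] by (simp add: N_def)
    then show "0 \<in> W" unfolding W_def using V0 by (metis image_eqI)
    fix f g assume "f \<in> W" "g \<in> W"
    then obtain a b where ab: "a \<in> V" "b \<in> V" "f = N a" "g = N b" by (auto simp: W_def)
    then have "f + g = N (a + b)" by (simp add: N_def T_add)
    then show "f + g \<in> W" using ab V_add by (auto simp: W_def)
  next
    fix c f assume "f \<in> W"
    then obtain a where a: "a \<in> V" "f = N a" by (auto simp: W_def)
    then have "c *\<^sub>C f = N (c *\<^sub>C a)" by (simp add: N_def T_scale scaleC_add_right)
    then show "c *\<^sub>C f \<in> W" using a V_scale by (auto simp: W_def)
  qed
  have "linear_functional_on W (\<lambda>f. cinner f h)"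
    by (simp add: linear_functional_on_def cinner.add_left cinner_scaleC_left)
  moreover have "cmod (cinner f h) \<le> norm h * norm f" for f
    using Cauchy_Schwarz_cinner[of f h] by (simp add: mult.commute)
  ultimately obtain u where u: "u \<in> closure W" "\<And>f. f \<in> W \<Longrightarrow> cinner f u = cinner f h"
    using Riesz_representation_subspace[OF W, of "\<lambda>f. cinner f h"] by blast
  define z where "z = h - u"
  have z: "cinner (T f) z = cinner f (- z)" if "f \<in> V" for f
  proof -
    have "cinner (N f) z = 0" using u(2)[of "N f"] that by (simp add: z_def cinner.diff_right W_def)
    then show ?thesis by (simp add: N_def cinner.add_left cinner.minus_right add_eq_0_iff)
  qed
  have "z \<in> V" "T z = - z" using self_adjoint_maximal[OF sa z] by auto
  then have "z = 0" using T_pos[of z] by (simp add: cinner.minus_left Re_cinner_same)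
  then have "h \<in> closure W" using u(1) by (simp add: z_def)
  then obtain w where w: "\<And>n. w n \<in> W" "w \<longlonglongrightarrow> h" unfolding closure_sequential by blast
  then obtain f where f: "\<And>n. f n \<in> V" "\<And>n. w n = N (f n)"
  proof -
    have "\<forall>n. \<exists>x. x \<in> V \<and> w n = N x" using w(1) unfolding W_def by auto
    from choice[OF this] show thesis using that by blast
  qed
  have "Cauchy f"
  proof (rule metric_CauchyI)
    fix e :: real assume "e > 0"
    then obtain M where M: "\<And>m n. m \<ge> M \<Longrightarrow> n \<ge> M \<Longrightarrow> dist (w m) (w n) < e"
      using LIMSEQ_imp_Cauchy[OF w(2)] metric_CauchyD by blast
    have "dist (f m) (f n) \<le> dist (w m) (w n)" for m n
      using N_lower[OF V_diff[OF f(1)[of m] f(1)[of n]]] by (simp add: dist_norm f N_diff)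
    then show "\<exists>M. \<forall>m\<ge>M. \<forall>n\<ge>M. dist (f m) (f n) < e" using M by (meson le_less_trans)
  qed
  then obtain f' where f': "f \<longlonglongrightarrow> f'" using Cauchy_convergent convergent_def by blast
  have Tf: "(\<lambda>n. T (f n)) \<longlonglongrightarrow> h - f'"
    using tendsto_diff[OF w(2) f'] by (simp add: f N_def)
  have "cinner (T g) f' = cinner g (h - f')" if g: "g \<in> V" for g
  proof (rule LIMSEQ_unique)
    show "(\<lambda>n. cinner (T g) (f n)) \<longlonglongrightarrow> cinner (T g) f'" by (intro cinner.tendsto f' tendsto_const)
    show "(\<lambda>n. cinner (T g) (f n)) \<longlonglongrightarrow> cinner g (h - f')"
      unfolding self_adjoint_sym[OF sa g f(1)] by (intro cinner.tendsto Tf tendsto_const)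
  qed
  then have "f' \<in> V" "T f' = h - f'" using self_adjoint_maximal[OF sa, of f' "h - f'"] by auto
  then show ?thesis by (intro bexI[of _ f']) (simp_all add: N_def)
qed

definition R :: "'h \<Rightarrow> 'h" where "R h = (SOME f. f \<in> V \<and> N f = h)"

lemma R: shows R_V: "R h \<in> V" and N_R: "N (R h) = h"
proof -
  have "R h \<in> V \<and> N (R h) = h" unfolding R_def by (rule someI_ex) (use N_surj[of h] in blast)
  then show "R h \<in> V" "N (R h) = h" by auto
qed

lemma R_unique: assumes "f \<in> V" "N f = h" shows "R h = f"
  using N_lower[OF V_diff[OF R_V[of h] assms(1)]] by (simp add: N_diff R_V assms N_R)

lemma T_R: "T (R h) = h - R h"
  using N_R[of h] by (simp add: N_def algebra_simps)

lemma R_contraction: "positive_contraction R"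
proof
  show "clin R"
    unfolding clin_def
  proof (intro conjI allI)
    show "R (f + g) = R f + R g" for f g
      by (rule R_unique) (auto simp: V_add R_V N_def T_add T_R)
    show "R (c *\<^sub>C f) = c *\<^sub>C R f" for c f
      by (rule R_unique) (auto simp: V_scale R_V N_def T_scale T_R scaleC_add_right[symmetric])
  qed
  show "cinner (R f) g = cinner f (R g)" for f g
    using self_adjoint_sym[OF sa R_V[of f] R_V[of g]] by (simp add: T_R cinner.diff_left cinner.diff_right)
  fix f
  have f: "f = R f + T (R f)" by (simp add: T_R)
  have p: "Re (cinner (R f) (T (R f))) \<ge> 0"
    using T_pos[OF R_V] cinner_commute[of "R f"] by simp
  have 1: "Re (cinner (R f) f) = (norm (R f))\<^sup>2 + Re (cinner (R f) (T (R f)))"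
    by (subst (2) f) (simp add: cinner.add_right Re_cinner_same)
  then show "0 \<le> Re (cinner (R f) f)" using p by simp
  have "(norm f)\<^sup>2 = (norm (R f))\<^sup>2 + (norm (T (R f)))\<^sup>2 + 2 * Re (cinner (R f) (T (R f)))"
    by (subst f) (rule norm_add_square)
  then show "Re (cinner (R f) f) \<le> (norm f)\<^sup>2" using 1 p zero_le_power2[of "norm (T (R f))"] by linarith
qed

sublocale R: positive_contraction R by (rule R_contraction)

text \<open>The spectral projection of \<open>{0}\<close> maps into the kernel of \<open>R\<close>, which is trivial.\<close>

lemma R_G_zero: "R.G {0} f = 0"
proof -
  define w where "w = R.G {0} f"
  have "emeasure (R.mu w) (- {0}) = emeasure (R.mu f) ({0} \<inter> - {0})"
    unfolding w_def by (rule R.mu_E) auto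
  then have "AE x in R.mu w. x = 0" by (intro AE_I[of _ _ "- {0}"]) auto
  then have "(\<integral>x. x\<^sup>2 \<partial>R.mu w) = (\<integral>x. 0 \<partial>R.mu w)" by (intro integral_cong_AE) auto
  then have "(norm (R w))\<^sup>2 = 0"
    using R.spec_norm[of "\<lambda>x. x" w] by (simp add: R.D_id R.spec_id)
  then have "R w = 0" by simp
  then have "w = N 0" using N_R[of w] by simp
  then show ?thesis using T_diff[OF V0 V0] by (simp add: N_def w_def)
qed

definition inv_R :: "real \<Rightarrow> real" where "inv_R x = 1 / x - 1"

lemma inv_R_measurable [measurable]: "inv_R \<in> borel_measurable borel"
  unfolding inv_R_def by measurable

text \<open>Since \<open>L = R\<^sup>-\<^sup>1 - I\<close>, the spectral measure of \<open>L\<close> is the image of that of \<open>R\<close> under \<open>inv_R\<close>. The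
  point \<open>0\<close>, where \<open>1 / x\<close> has its default value \<open>0\<close>, is null by \<open>R_G_zero\<close>.\<close>

definition E where "E S = R.G (inv_R -` S)"

lemma vimage_inv_R: "S \<in> sets borel \<Longrightarrow> inv_R -` S \<in> sets borel"
  using measurable_sets[OF inv_R_measurable, of S] by simp

lemma E_pvm: "projection_valued_measure E"
proof -
  have s: "(\<lambda>n. E (A n) f) sums E (\<Union>n. A n) f" if "range A \<subseteq> sets borel" "disjoint_family A" for A :: "nat \<Rightarrow> real set" and f
  proof -
    have "range (\<lambda>n. inv_R -` A n) \<subseteq> sets borel" using that vimage_inv_R by auto
    moreover have "disjoint_family (\<lambda>n. inv_R -` A n)" using that(2) by (auto simp: disjoint_family_on_def)
    ultimately show ?thesis using R.E_sums[of "\<lambda>n. inv_R -` A n" f] by (simp add: E_def vimage_UN)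
  qed
  show ?thesis
    unfolding projection_valued_measure_def linear_op_UNIV
    by (auto simp: s) (auto simp: E_def vimage_inv_R R.E_clin R.E_idem R.E_sym R.E_empty R.E_UNIV R.E_Int)
qed

sublocale E: pvm E by (rule pvm.intro[OF E_pvm])

lemma mu_E_eq: "E.mu f = distr (R.mu f) borel inv_R"
proof (rule measure_eqI)
  fix S assume "S \<in> sets (E.mu f)"
  then have "S \<in> sets borel" by simp
  then show "emeasure (E.mu f) S = emeasure (distr (R.mu f) borel inv_R) S"
    by (simp add: E.emeasure_mu emeasure_distr R.emeasure_mu vimage_inv_R E_def)
qed simp

lemma spectral_integral_E: "spectral_integral E (\<lambda>x. x) = spectral_integral R.G inv_R"
proof -
  have 1: "spectral_domain E (\<lambda>x. x) = spectral_domain R.G inv_R"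
    by (simp add: spectral_domain_def mu_E_eq nn_integral_distr)
  have 2: "spectral_form E (\<lambda>x. x) f g = spectral_form R.G inv_R f g" for f g
    by (simp add: spectral_form_def mu_E_eq integral_distr)
  show ?thesis unfolding spectral_integral_def 1 2 ..
qed

text \<open>Write \<open>f = R u = id(R) u\<close>. Composition of functions of \<open>R\<close> gives \<open>inv_R(R) f = (1 - id)(R) u = u - R u = L f\<close>.\<close>

lemma V_spec:
  assumes f: "f \<in> V" shows "f \<in> R.D inv_R" and "R.spec inv_R f = T f"
proof -
  define u where "u = N f"
  have fu: "f = R u" using R_unique[OF f] by (simp add: u_def)
  define \<phi> where "\<phi> x = inv_R x * x" for x
  have \<phi>m [measurable]: "\<phi> \<in> borel_measurable borel" unfolding \<phi>_def by measurable
  have \<phi>x: "\<phi> x = (if x = 0 then 0 else 1 - x)" for x by (simp add: \<phi>_def inv_R_def field_simps)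
  have d\<phi>: "u \<in> R.D \<phi>" by (rule R.D_AE_bounded[of _ 1]) (auto simp: \<phi>x)
  have d1: "u \<in> R.D (\<lambda>x. \<phi> x + x)" by (rule R.D_AE_bounded[of _ 1]) (auto simp: \<phi>x)
  have f': "f = R.spec (\<lambda>x. x) u" by (simp add: fu R.spec_id)
  show "f \<in> R.D inv_R"
    unfolding f' using d\<phi> by (subst R.spec_D_iff) (auto simp: R.D_id \<phi>_def[abs_def])
  have eq: "R.spec inv_R f = R.spec \<phi> u"
    unfolding f' \<phi>_def[abs_def]
    by (rule R.spec_spec[OF _ inv_R_measurable R.D_id d\<phi>[unfolded \<phi>_def[abs_def]]]) simp
  have "emeasure (R.mu u) {0} = 0" by (simp add: R.emeasure_mu R_G_zero)
  then have "AE x in R.mu u. x \<noteq> 0" by (intro AE_I[of _ _ "{0}"]) auto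
  then have "AE x in R.mu u. \<phi> x + x = 1" by eventually_elim (simp add: \<phi>x)
  then have "R.spec (\<lambda>x. \<phi> x + x) u = R.spec (\<lambda>_. 1) u"
    by (rule R.spec_eqI[OF _ _ d1 R.D_one, rotated 2]) simp_all
  moreover have "R.spec (\<lambda>x. \<phi> x + x) u = R.spec \<phi> u + R u"
  proof -
    have "(\<lambda>x::real. x) \<in> borel_measurable borel" by simp
    from R.spec_fun_add[where \<phi>=\<phi> and \<psi>="\<lambda>x. x" and f=u, OF \<phi>m this d\<phi> R.D_id d1]
    have "R.spec (\<lambda>x. \<phi> x + x) u = R.spec \<phi> u + R.spec (\<lambda>x. x) u" .
    moreover have "R.spec (\<lambda>x. x) u = R u" by (rule R.spec_id)
    ultimately show "R.spec (\<lambda>x. \<phi> x + x) u = R.spec \<phi> u + R u" by argo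
  qed
  ultimately have "R.spec \<phi> u + R u = u" by (simp only: R.spec_one)
  then have "R.spec \<phi> u = u - R u" by (simp only: eq_diff_eq)
  then show "R.spec inv_R f = T f" unfolding eq by (simp only: fu T_R)
qed

text \<open>The symmetric operator \<open>inv_R(R)\<close> extends \<open>L\<close>, and a self-adjoint operator has no proper symmetric
  extension.\<close>

lemma D_inv_R_V:
  assumes f: "f \<in> R.D inv_R" shows "f \<in> V"
proof (rule self_adjoint_maximal(1)[OF sa])
  fix g assume g: "g \<in> V"
  show "cinner (T g) f = cinner g (R.spec inv_R f)"
    using R.spec_sym[OF _ V_spec(1)[OF g] f] V_spec(2)[OF g] by simp
qed

lemma L_eq_spectral: "op_eq L (spectral_integral E (\<lambda>x. x))"
  unfolding op_eq_def spectral_integral_E R.dom_spectral_integral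
proof (intro conjI ballI)
  show "V = R.D inv_R" using V_spec(1) D_inv_R_V by blast
  show "T f = app_op (spectral_integral R.G inv_R) f" if "f \<in> V" for f
    using V_spec[OF that] by (simp add: R.app_spectral_integral)
qed

lemma spectral_measure_props:
  shows spectral_measure_pvm: "projection_valued_measure (spectral_measure L)"
    and spectral_measure_L: "op_eq L (spectral_integral (spectral_measure L) (\<lambda>x. x))"
proof -
  have "\<exists>E. projection_valued_measure E \<and> op_eq L (spectral_integral E (\<lambda>x. x))"
    using E_pvm L_eq_spectral by blast
  from someI_ex[OF this, folded spectral_measure_def]
  show "projection_valued_measure (spectral_measure L)" "op_eq L (spectral_integral (spectral_measure L) (\<lambda>x. x))"
    by blast+
qed

sublocale S: pvm "spectral_measure L" by (rule pvm.intro[OF spectral_measure_pvm])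

text \<open>A vector \<open>u\<close> in the range of the spectral projection of \<open>(-n, 0)\<close> has
  \<open>\<langle>L u, u\<rangle> = \<integral> x d\<langle>E u, u\<rangle>\<close> with an integrand that is negative almost everywhere.\<close>

lemma spectral_measure_negative: "emeasure (S.mu f) {..<0} = 0"
proof -
  define A where "A n = {- real n<..<0}" for n
  have A [measurable]: "A n \<in> sets borel" for n by (simp add: A_def)
  have null: "emeasure (S.mu f) (A n) = 0" for n
  proof -
    define u where "u = spectral_measure L (A n) f"
    have "emeasure (S.mu u) (- A n) = emeasure (S.mu f) (A n \<inter> - A n)"
      unfolding u_def by (rule S.mu_E) auto
    then have ae: "AE x in S.mu u. x \<in> A n" by (intro AE_I[of _ _ "- A n"]) auto
    have i: "integrable (S.mu u) (\<lambda>x. x\<^sup>2)"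
    proof (rule finite_measure.integrable_const_bound[OF S.finite_mu, where B = "(real n)\<^sup>2"])
      show "AE x in S.mu u. norm (x\<^sup>2) \<le> (real n)\<^sup>2"
        using ae by eventually_elim (auto simp: A_def abs_le_square_iff[symmetric])
    qed simp
    then have d: "u \<in> S.D (\<lambda>x. x)" by (simp add: S.D_iff)
    have uV: "u \<in> V" using spectral_measure_L d by (simp add: op_eq_def S.dom_spectral_integral)
    have Tu: "T u = S.spec (\<lambda>x. x) u" using spectral_measure_L d uV by (simp add: op_eq_def S.app_spectral_integral)
    have "cinner (T u) u = of_real (\<integral>x. x \<partial>S.mu u)"
      using S.spec_cinner[OF _ _ d S.D_one] by (simp add: Tu S.spec_one)
    then have ge: "0 \<le> (\<integral>x. x \<partial>S.mu u)" using T_pos[OF uV] by simp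
    have i1: "integrable (S.mu u) (\<lambda>x. - x)" using S.D_integrable[OF _ d] by simp
    have nn: "AE x in S.mu u. 0 \<le> - x" using ae by eventually_elim (simp add: A_def)
    have "(\<integral>x. - x \<partial>S.mu u) = 0"
      using ge integral_nonneg_AE[OF nn] by simp
    then have "AE x in S.mu u. - x = 0" using integral_nonneg_eq_0_iff_AE[OF i1 nn] by simp
    with ae have "AE x in S.mu u. False" by eventually_elim (simp add: A_def)
    then have "emeasure (S.mu u) UNIV = 0" by (simp add: AE_iff_null null_sets_def)
    then have "norm u = 0" by (simp add: S.emeasure_mu S.E_UNIV)
    then show ?thesis by (simp add: S.emeasure_mu u_def)
  qed
  have "{..<0} = (\<Union>n. A n)"
  proof
    show "{..<0} \<subseteq> (\<Union>n. A n)"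
    proof
      fix x :: real assume "x \<in> {..<0}"
      moreover obtain n where "- x < real n" using reals_Archimedean2 by blast
      ultimately show "x \<in> (\<Union>n. A n)" by (auto simp: A_def intro!: exI[of _ n])
    qed
  qed (auto simp: A_def)
  then show ?thesis using emeasure_UN_eq_0[of "S.mu f" A, OF null] A by (simp add: image_subset_iff)
qed

lemma AE_nonneg: "AE x in S.mu f. 0 \<le> x"
  by (rule AE_I[OF _ spectral_measure_negative]) auto

end

section \<open>Weighted sequence norms and discretization of the interpolation norm\<close>

lemma epowr_ennreal: "0 \<le> x \<Longrightarrow> epowr (ennreal x) p = ennreal (x powr p)"
  by (simp add: epowr_def)

lemma epowr_mono:
  assumes "x \<le> y" "0 \<le> p" shows "epowr x p \<le> epowr y p"
proof (cases "y = \<infinity>")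
  case True
  then show ?thesis by (simp add: epowr_def)
next
  case False
  then obtain b where b: "y = ennreal b" "0 \<le> b" by (cases y) auto
  obtain a where a: "x = ennreal a" "0 \<le> a" using assms(1) b by (cases x) (auto simp: top_unique)
  have "a \<le> b" using assms(1) a b by simp
  then show ?thesis using a b assms(2) by (simp add: epowr_ennreal powr_mono2)
qed

text \<open>For non-negative \<open>u\<close> the bound \<open>lq_norm q u \<le> M\<close> is equivalent to \<open>lq_le q u M\<close>
  (\<open>lq_norm_le_iff\<close>), which involves no infinite values, so the estimates are made in the reals.\<close>

definition lq_norm :: "ennreal \<Rightarrow> (nat \<Rightarrow> real) \<Rightarrow> ennreal" where
  "lq_norm q u = (if q = \<infinity> then SUP j. ennreal (u j)
     else epowr (\<Sum>j. ennreal (u j powr enn2real q)) (1 / enn2real q))"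

definition lq_le :: "ennreal \<Rightarrow> (nat \<Rightarrow> real) \<Rightarrow> real \<Rightarrow> bool" where
  "lq_le q u M = (if q = \<infinity> then \<forall>j. u j \<le> M
     else \<forall>n. (\<Sum>j<n. u j powr enn2real q) \<le> M powr enn2real q)"

lemma enn2real_ge_1: "1 \<le> q \<Longrightarrow> q \<noteq> \<infinity> \<Longrightarrow> 1 \<le> enn2real q"
  by (cases q) (auto simp: enn2real_ennreal)

lemma lq_norm_le_iff:
  assumes q: "1 \<le> q" and u: "\<And>j. 0 \<le> u j" and M: "0 \<le> M"
  shows "lq_norm q u \<le> ennreal M \<longleftrightarrow> lq_le q u M"
proof (cases "q = \<infinity>")
  case True
  then show ?thesis using M by (simp add: lq_norm_def lq_le_def SUP_le_iff)
next
  case False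
  define p where "p = enn2real q"
  have p: "p \<ge> 1" using enn2real_ge_1[OF q False] by (simp add: p_def)
  define S where "S = (\<Sum>j. ennreal (u j powr p))"
  have "epowr S (1 / p) \<le> ennreal M \<longleftrightarrow> S \<le> ennreal (M powr p)"
  proof (cases "S = \<infinity>")
    case True
    then show ?thesis by (simp add: epowr_def top_unique)
  next
    case fin: False
    then obtain s where s: "S = ennreal s" "s \<ge> 0" by (cases S) auto
    have "s powr (1 / p) \<le> M \<longleftrightarrow> s \<le> M powr p"
    proof
      assume "s powr (1 / p) \<le> M"
      then have "(s powr (1 / p)) powr p \<le> M powr p" using p by (intro powr_mono2) auto
      then show "s \<le> M powr p" using p s by (simp add: powr_powr)
    next
      assume "s \<le> M powr p"
      then have "s powr (1 / p) \<le> (M powr p) powr (1 / p)" using p s by (intro powr_mono2) auto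
      then show "s powr (1 / p) \<le> M" using p M by (simp add: powr_powr)
    qed
    then show ?thesis using s M by (simp add: epowr_ennreal)
  qed
  also have "\<dots> \<longleftrightarrow> (\<forall>n. (\<Sum>j<n. ennreal (u j powr p)) \<le> ennreal (M powr p))"
  proof
    assume "S \<le> ennreal (M powr p)"
    moreover have "(\<Sum>j<n. ennreal (u j powr p)) \<le> S" for n
      unfolding S_def by (rule sum_le_suminf) auto
    ultimately show "\<forall>n. (\<Sum>j<n. ennreal (u j powr p)) \<le> ennreal (M powr p)"
      using order_trans by blast
  next
    assume "\<forall>n. (\<Sum>j<n. ennreal (u j powr p)) \<le> ennreal (M powr p)"
    then show "S \<le> ennreal (M powr p)" unfolding S_def by (intro suminf_le_const) auto
  qed
  also have "\<dots> \<longleftrightarrow> (\<forall>n. (\<Sum>j<n. u j powr p) \<le> M powr p)"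
    by (simp add: sum_ennreal)
  finally show ?thesis using False by (simp add: lq_norm_def lq_le_def p_def S_def)
qed

lemma lq_norm_transfer:
  assumes q: "1 \<le> q" and u: "\<And>j. 0 \<le> u j" and v: "\<And>j. 0 \<le> v j" and c: "0 < c"
    and le: "\<And>M. 0 \<le> M \<Longrightarrow> lq_le q u M \<Longrightarrow> lq_le q v (c * M)"
  shows "lq_norm q v \<le> ennreal c * lq_norm q u"
proof (cases "lq_norm q u = \<infinity>")
  case True
  then show ?thesis using c by (simp add: ennreal_mult_eq_top_iff)
next
  case False
  then obtain M where M: "lq_norm q u = ennreal M" "M \<ge> 0" by (cases "lq_norm q u") auto
  then have "lq_norm q u \<le> ennreal M" by simp
  then have "lq_le q u M" using lq_norm_le_iff[of q u M, OF q u M(2)] by blast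
  then have "lq_le q v (c * M)" by (rule le[OF M(2)])
  then have "lq_norm q v \<le> ennreal (c * M)" using lq_norm_le_iff[of q v "c * M", OF q v] c M(2) by simp
  then show ?thesis using M c by (simp add: ennreal_mult)
qed

lemma lq_le_mono:
  assumes "\<And>j. 0 \<le> u j" "\<And>j. u j \<le> v j" "1 \<le> q" "lq_le q v M"
  shows "lq_le q u M"
proof (cases "q = \<infinity>")
  case True
  have "u j \<le> M" for j
  proof -
    have "v j \<le> M" using assms(4) True by (simp add: lq_le_def)
    with assms(2)[of j] show ?thesis by simp
  qed
  then show ?thesis using True by (simp add: lq_le_def)
next
  case False
  have "(\<Sum>j<n. u j powr enn2real q) \<le> M powr enn2real q" for n
  proof -
    have "(\<Sum>j<n. u j powr enn2real q) \<le> (\<Sum>j<n. v j powr enn2real q)"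
      by (intro sum_mono powr_mono2) (use assms in auto)
    also have "\<dots> \<le> M powr enn2real q" using assms(4) False by (simp add: lq_le_def)
    finally show ?thesis .
  qed
  then show ?thesis using False by (simp add: lq_le_def)
qed

lemma lq_le_scale:
  assumes u: "\<And>j. 0 \<le> u j" and c: "0 \<le> c" and M: "0 \<le> M" and "lq_le q u M"
  shows "lq_le q (\<lambda>j. c * u j) (c * M)"
proof (cases "q = \<infinity>")
  case True
  then show ?thesis using assms(4) c by (simp add: lq_le_def mult_left_mono)
next
  case False
  have "(\<Sum>j<n. (c * u j) powr enn2real q) = c powr enn2real q * (\<Sum>j<n. u j powr enn2real q)" for n
    unfolding sum_distrib_left by (rule sum.cong[OF refl]) (simp add: powr_mult c u)
  moreover have "c powr enn2real q * (\<Sum>j<n. u j powr enn2real q) \<le> c powr enn2real q * M powr enn2real q" for n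
    using assms(4) False by (intro mult_left_mono) (simp_all add: lq_le_def)
  ultimately have "(\<Sum>j<n. (c * u j) powr enn2real q) \<le> (c * M) powr enn2real q" for n
    using c M by (simp add: powr_mult)
  then show ?thesis using False by (simp add: lq_le_def)
qed

lemma lq_le_add:
  assumes q: "1 \<le> q" and u: "\<And>j. 0 \<le> u j" and v: "\<And>j. 0 \<le> v j" and M: "0 \<le> M" "0 \<le> M'"
    and le: "lq_le q u M" "lq_le q v M'"
  shows "lq_le q (\<lambda>j. u j + v j) (4 * (M + M'))"
proof (cases "q = \<infinity>")
  case True
  have "u j + v j \<le> 4 * (M + M')" for j
  proof -
    have "u j \<le> M" "v j \<le> M'" using le True by (auto simp: lq_le_def)
    then show ?thesis using M by argo
  qed
  then show ?thesis using True by (simp add: lq_le_def)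
next
  case False
  define p where "p = enn2real q"
  have p: "p \<ge> 1" using enn2real_ge_1[OF q False] by (simp add: p_def)
  have "(\<Sum>j<n. (u j + v j) powr p) \<le> (4 * (M + M')) powr p" for n
  proof -
    have "(u j + v j) powr p \<le> 2 powr p * (u j powr p + v j powr p)" for j
    proof -
      have "(u j + v j) powr p \<le> (2 * max (u j) (v j)) powr p" using u[of j] v[of j] p by (intro powr_mono2) auto
      also have "\<dots> = 2 powr p * max (u j) (v j) powr p" using u[of j] by (simp add: powr_mult)
      also have "\<dots> \<le> 2 powr p * (u j powr p + v j powr p)" by (intro mult_left_mono) (auto simp: max_def)
      finally show ?thesis .
    qed
    then have "(\<Sum>j<n. (u j + v j) powr p) \<le> (\<Sum>j<n. 2 powr p * (u j powr p + v j powr p))" by (intro sum_mono)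
    also have "\<dots> = 2 powr p * ((\<Sum>j<n. u j powr p) + (\<Sum>j<n. v j powr p))"
      by (simp add: sum_distrib_left sum.distrib distrib_left)
    also have "\<dots> \<le> 2 powr p * (M powr p + M' powr p)"
      using le False by (intro mult_left_mono add_mono) (auto simp: lq_le_def p_def)
    also have "\<dots> \<le> 2 powr p * ((M + M') powr p + (M + M') powr p)"
      using M p by (intro mult_left_mono add_mono powr_mono2) auto
    also have "\<dots> = 2 * (2 * (M + M')) powr p" using powr_mult[of 2 "M + M'" p] M by simp
    also have "\<dots> \<le> 2 powr p * (2 * (M + M')) powr p"
      using p powr_mono[of 1 p 2] by (intro mult_right_mono) auto
    also have "\<dots> = (4 * (M + M')) powr p" using powr_mult[of 2 "2 * (M + M')" p] M by simp
    finally show ?thesis .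
  qed
  then show ?thesis using False by (simp add: lq_le_def p_def)
qed

text \<open>Jensen's inequality for the two points \<open>t\<close> and \<open>u / (1 - \<kappa>)\<close> with weights \<open>\<kappa>\<close> and \<open>1 - \<kappa>\<close>. The
  coefficient of \<open>t powr p\<close> is less than \<open>1\<close>, so a sum of such terms can be absorbed.\<close>

lemma powr_convex_step:
  fixes t u \<kappa> p :: real
  assumes t: "0 \<le> t" and u: "0 \<le> u" and \<kappa>: "0 < \<kappa>" "\<kappa> < 1" and p: "1 \<le> p"
  shows "(\<kappa> * t + u) powr p \<le> \<kappa> * t powr p + (1 - \<kappa>) powr (1 - p) * u powr p"
proof -
  consider "t = 0" | "u = 0" | "t > 0" "u > 0" using t u by linarith
  then show ?thesis
  proof cases
    case 1
    have "1 \<le> (1 - \<kappa>) powr (1 - p)" using powr_mono'[of "1 - p" 0 "1 - \<kappa>"] \<kappa> p by simp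
    then show ?thesis using 1 by (simp add: mult_le_cancel_right1)
  next
    case 2
    have "\<kappa> powr p \<le> \<kappa>" using powr_mono'[of 1 p \<kappa>] \<kappa> p by simp
    then show ?thesis using 2 t \<kappa> by (simp add: powr_mult mult_right_mono)
  next
    case 3
    have "((1 - (1 - \<kappa>)) * t + (1 - \<kappa>) * (u / (1 - \<kappa>))) powr p
        \<le> (1 - (1 - \<kappa>)) * t powr p + (1 - \<kappa>) * (u / (1 - \<kappa>)) powr p"
      using convex_onD[OF powr_convex[OF p], of "1 - \<kappa>" t "u / (1 - \<kappa>)"] 3 \<kappa> by simp
    moreover have "(1 - \<kappa>) * (u / (1 - \<kappa>)) powr p = (1 - \<kappa>) powr (1 - p) * u powr p"
      using \<kappa> 3 by (simp add: powr_divide powr_diff)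
    ultimately show ?thesis using \<kappa> by simp
  qed
qed

text \<open>A discrete Hardy inequality, for sequences given by a contracting recursion instead of the
  explicit geometric convolution.\<close>

lemma Hardy_recursion:
  fixes T u :: "nat \<Rightarrow> real"
  assumes nn: "\<And>j. 0 \<le> T j" "\<And>j. 0 \<le> u j" and \<kappa>: "0 < \<kappa>" "\<kappa> < 1" and p: "1 \<le> p"
    and base: "T 0 \<le> u 0" and step: "\<And>j. Suc j < n \<Longrightarrow> T (Suc j) \<le> \<kappa> * T j + u (Suc j)"
  shows "(\<Sum>j<n. T j powr p) \<le> (1 / (1 - \<kappa>)) powr p * (\<Sum>j<n. u j powr p)"
proof -
  define c where "c = (1 - \<kappa>) powr (1 - p)"
  have c1: "c \<ge> 1" unfolding c_def using powr_mono'[of "1 - p" 0 "1 - \<kappa>"] \<kappa> p by simp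
  have ind: "k < n \<Longrightarrow> (\<Sum>j<Suc k. T j powr p) \<le> c * (\<Sum>j<Suc k. u j powr p) + \<kappa> * (\<Sum>j<k. T j powr p)" for k
  proof (induction k)
    case 0
    have "T 0 powr p \<le> u 0 powr p" using base nn p by (intro powr_mono2) auto
    also have "\<dots> \<le> c * u 0 powr p" using c1 by (simp add: mult_le_cancel_right1)
    finally show ?case by simp
  next
    case (Suc k)
    have "T (Suc k) powr p \<le> (\<kappa> * T k + u (Suc k)) powr p"
      using step[OF Suc.prems] nn p by (intro powr_mono2) auto
    also have "\<dots> \<le> \<kappa> * T k powr p + c * u (Suc k) powr p"
      unfolding c_def by (rule powr_convex_step) (use nn \<kappa> p in auto)
    finally have "T (Suc k) powr p \<le> \<kappa> * T k powr p + c * u (Suc k) powr p" .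
    moreover have "(\<Sum>j<Suc k. T j powr p) \<le> c * (\<Sum>j<Suc k. u j powr p) + \<kappa> * (\<Sum>j<k. T j powr p)"
      using Suc by simp
    ultimately show ?case by (simp add: algebra_simps)
  qed
  show ?thesis
  proof (cases n)
    case 0 then show ?thesis by simp
  next
    case (Suc k)
    have "(\<Sum>j<n. T j powr p) \<le> c * (\<Sum>j<n. u j powr p) + \<kappa> * (\<Sum>j<k. T j powr p)"
      using ind[of k] Suc by simp
    also have "\<dots> \<le> c * (\<Sum>j<n. u j powr p) + \<kappa> * (\<Sum>j<n. T j powr p)"
      using Suc \<kappa> by simp
    finally have "(1 - \<kappa>) * (\<Sum>j<n. T j powr p) \<le> c * (\<Sum>j<n. u j powr p)" by (simp add: algebra_simps)
    then have "(\<Sum>j<n. T j powr p) \<le> c / (1 - \<kappa>) * (\<Sum>j<n. u j powr p)"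
      using \<kappa> by (simp add: field_simps)
    also have "c / (1 - \<kappa>) = (1 / (1 - \<kappa>)) powr p"
      unfolding c_def using \<kappa> by (simp add: powr_diff powr_divide)
    finally show ?thesis .
  qed
qed

lemma sup_recursion:
  fixes T u :: "nat \<Rightarrow> real"
  assumes \<kappa>: "0 < \<kappa>" "\<kappa> < 1" and M: "\<And>j. j < n \<Longrightarrow> u j \<le> M"
    and base: "T 0 \<le> u 0" and step: "\<And>j. Suc j < n \<Longrightarrow> T (Suc j) \<le> \<kappa> * T j + u (Suc j)" and M0: "0 \<le> M"
  shows "j < n \<Longrightarrow> T j \<le> 1 / (1 - \<kappa>) * M"
proof (induction j)
  case 0
  have "T 0 \<le> M" using base M[OF 0] by simp
  also have "\<dots> \<le> 1 / (1 - \<kappa>) * M" using \<kappa> M0 by (simp add: field_simps)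
  finally show ?case .
next
  case (Suc j)
  have "T (Suc j) \<le> \<kappa> * T j + M" using step[OF Suc.prems] M[OF Suc.prems] by simp
  also have "\<dots> \<le> \<kappa> * (1 / (1 - \<kappa>) * M) + M"
    by (intro add_right_mono mult_left_mono Suc.IH) (use Suc.prems \<kappa> in auto)
  also have "\<dots> = 1 / (1 - \<kappa>) * M" using \<kappa> by (simp add: field_simps)
  finally show ?case .
qed

lemma lq_le_forward:
  assumes q: "1 \<le> q" and nn: "\<And>j. 0 \<le> T j" "\<And>j. 0 \<le> u j" and \<kappa>: "0 < \<kappa>" "\<kappa> < 1" and M: "0 \<le> M"
    and base: "T 0 \<le> u 0" and step: "\<And>j. T (Suc j) \<le> \<kappa> * T j + u (Suc j)" and le: "lq_le q u M"
  shows "lq_le q T (1 / (1 - \<kappa>) * M)"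
proof (cases "q = \<infinity>")
  case True
  then show ?thesis using sup_recursion[OF \<kappa> _ base step M, of "Suc _"] le by (auto simp: lq_le_def)
next
  case False
  have "(\<Sum>j<n. T j powr enn2real q) \<le> (1 / (1 - \<kappa>) * M) powr enn2real q" for n
  proof -
    have "(\<Sum>j<n. T j powr enn2real q) \<le> (1 / (1 - \<kappa>)) powr enn2real q * (\<Sum>j<n. u j powr enn2real q)"
      by (rule Hardy_recursion[OF nn \<kappa> enn2real_ge_1[OF q False] base step])
    also have "\<dots> \<le> (1 / (1 - \<kappa>)) powr enn2real q * M powr enn2real q"
      using le False by (intro mult_left_mono) (auto simp: lq_le_def)
    finally show ?thesis using \<kappa> M by (simp only: powr_mult)
  qed
  then show ?thesis using False by (simp add: lq_le_def)
qed

text \<open>The backward recursion is the forward one read from an index \<open>N\<close> downwards. The sequence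
  \<open>max 0 (e j - e N)\<close> satisfies the same recursion for \<open>j < N\<close> and vanishes at \<open>N\<close>, so the forward bound
  applies to it; as \<open>N\<close> tends to infinity it converges to \<open>e j\<close>.\<close>

lemma lq_le_backward:
  fixes e a :: "nat \<Rightarrow> real"
  assumes q: "1 \<le> q" and nn: "\<And>j. 0 \<le> e j" "\<And>j. 0 \<le> a j" and \<beta>: "1 < \<beta>" and M: "0 \<le> M"
    and step: "\<And>j. e j \<le> e (Suc j) + a (Suc j)" and lim: "e \<longlonglongrightarrow> 0" and le: "lq_le q (\<lambda>j. \<beta> ^ j * a j) M"
  shows "lq_le q (\<lambda>j. \<beta> ^ j * e j) (1 / (1 - 1 / \<beta>) * M)"
proof -
  define \<kappa> where "\<kappa> = 1 / \<beta>"
  have \<kappa>: "0 < \<kappa>" "\<kappa> < 1" using \<beta> by (auto simp: \<kappa>_def)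
  define y where "y N j = max 0 (e j - e N)" for N j
  define T where "T N i = \<beta> ^ (N - i) * y N (N - i)" for N i
  define u where "u N i = (if i = 0 then 0 else \<kappa> * (\<beta> ^ (Suc N - i) * a (Suc N - i)))" for N i
  have T0: "0 \<le> T N i" for N i using \<beta> by (simp add: T_def y_def)
  have u0: "0 \<le> u N i" for N i using \<beta> \<kappa> nn by (simp add: u_def)
  have base: "T N 0 \<le> u N 0" for N by (simp add: T_def y_def u_def)
  have stepT: "T N (Suc i) \<le> \<kappa> * T N i + u N (Suc i)" if "Suc i < Suc N" for N i
  proof -
    define j where "j = N - Suc i"
    have j: "N - i = Suc j" "N - Suc i = j" "Suc N - Suc i = Suc j" using that by (auto simp: j_def)
    have "y N j \<le> y N (Suc j) + a (Suc j)" using step[of j] nn(2)[of "Suc j"] by (auto simp: y_def)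
    then have "\<beta> ^ j * y N j \<le> \<beta> ^ j * (y N (Suc j) + a (Suc j))" using \<beta> by (intro mult_left_mono) auto
    also have "\<dots> = \<kappa> * (\<beta> ^ Suc j * y N (Suc j)) + \<kappa> * (\<beta> ^ Suc j * a (Suc j))"
      using \<beta> by (simp add: \<kappa>_def algebra_simps)
    finally show ?thesis unfolding T_def u_def j by simp
  qed
  have ylim: "(\<lambda>N. \<beta> ^ j * y N j) \<longlonglongrightarrow> \<beta> ^ j * e j" for j
  proof -
    have "(\<lambda>N. \<beta> ^ j * y N j) \<longlonglongrightarrow> \<beta> ^ j * max 0 (e j - 0)" unfolding y_def by (intro tendsto_intros lim)
    then show ?thesis using nn by simp
  qed
  show ?thesis
  proof (cases "q = \<infinity>")
    case True
    have "\<beta> ^ j * e j \<le> 1 / (1 - \<kappa>) * M" for j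
    proof (rule LIMSEQ_le_const2[OF ylim], intro exI[of _ j] allI impI)
      fix N assume N: "j \<le> N"
      have "u N i \<le> M" for i
      proof -
        have "\<kappa> * (\<beta> ^ k * a k) \<le> 1 * M" for k
          using le True \<kappa> \<beta> nn M by (intro mult_mono) (auto simp: lq_le_def)
        then show ?thesis using M by (simp add: u_def)
      qed
      then have "T N (N - j) \<le> 1 / (1 - \<kappa>) * M"
        by (intro sup_recursion[of \<kappa> "Suc N" "u N" M "T N" "N - j"] \<kappa> base stepT M) auto
      then show "\<beta> ^ j * y N j \<le> 1 / (1 - \<kappa>) * M" using N by (simp add: T_def)
    qed
    then show ?thesis using True by (simp add: lq_le_def \<kappa>_def)
  next
    case False
    define p where "p = enn2real q"
    have p: "p \<ge> 1" using enn2real_ge_1[OF q False] by (simp add: p_def)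
    have uM: "(\<Sum>i<Suc N. u N i powr p) \<le> M powr p" for N
    proof -
      have "(\<Sum>i<Suc N. u N i powr p) = (\<Sum>i<N. (\<kappa> * (\<beta> ^ Suc (N - Suc i) * a (Suc (N - Suc i)))) powr p)"
        unfolding sum.lessThan_Suc_shift u_def using p by (auto simp: Suc_diff_Suc intro!: sum.cong)
      also have "(\<Sum>i<N. (\<kappa> * (\<beta> ^ Suc (N - Suc i) * a (Suc (N - Suc i)))) powr p) = (\<Sum>j<N. (\<kappa> * (\<beta> ^ Suc j * a (Suc j))) powr p)"
        by (rule sum.nat_diff_reindex)
      also have "\<dots> \<le> (\<Sum>j<N. (\<beta> ^ Suc j * a (Suc j)) powr p)"
        using \<kappa> \<beta> nn p by (intro sum_mono powr_mono2 mult_left_le_one_le) auto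
      also have "\<dots> \<le> (\<Sum>j<Suc N. (\<beta> ^ j * a j) powr p)"
        unfolding sum.lessThan_Suc_shift by simp
      also have "\<dots> \<le> M powr p" using le False by (simp add: lq_le_def p_def del: sum.lessThan_Suc)
      finally show ?thesis .
    qed
    have "(\<Sum>j<n. (\<beta> ^ j * e j) powr p) \<le> (1 / (1 - \<kappa>) * M) powr p" for n
    proof (rule LIMSEQ_le_const2)
      show "(\<lambda>N. \<Sum>j<n. (\<beta> ^ j * y N j) powr p) \<longlonglongrightarrow> (\<Sum>j<n. (\<beta> ^ j * e j) powr p)"
      proof (rule tendsto_sum)
        fix j
        show "(\<lambda>N. (\<beta> ^ j * y N j) powr p) \<longlonglongrightarrow> (\<beta> ^ j * e j) powr p"
          using p \<beta> by (intro tendsto_powr2[OF ylim tendsto_const]) (auto simp: y_def)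
      qed
      show "\<exists>N0. \<forall>N\<ge>N0. (\<Sum>j<n. (\<beta> ^ j * y N j) powr p) \<le> (1 / (1 - \<kappa>) * M) powr p"
      proof (intro exI[of _ n] allI impI)
        fix N assume N: "n \<le> N"
        have "(\<Sum>j<n. (\<beta> ^ j * y N j) powr p) \<le> (\<Sum>j<Suc N. (\<beta> ^ j * y N j) powr p)"
          using N by (intro sum_mono2) auto
        also have "\<dots> = (\<Sum>i<Suc N. T N i powr p)"
          unfolding T_def by (subst sum.nat_diff_reindex[symmetric]) simp
        also have "\<dots> \<le> (1 / (1 - \<kappa>)) powr p * (\<Sum>i<Suc N. u N i powr p)"
          by (rule Hardy_recursion[OF T0 u0 \<kappa> p base stepT])
        also have "\<dots> \<le> (1 / (1 - \<kappa>)) powr p * M powr p"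
          by (intro mult_left_mono uM) simp
        finally show "(\<Sum>j<n. (\<beta> ^ j * y N j) powr p) \<le> (1 / (1 - \<kappa>) * M) powr p"
          using \<kappa> M by (simp only: powr_mult)
      qed
    qed
    then show ?thesis using False by (simp add: lq_le_def \<kappa>_def p_def)
  qed
qed


text \<open>The interpolation norm of a function \<open>k\<close>, which is the Besov norm when \<open>k\<close> is the
  \<open>K\<close>-functional and \<open>\<theta> = \<alpha> / r\<close>.\<close>

definition interpolation_norm :: "real \<Rightarrow> ennreal \<Rightarrow> (real \<Rightarrow> real) \<Rightarrow> ennreal" where
  "interpolation_norm \<theta> q k =
     (if q = \<infinity> then (SUP t\<in>{0<..}. ennreal (t powr (- \<theta>) * k t))
      else epowr
        (\<integral>\<^sup>+t\<in>{0<..}. ennreal ((t powr (- \<theta>) * k t) powr enn2real q / t) \<partial>lborel)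
        (1 / enn2real q))"

lemma epowr_le_scale:
  assumes p: "1 \<le> p" and c: "0 < c" and le: "x \<le> ennreal (c powr p) * y"
  shows "epowr x (1 / p) \<le> ennreal c * epowr y (1 / p)"
proof (cases "y = \<infinity>")
  case True
  then show ?thesis using c by (simp add: epowr_def ennreal_mult_eq_top_iff)
next
  case False
  then obtain y' where y: "y = ennreal y'" "y' \<ge> 0" by (cases y) auto
  have "epowr x (1 / p) \<le> epowr (ennreal (c powr p * y')) (1 / p)"
    using le y p by (intro epowr_mono) (simp_all add: ennreal_mult)
  also have "\<dots> = ennreal (c * y' powr (1 / p))"
    using y c p by (simp add: epowr_ennreal powr_mult powr_powr)
  also have "\<dots> = ennreal c * epowr y (1 / p)"
    using y c by (simp add: epowr_ennreal ennreal_mult)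
  finally show ?thesis .
qed

lemma dyadic_below:
  fixes d t :: real
  assumes d: "0 < d" "d < 1" and t: "0 < t" "t \<le> 1"
  shows "\<exists>j. d ^ Suc j < t \<and> t \<le> d ^ j"
proof -
  have "\<exists>n. d ^ n < t" using real_arch_pow_inv[OF t(1) d(2)] .
  define n where "n = (LEAST n. d ^ n < t)"
  have n: "d ^ n < t" unfolding n_def by (rule LeastI_ex) fact
  have "n \<noteq> 0" using n t by (intro notI) simp
  then obtain j where j: "n = Suc j" by (cases n) auto
  have "\<not> d ^ j < t" using not_less_Least[of j "\<lambda>n. d ^ n < t"] j by (simp add: n_def)
  then show ?thesis using n j by auto
qed

lemma dyadic_above:
  fixes D t :: real
  assumes D: "1 < D" and t: "1 \<le> t"
  shows "\<exists>j. D ^ j \<le> t \<and> t < D ^ Suc j"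
proof -
  have "\<exists>n. t < D ^ n" using real_arch_pow[OF D] .
  define n where "n = (LEAST n. t < D ^ n)"
  have n: "t < D ^ n" unfolding n_def by (rule LeastI_ex) fact
  have "n \<noteq> 0" using n t by (intro notI) simp
  then obtain j where j: "n = Suc j" by (cases n) auto
  have "\<not> t < D ^ j" using not_less_Least[of j "\<lambda>n. t < D ^ n"] j by (simp add: n_def)
  then show ?thesis using n j by (auto simp: not_less)
qed

lemma nn_integral_step:
  assumes I: "\<And>j. I j \<in> sets borel"
  shows "(\<integral>\<^sup>+t. (\<Sum>j. ennreal (c j) * indicator (I j) t) \<partial>lborel) = (\<Sum>j. ennreal (c j) * emeasure lborel (I j))"
  using I by (simp add: nn_integral_suminf nn_integral_cmult_indicator)

text \<open>The constant of \<open>le_sample\<close>. It is named because it must not depend on the function \<open>k\<close>, which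
  the following locale fixes.\<close>

definition sample_const :: "real \<Rightarrow> real \<Rightarrow> ennreal \<Rightarrow> real" where
  "sample_const D \<beta> q = (if q = \<infinity> then \<beta> else
     (\<beta> powr enn2real q * (D - 1) + (D - 1) / (1 - (1 / \<beta>) powr enn2real q)) powr (1 / enn2real q))"

text \<open>In the application \<open>k\<close> is the \<open>K\<close>-functional of a vector, \<open>D = 2\<^sup>r\<close>, \<open>\<theta> = \<alpha> / r\<close> and \<open>\<beta> = 2\<^sup>\<alpha>\<close>.\<close>

locale interpolation_sample =
  fixes D \<theta> \<beta> :: real and k :: "real \<Rightarrow> real"
  assumes D: "1 < D" and \<theta>: "0 < \<theta>" and \<beta>: "\<beta> = D powr \<theta>"
    and k0: "\<And>t. 0 < t \<Longrightarrow> 0 \<le> k t" and kmono: "\<And>s t. 0 < s \<Longrightarrow> s \<le> t \<Longrightarrow> k s \<le> k t"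
    and k1: "\<And>t. 1 \<le> t \<Longrightarrow> k t \<le> k 1"
begin

abbreviation "d \<equiv> 1 / D"

lemma d: "0 < d" "d < 1" using D by auto

lemma \<beta>1: "1 < \<beta>" using D \<theta> by (simp add: \<beta> gr_one_powr)

lemma powr_d: "(d ^ j) powr (- \<theta>) = \<beta> ^ j"
proof -
  have "(d ^ j) powr (- \<theta>) = (D powr (- real j)) powr (- \<theta>)"
    using D by (simp add: powr_minus powr_realpow power_one_over divide_inverse power_inverse)
  also have "\<dots> = (D powr \<theta>) powr real j" by (simp add: powr_powr mult.commute)
  also have "\<dots> = \<beta> ^ j" using \<beta>1 by (simp add: \<beta>[symmetric] powr_realpow)
  finally show ?thesis .
qed

lemma powr_D: "(D ^ j) powr (- \<theta>) = (1 / \<beta>) ^ j"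
proof -
  have "(D ^ j) powr (- \<theta>) = (D powr real j) powr (- \<theta>)" using D by (simp add: powr_realpow)
  also have "\<dots> = (D powr (- \<theta>)) powr real j" by (simp add: powr_powr mult.commute)
  also have "\<dots> = (1 / \<beta>) ^ j" using \<beta>1 D by (simp add: \<beta> powr_minus powr_realpow power_one_over divide_inverse)
  finally show ?thesis .
qed

definition \<sigma> :: "nat \<Rightarrow> real" where "\<sigma> j = \<beta> ^ j * k (d ^ j)"

lemma d_pow_pos: "0 < d ^ j" using d by simp

lemma \<sigma>_nonneg: "0 \<le> \<sigma> j" unfolding \<sigma>_def using \<beta>1 k0[OF d_pow_pos] by simp

lemma below_bound:
  assumes "d ^ Suc j < t" "t \<le> d ^ j" shows "0 < t" "t powr (- \<theta>) * k t \<le> \<beta> * \<sigma> j"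
proof -
  show t: "0 < t" using assms(1) d_pow_pos[of "Suc j"] by linarith
  have "t powr (- \<theta>) \<le> (d ^ Suc j) powr (- \<theta>)"
    using assms d_pow_pos[of "Suc j"] \<theta> by (intro powr_mono2') auto
  then have "t powr (- \<theta>) * k t \<le> \<beta> ^ Suc j * k (d ^ j)"
    unfolding powr_d using kmono[OF t assms(2)] k0[OF t] \<beta>1 by (intro mult_mono) auto
  then show "t powr (- \<theta>) * k t \<le> \<beta> * \<sigma> j" by (simp add: \<sigma>_def)
qed

lemma above_bound:
  assumes "D ^ j \<le> t" shows "t powr (- \<theta>) * k t \<le> (1 / \<beta>) ^ j * \<sigma> 0"
proof -
  have Dj: "1 \<le> D ^ j" using D by simp
  then have t: "1 \<le> t" using assms by linarith
  have "t powr (- \<theta>) \<le> (D ^ j) powr (- \<theta>)"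
    using assms Dj \<theta> by (intro powr_mono2') auto
  then show ?thesis
    unfolding powr_D using k1[OF t] k0[of t] t \<beta>1 by (simp add: \<sigma>_def mult_mono)
qed

text \<open>On the interval \<open>(d\<^sup>j, d\<^sup>j D]\<close> monotonicity of \<open>k\<close> bounds the integrand below by the sample at \<open>d\<^sup>j\<close>,
  and these intervals are disjoint.\<close>

lemma sample_le: "lq_norm q \<sigma> \<le> ennreal (if q = \<infinity> then 1 else \<beta> * (1 / (1 - d)) powr (1 / enn2real q)) * interpolation_norm \<theta> q k"
  if q: "1 \<le> q"
proof (cases "q = \<infinity>")
  case True
  have "ennreal (\<sigma> j) \<le> (SUP t\<in>{0<..}. ennreal (t powr (- \<theta>) * k t))" for j
    by (rule SUP_upper2[of "d ^ j"]) (use d_pow_pos in \<open>auto simp: powr_d \<sigma>_def\<close>)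
  then show ?thesis using True by (simp add: lq_norm_def interpolation_norm_def SUP_le_iff)
next
  case False
  define p where "p = enn2real q"
  have p: "p \<ge> 1" using enn2real_ge_1[OF q False] by (simp add: p_def)
  define I where "I j = {d ^ j <.. d ^ j * D}" for j
  define c where "c j = (\<sigma> j / \<beta>) powr p / (d ^ j * D)" for j
  define F where "F t = ennreal ((t powr (- \<theta>) * k t) powr p / t) * indicator {0<..} t" for t
  have inI: "ennreal (c j) \<le> F t" if t: "t \<in> I j" for j t
  proof -
    have t0: "0 < t" using t d_pow_pos[of j] by (simp add: I_def)
    have "(d ^ j * D) powr (- \<theta>) \<le> t powr (- \<theta>)"
      using t t0 \<theta> by (intro powr_mono2') (auto simp: I_def)
    moreover have "(d ^ j * D) powr (- \<theta>) = \<beta> ^ j / \<beta>"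
      using D d_pow_pos[of j] powr_D[of 1] by (simp add: powr_mult powr_d)
    moreover have "k (d ^ j) \<le> k t" using t d_pow_pos by (intro kmono) (auto simp: I_def)
    ultimately have "\<beta> ^ j / \<beta> * k (d ^ j) \<le> t powr (- \<theta>) * k t"
      using k0[OF d_pow_pos] \<beta>1 by (intro mult_mono) auto
    then have "\<sigma> j / \<beta> \<le> t powr (- \<theta>) * k t" by (simp add: \<sigma>_def)
    then have "(\<sigma> j / \<beta>) powr p \<le> (t powr (- \<theta>) * k t) powr p"
      using \<sigma>_nonneg[of j] \<beta>1 p by (intro powr_mono2) auto
    then have "c j \<le> (t powr (- \<theta>) * k t) powr p / t"
      unfolding c_def using t t0 by (intro frac_le) (auto simp: I_def)
    then show ?thesis using t0 by (simp add: F_def ennreal_leI)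
  qed
  have disj: "i = j" if "t \<in> I i" "t \<in> I j" for i j t
  proof -
    have less: False if "i < j" "t \<in> I i" "t \<in> I j" for i j
    proof -
      have "d ^ j * D \<le> d ^ Suc i * D" using that(1) d D by (intro mult_right_mono power_decreasing) auto
      also have "\<dots> = d ^ i" using D by simp
      finally show False using that by (auto simp: I_def)
    qed
    then show ?thesis using that by (metis linorder_neqE_nat)
  qed
  have "(\<Sum>j. ennreal (c j) * emeasure lborel (I j)) = (\<integral>\<^sup>+t. (\<Sum>j. ennreal (c j) * indicator (I j) t) \<partial>lborel)"
    by (rule nn_integral_step[symmetric]) (simp add: I_def)
  also have "\<dots> \<le> (\<integral>\<^sup>+t. F t \<partial>lborel)"
  proof (rule nn_integral_mono)
    fix t
    show "(\<Sum>j. ennreal (c j) * indicator (I j) t) \<le> F t"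
    proof (cases "\<exists>j. t \<in> I j")
      case True
      then obtain j where j: "t \<in> I j" by blast
      have "(\<Sum>j. ennreal (c j) * indicator (I j) t) = (\<Sum>i\<in>{j}. ennreal (c i) * indicator (I i) t)"
        by (rule suminf_finite) (use disj[OF j] in \<open>auto simp: indicator_def\<close>)
      then show ?thesis using inI[OF j] j by simp
    next
      case False
      then show ?thesis by simp
    qed
  qed
  finally have int: "(\<Sum>j. ennreal (c j) * emeasure lborel (I j)) \<le> (\<integral>\<^sup>+t. F t \<partial>lborel)" .
  define b where "b = \<beta> * (1 / (1 - d)) powr (1 / p)"
  have bp: "b powr p = \<beta> powr p * (1 / (1 - d))"
    unfolding b_def using \<beta>1 d p by (simp add: powr_mult powr_powr)
  have trm: "ennreal (\<sigma> j powr p) = ennreal (b powr p) * (ennreal (c j) * emeasure lborel (I j))" for j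
  proof -
    have "emeasure lborel (I j) = ennreal (d ^ j * D - d ^ j)"
      unfolding I_def using D d_pow_pos[of j] by (intro emeasure_lborel_Ioc) simp
    moreover have "b powr p * (c j * (d ^ j * D - d ^ j)) = \<sigma> j powr p"
    proof -
      have "c j * (d ^ j * D - d ^ j) = (\<sigma> j / \<beta>) powr p * ((d ^ j * D - d ^ j) / (d ^ j * D))"
        unfolding c_def by (simp only: times_divide_eq_left times_divide_eq_right)
      also have "(d ^ j * D - d ^ j) / (d ^ j * D) = 1 - d" using D d_pow_pos[of j] by (simp add: field_simps)
      finally have "c j * (d ^ j * D - d ^ j) = (\<sigma> j / \<beta>) powr p * (1 - d)" .
      moreover have "\<beta> powr p * (\<sigma> j / \<beta>) powr p = \<sigma> j powr p"
        using \<beta>1 \<sigma>_nonneg[of j] by (simp add: powr_divide)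
      ultimately show ?thesis using d by (simp add: bp)
    qed
    moreover have "0 \<le> c j" "0 \<le> d ^ j * D - d ^ j" using D d_pow_pos[of j] by (auto simp: c_def)
    ultimately show ?thesis by (simp only: ennreal_mult[symmetric] powr_ge_zero mult_nonneg_nonneg)
  qed
  have "(\<Sum>j. ennreal (\<sigma> j powr p)) = ennreal (b powr p) * (\<Sum>j. ennreal (c j) * emeasure lborel (I j))"
    unfolding trm by (simp add: ennreal_suminf_cmult)
  also have "\<dots> \<le> ennreal (b powr p) * (\<integral>\<^sup>+t. F t \<partial>lborel)" by (intro mult_left_mono int) simp
  finally have le: "(\<Sum>j. ennreal (\<sigma> j powr p)) \<le> ennreal (b powr p) * (\<integral>\<^sup>+t. F t \<partial>lborel)" .
  have "0 < b" using \<beta>1 d by (simp add: b_def)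
  from epowr_le_scale[OF p this le] have "lq_norm q \<sigma> \<le> ennreal b * interpolation_norm \<theta> q k"
    using False by (simp add: lq_norm_def interpolation_norm_def p_def F_def)
  then show ?thesis using False by (simp add: b_def p_def)
qed

text \<open>On \<open>(d\<^sup>j\<^sup>+\<^sup>1, d\<^sup>j]\<close> the integrand is controlled by the sample at \<open>d\<^sup>j\<close>. For \<open>t \<ge> 1\<close> the function
  \<open>k\<close> is bounded by its value at \<open>1\<close> and the weight decays geometrically along \<open>[D\<^sup>j, D\<^sup>j\<^sup>+\<^sup>1)\<close>.\<close>

lemma le_sample: "0 < sample_const D \<beta> q \<and> interpolation_norm \<theta> q k \<le> ennreal (sample_const D \<beta> q) * lq_norm q \<sigma>"
  if q: "1 \<le> q"
proof (cases "q = \<infinity>")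
  case True
  have "ennreal (t powr (- \<theta>) * k t) \<le> ennreal \<beta> * (SUP j. ennreal (\<sigma> j))" if t: "0 < t" for t
  proof (cases "t \<le> 1")
    case True
    then obtain j where j: "d ^ Suc j < t" "t \<le> d ^ j" using dyadic_below[OF d t] by blast
    have "ennreal (t powr (- \<theta>) * k t) \<le> ennreal \<beta> * ennreal (\<sigma> j)"
      using below_bound(2)[OF j] \<beta>1 \<sigma>_nonneg[of j] by (simp add: ennreal_mult[symmetric] ennreal_leI)
    also have "\<dots> \<le> ennreal \<beta> * (SUP j. ennreal (\<sigma> j))" by (intro mult_left_mono SUP_upper) auto
    finally show ?thesis .
  next
    case False
    have "t powr (- \<theta>) * k t \<le> \<sigma> 0" using above_bound[of 0 t] False by simp
    also have "\<dots> \<le> \<beta> * \<sigma> 0" using \<beta>1 \<sigma>_nonneg[of 0] by (simp add: mult_le_cancel_right1)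
    finally have "ennreal (t powr (- \<theta>) * k t) \<le> ennreal \<beta> * ennreal (\<sigma> 0)"
      using \<beta>1 \<sigma>_nonneg[of 0] by (simp add: ennreal_mult[symmetric] ennreal_leI)
    also have "\<dots> \<le> ennreal \<beta> * (SUP j. ennreal (\<sigma> j))" by (intro mult_left_mono SUP_upper) auto
    finally show ?thesis .
  qed
  then have "interpolation_norm \<theta> q k \<le> ennreal \<beta> * lq_norm q \<sigma>"
    using True by (simp add: lq_norm_def interpolation_norm_def SUP_le_iff)
  then show ?thesis using \<beta>1 True by (simp add: sample_const_def)
next
  case False
  define p where "p = enn2real q"
  have p: "p \<ge> 1" using enn2real_ge_1[OF q False] by (simp add: p_def)
  define I J where "I j = {d ^ Suc j <.. d ^ j}" and "J j = {D ^ j ..< D ^ Suc j}" for j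
  define a b where "a j = (\<beta> * \<sigma> j) powr p / d ^ Suc j" and "b j = ((1 / \<beta>) ^ j * \<sigma> 0) powr p / D ^ j" for j
  define F where "F t = ennreal ((t powr (- \<theta>) * k t) powr p / t) * indicator {0<..} t" for t
  have one: "f j \<le> (\<Sum>j. f j)" for f :: "nat \<Rightarrow> ennreal" and j
    using sum_le_suminf[of f "{j}"] by simp
  have F: "F t \<le> (\<Sum>j. ennreal (a j) * indicator (I j) t) + (\<Sum>j. ennreal (b j) * indicator (J j) t)" for t
  proof -
    consider "t \<le> 0" | "0 < t" "t \<le> 1" | "1 \<le> t" by linarith
    then show ?thesis
    proof cases
      case 1
      then show ?thesis by (simp add: F_def)
    next
      case 2
      then obtain j where j: "d ^ Suc j < t" "t \<le> d ^ j" using dyadic_below[OF d] by blast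
      have "(t powr (- \<theta>) * k t) powr p / t \<le> a j"
        unfolding a_def using below_bound(2)[OF j] k0[OF 2(1)] p j d_pow_pos[of "Suc j"]
        by (intro frac_le powr_mono2) auto
      then have "F t \<le> ennreal (a j) * indicator (I j) t"
        using 2 j by (simp add: F_def I_def ennreal_leI)
      also have "\<dots> \<le> (\<Sum>j. ennreal (a j) * indicator (I j) t)" by (rule one)
      also have "\<dots> \<le> \<dots> + (\<Sum>j. ennreal (b j) * indicator (J j) t)" by simp
      finally show ?thesis .
    next
      case 3
      then obtain j where j: "D ^ j \<le> t" "t < D ^ Suc j" using dyadic_above[OF D] by blast
      have "(t powr (- \<theta>) * k t) powr p / t \<le> b j"
        unfolding b_def using above_bound[OF j(1)] k0[of t] 3 p j D
        by (intro frac_le powr_mono2) auto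
      then have "F t \<le> ennreal (b j) * indicator (J j) t"
        using 3 j by (simp add: F_def J_def ennreal_leI)
      also have "\<dots> \<le> (\<Sum>j. ennreal (b j) * indicator (J j) t)" by (rule one)
      also have "\<dots> \<le> (\<Sum>j. ennreal (a j) * indicator (I j) t) + \<dots>" by simp
      finally show ?thesis .
    qed
  qed
  define S where "S = (\<Sum>j. ennreal (\<sigma> j powr p))"
  define \<gamma> where "\<gamma> = (1 / \<beta>) powr p"
  have \<gamma>: "0 < \<gamma>" "\<gamma> < 1"
  proof -
    show "0 < \<gamma>" using \<beta>1 by (simp add: \<gamma>_def)
    have "\<gamma> \<le> (1 / \<beta>) powr 1" unfolding \<gamma>_def using \<beta>1 p by (intro powr_mono') auto
    also have "\<dots> < 1" using \<beta>1 by simp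
    finally show "\<gamma> < 1" .
  qed
  have Ipart: "ennreal (a j) * emeasure lborel (I j) = ennreal (\<beta> powr p * (D - 1)) * ennreal (\<sigma> j powr p)" for j
  proof -
    have dd: "d ^ Suc j \<le> d ^ j" using d by (intro power_decreasing) auto
    then have "emeasure lborel (I j) = ennreal (d ^ j - d ^ Suc j)"
      unfolding I_def by (rule emeasure_lborel_Ioc)
    moreover have "a j * (d ^ j - d ^ Suc j) = \<beta> powr p * (D - 1) * \<sigma> j powr p"
    proof -
      have "a j * (d ^ j - d ^ Suc j) = (\<beta> * \<sigma> j) powr p * ((d ^ j - d ^ Suc j) / d ^ Suc j)"
        unfolding a_def by (simp only: times_divide_eq_left times_divide_eq_right)
      also have "(d ^ j - d ^ Suc j) / d ^ Suc j = D - 1" using D by (simp add: field_simps)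
      also have "(\<beta> * \<sigma> j) powr p = \<beta> powr p * \<sigma> j powr p"
        using \<beta>1 \<sigma>_nonneg[of j] by (simp add: powr_mult)
      finally show ?thesis by (simp only: mult.assoc mult.commute[of "D - 1"])
    qed
    moreover have "0 \<le> a j" using d_pow_pos[of "Suc j"] unfolding a_def by (intro divide_nonneg_pos) auto
    ultimately show ?thesis using dd D by (simp add: ennreal_mult[symmetric])
  qed
  have Jpart: "ennreal (b j) * emeasure lborel (J j) = ennreal ((D - 1) * \<sigma> 0 powr p * \<gamma> ^ j)" for j
  proof -
    have DD: "D ^ j \<le> D ^ Suc j" using D by (intro power_increasing) auto
    then have "emeasure lborel (J j) = ennreal (D ^ Suc j - D ^ j)"
      unfolding J_def by (rule emeasure_lborel_Ico)
    moreover have "b j * (D ^ Suc j - D ^ j) = (D - 1) * \<sigma> 0 powr p * \<gamma> ^ j"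
    proof -
      have g: "((1 / \<beta>) ^ j) powr p = \<gamma> ^ j"
        unfolding \<gamma>_def using \<beta>1 by (simp add: powr_realpow[symmetric] powr_powr mult.commute)
      have "b j * (D ^ Suc j - D ^ j) = ((1 / \<beta>) ^ j * \<sigma> 0) powr p * ((D ^ Suc j - D ^ j) / D ^ j)"
        unfolding b_def by (simp only: times_divide_eq_left times_divide_eq_right)
      also have "(D ^ Suc j - D ^ j) / D ^ j = D - 1" using D by (simp add: field_simps)
      also have "((1 / \<beta>) ^ j * \<sigma> 0) powr p = \<gamma> ^ j * \<sigma> 0 powr p"
        unfolding g[symmetric] using \<beta>1 \<sigma>_nonneg[of 0] by (simp add: powr_mult)
      finally have e: "b j * (D ^ Suc j - D ^ j) = \<gamma> ^ j * \<sigma> 0 powr p * (D - 1)" .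
      show ?thesis unfolding e by (simp only: mult_ac)
    qed
    moreover have "0 \<le> b j" using D unfolding b_def by (intro divide_nonneg_pos) auto
    ultimately show ?thesis using DD by (simp add: ennreal_mult[symmetric])
  qed
  define w where "w = \<beta> powr p * (D - 1) + (D - 1) / (1 - \<gamma>)"
  have w: "0 < w" using \<beta>1 D \<gamma> by (simp add: w_def add_pos_pos)
  have "(\<integral>\<^sup>+t. F t \<partial>lborel) \<le> (\<integral>\<^sup>+t. (\<Sum>j. ennreal (a j) * indicator (I j) t) + (\<Sum>j. ennreal (b j) * indicator (J j) t) \<partial>lborel)"
    by (intro nn_integral_mono F)
  also have "\<dots> = (\<integral>\<^sup>+t. (\<Sum>j. ennreal (a j) * indicator (I j) t) \<partial>lborel) + (\<integral>\<^sup>+t. (\<Sum>j. ennreal (b j) * indicator (J j) t) \<partial>lborel)"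
    by (intro nn_integral_add borel_measurable_suminf_order borel_measurable_times borel_measurable_indicator) (auto simp: I_def J_def)
  also have "\<dots> = (\<Sum>j. ennreal (a j) * emeasure lborel (I j)) + (\<Sum>j. ennreal (b j) * emeasure lborel (J j))"
    by (subst (1 2) nn_integral_step) (auto simp: I_def J_def)
  also have "(\<Sum>j. ennreal (a j) * emeasure lborel (I j)) = ennreal (\<beta> powr p * (D - 1)) * S"
    unfolding Ipart S_def by simp
  also have "(\<Sum>j. ennreal (b j) * emeasure lborel (J j)) = ennreal ((D - 1) * \<sigma> 0 powr p * (1 / (1 - \<gamma>)))"
    unfolding Jpart using D \<gamma> by (intro suminf_ennreal_eq sums_mult geometric_sums) auto
  also have "\<dots> = ennreal ((D - 1) / (1 - \<gamma>)) * ennreal (\<sigma> 0 powr p)"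
    using D \<gamma> by (simp add: ennreal_mult[symmetric])
  also have "\<dots> \<le> ennreal ((D - 1) / (1 - \<gamma>)) * S"
    unfolding S_def by (intro mult_left_mono one) simp
  finally have "(\<integral>\<^sup>+t. F t \<partial>lborel) \<le> ennreal (\<beta> powr p * (D - 1)) * S + ennreal ((D - 1) / (1 - \<gamma>)) * S"
    by (simp add: add_left_mono)
  also have "\<dots> = ennreal w * S"
    unfolding w_def using \<beta>1 D \<gamma> by (simp add: distrib_right ennreal_plus)
  also have "w = (w powr (1 / p)) powr p" using w p by (simp add: powr_powr)
  finally have le: "(\<integral>\<^sup>+t. F t \<partial>lborel) \<le> ennreal ((w powr (1 / p)) powr p) * S" .
  have w': "0 < w powr (1 / p)" using w by simp
  from epowr_le_scale[OF p w' le]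
  have "interpolation_norm \<theta> q k \<le> ennreal (w powr (1 / p)) * lq_norm q \<sigma>"
    using False by (simp add: lq_norm_def interpolation_norm_def p_def F_def S_def)
  then show ?thesis using w' False by (simp add: sample_const_def w_def \<gamma>_def p_def)
qed

end

section \<open>Littlewood--Paley decomposition\<close>

context pvm
begin

lemma spec_norm_scale:
  assumes m [measurable]: "\<phi> \<in> borel_measurable borel" and f: "f \<in> D \<phi>"
  shows "f \<in> D (\<lambda>x. c * \<phi> x)" and "norm (spec (\<lambda>x. c * \<phi> x) f) = \<bar>c\<bar> * norm (spec \<phi> f)"
proof -
  show d: "f \<in> D (\<lambda>x. c * \<phi> x)" using f by (simp add: D_iff power_mult_distrib)
  have "(norm (spec (\<lambda>x. c * \<phi> x) f))\<^sup>2 = (\<bar>c\<bar> * norm (spec \<phi> f))\<^sup>2"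
    using d f by (simp add: spec_norm power_mult_distrib)
  then show "norm (spec (\<lambda>x. c * \<phi> x) f) = \<bar>c\<bar> * norm (spec \<phi> f)"
    by (simp add: power2_eq_iff_nonneg)
qed

end

locale littlewood_paley = positive_self_adjoint L
  for L :: "'h::complex_hilbert_space unbounded_op" +
  fixes g :: "real \<Rightarrow> real"
  assumes g: "cutoff_function g"
begin

abbreviation "spec \<equiv> S.spec"
abbreviation "D \<equiv> S.D"

text \<open>By the norm formula and the positivity of \<open>L\<close>, a pointwise inequality on \<open>[0, \<infinity>)\<close> is an inequality
  of norms. Almost all operator estimates below have this form.\<close>

lemma spec_dominated:
  assumes m [measurable]: "\<phi> \<in> borel_measurable borel" "\<psi> \<in> borel_measurable borel" and f: "f \<in> D \<psi>"
    and c: "0 \<le> c" and le: "\<And>x. 0 \<le> x \<Longrightarrow> \<bar>\<phi> x\<bar> \<le> c * \<bar>\<psi> x\<bar>"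
  shows "f \<in> D \<phi>" and "norm (spec \<phi> f) \<le> c * norm (spec \<psi> f)"
proof -
  have ae: "AE x in S.mu f. \<bar>\<phi> x\<bar> \<le> \<bar>c * \<psi> x\<bar>"
    using AE_nonneg[of f] by eventually_elim (use le c in \<open>simp add: abs_mult\<close>)
  have m': "(\<lambda>x. c * \<psi> x) \<in> borel_measurable borel" by measurable
  note sc = S.spec_norm_scale[OF m(2) f, of c]
  show "f \<in> D \<phi>" by (rule S.spec_norm_mono(1)[OF m(1) m' sc(1) ae])
  show "norm (spec \<phi> f) \<le> c * norm (spec \<psi> f)"
    using S.spec_norm_mono(2)[OF m(1) m' sc(1) ae] sc(2) c by simp
qed

lemma g_values:
  shows g_antimono: "\<And>x y. 0 \<le> x \<Longrightarrow> x \<le> y \<Longrightarrow> g y \<le> g x" and g_zero: "\<And>x. 2 < x \<Longrightarrow> g x = 0"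
    and g_one: "\<And>x. 0 \<le> x \<Longrightarrow> x \<le> 1 \<Longrightarrow> g x = 1" and g_nonneg: "\<And>x. 0 \<le> x \<Longrightarrow> 0 \<le> g x"
    and g_le_1: "\<And>x. 0 \<le> x \<Longrightarrow> g x \<le> 1"
  using g by (auto simp: cutoff_function_def monotone_on_def)

text \<open>\<open>G j\<close> and \<open>F j\<close> are the low-pass filter \<open>g (2\<^sup>-\<^sup>j \<surd>x)\<close> and the window \<open>F\<^sub>j (\<surd>x)\<close>, as functions of
  the spectral parameter of \<open>L\<close>.\<close>

definition G :: "nat \<Rightarrow> real \<Rightarrow> real" where
  "G j x = (if 0 \<le> x then g (sqrt x / 2 ^ j) else 0)"

definition F :: "nat \<Rightarrow> real \<Rightarrow> real" where
  "F j x = (if 0 \<le> x then dyadic_window g j (sqrt x) else 0)"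

lemma G_measurable [measurable]: "G j \<in> borel_measurable borel"
proof -
  have "mono (\<lambda>y. - g (max 0 y))" by (rule monoI) (simp add: g_antimono)
  then have "(\<lambda>y. - g (max 0 y)) \<in> borel_measurable borel" by (rule borel_measurable_mono)
  then have [measurable]: "(\<lambda>y. g (max 0 y)) \<in> borel_measurable borel" by simp
  have "G j = (\<lambda>x. if 0 \<le> x then g (max 0 (sqrt x / 2 ^ j)) else 0)" by (auto simp: G_def max_def)
  then show ?thesis by simp
qed

lemma G_bounds: "0 \<le> G j x" "G j x \<le> 1"
  by (simp_all add: G_def g_nonneg g_le_1)

lemma G_mono: "G j x \<le> G (Suc j) x"
  by (auto simp: G_def intro!: g_antimono divide_left_mono)

lemma F_0: "F 0 x = sqrt (G 0 x)"
  by (simp add: F_def G_def dyadic_window_def)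

lemma F_Suc: "F (Suc j) x = sqrt (G (Suc j) x - G j x)"
proof (cases "0 \<le> x")
  case True
  define y where "y = 2 powr (- real (Suc j)) * sqrt x"
  have "2 powr (- real (Suc j)) = 1 / (2::real) ^ Suc j"
    by (metis powr_minus_divide powr_realpow zero_less_numeral)
  then have y: "y = sqrt x / 2 ^ Suc j" by (simp only: y_def) simp
  have "F (Suc j) x = sqrt (g y - g (2 * y))"
    using True unfolding F_def dyadic_window_def Let_def y_def by (simp only: if_True nat.distinct if_False)
  moreover have "G (Suc j) x = g y" using True unfolding y by (simp only: G_def if_True)
  moreover have "2 * y = sqrt x / 2 ^ j" by (simp add: y)
  then have "G j x = g (2 * y)" using True by (simp only: G_def if_True)
  ultimately show ?thesis by (simp only:)
qed (simp add: F_def G_def)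

lemma F_measurable [measurable]: "F j \<in> borel_measurable borel"
proof (cases j)
  case 0
  then have "F j = (\<lambda>x. sqrt (G 0 x))" using F_0 by auto
  then show ?thesis by simp
next
  case (Suc i)
  then have "F j = (\<lambda>x. sqrt (G (Suc i) x - G i x))" using F_Suc by auto
  then show ?thesis by simp
qed

lemma F_square: "(F 0 x)\<^sup>2 = G 0 x" "(F (Suc j) x)\<^sup>2 = G (Suc j) x - G j x"
  using G_bounds[of 0 x] G_mono[of j x] by (simp_all add: F_0 F_Suc)

lemma F_bounds: "0 \<le> F j x" "F j x \<le> 1"
proof -
  have "0 \<le> F j x \<and> F j x \<le> 1"
  proof (cases j)
    case 0
    then show ?thesis using G_bounds[of 0 x] by (simp add: F_0)
  next
    case (Suc i)
    then show ?thesis using G_bounds[of i x] G_bounds[of "Suc i" x] G_mono[of i x] by (simp add: F_Suc)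
  qed
  then show "0 \<le> F j x" "F j x \<le> 1" by auto
qed

lemma F_square_le: "(F j x)\<^sup>2 \<le> F j x"
  using F_bounds[of j x] by (simp add: power2_eq_square mult_left_le_one_le)

lemma F_support:
  assumes x: "0 \<le> x" "F j x \<noteq> 0" shows "sqrt x \<le> 2 * 2 ^ j"
proof (rule ccontr)
  assume "\<not> sqrt x \<le> 2 * 2 ^ j"
  then have s: "2 * 2 ^ j < sqrt x" by simp
  then have Gj: "G j x = 0" using x by (simp add: G_def g_zero field_simps)
  have "F j x = 0"
  proof (cases j)
    case 0
    then show ?thesis using Gj by (simp add: F_0)
  next
    case (Suc i)
    then show ?thesis using Gj G_bounds(1)[of i x] G_mono[of i x] by (simp add: F_Suc)
  qed
  then show False using x by simp
qed

lemma F_support_below: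
  assumes x: "0 \<le> x" "F (Suc j) x \<noteq> 0" shows "2 ^ j < sqrt x"
proof (rule ccontr)
  assume "\<not> 2 ^ j < sqrt x"
  then have s: "sqrt x \<le> 2 ^ j" by simp
  then have "sqrt x \<le> 2 ^ Suc j" by (rule order_trans) simp
  then have "G j x = 1" "G (Suc j) x = 1" using s x unfolding G_def by (auto intro!: g_one simp: divide_le_eq)
  then show False using x by (simp add: F_Suc)
qed

lemma D_F: "f \<in> D (F j)" by (rule S.D_bounded[of _ 1]) (use F_bounds in auto)
lemma D_G: "f \<in> D (G j)" by (rule S.D_bounded[of _ 1]) (use G_bounds in auto)
lemma D_F2: "f \<in> D (\<lambda>x. (F j x)\<^sup>2)"
  by (rule S.D_bounded[of _ 1]) (use F_bounds in \<open>auto simp: power_le_one\<close>)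

lemma fun_sqrt_window: "fun_sqrt_op L (dyadic_window g j) f = spec (F j) f"
proof -
  have "(\<lambda>x. if 0 \<le> x then dyadic_window g j (sqrt x) else 0) = F j" by (auto simp: F_def)
  then show ?thesis unfolding fun_sqrt_op_def by (simp only: S.app_spectral_integral[OF F_measurable D_F])
qed

subsection \<open>The \<open>K\<close>-functional\<close>

definition weight :: "nat \<Rightarrow> real \<Rightarrow> real" where "weight r x = (1 + x) powr (real r / 2)"

lemma weight_measurable [measurable]: "weight r \<in> borel_measurable borel"
  unfolding weight_def by measurable

lemma dom_sobolev: "dom_op (op_I_plus_powr L (real r / 2)) = D (weight r)"
  by (simp add: op_I_plus_powr_def S.dom_spectral_integral weight_def[abs_def])

lemma sobolev_norm_spec: "f \<in> D (weight r) \<Longrightarrow> sobolev_norm L r f = norm f + norm (spec (weight r) f)"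
  using S.app_spectral_integral[OF weight_measurable, of f r]
  by (simp add: sobolev_norm_def op_I_plus_powr_def weight_def[abs_def])

lemma K_functional_spec:
  "K_functional L r t f = Inf {norm f0 + t * (norm f1 + norm (spec (weight r) f1)) | f0 f1. f1 \<in> D (weight r) \<and> f = f0 + f1}"
proof -
  have "{norm f0 + t * sobolev_norm L r f1 | f0 f1. f1 \<in> dom_op (op_I_plus_powr L (real r / 2)) \<and> f = f0 + f1}
      = {norm f0 + t * (norm f1 + norm (spec (weight r) f1)) | f0 f1. f1 \<in> D (weight r) \<and> f = f0 + f1}"
    unfolding dom_sobolev by (metis (no_types, opaque_lifting) sobolev_norm_spec)
  then show ?thesis by (simp add: K_functional_def)
qed

lemma K_le:
  assumes "0 \<le> t" "f1 \<in> D (weight r)" "f = f0 + f1"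
  shows "K_functional L r t f \<le> norm f0 + t * (norm f1 + norm (spec (weight r) f1))"
  unfolding K_functional_spec
proof (rule cInf_lower)
  show "bdd_below {norm f0 + t * (norm f1 + norm (spec (weight r) f1)) | f0 f1. f1 \<in> D (weight r) \<and> f = f0 + f1}"
    by (rule bdd_belowI[of _ 0]) (use assms(1) in auto)
qed (use assms in blast)

lemma D_weight_0: "0 \<in> D (weight r)" and spec_weight_0: "spec (weight r) 0 = 0"
proof -
  show z: "0 \<in> D (weight r)" using S.D_csubspace[OF weight_measurable] by (simp add: csubspace_def)
  show "spec (weight r) 0 = 0" using S.spec_scaleC[OF weight_measurable z, of 0] by (simp add: scaleC_zero_left)
qed

lemma K_ge:
  assumes "\<And>f0 f1. f1 \<in> D (weight r) \<Longrightarrow> f = f0 + f1 \<Longrightarrow> b \<le> norm f0 + t * (norm f1 + norm (spec (weight r) f1))"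
  shows "b \<le> K_functional L r t f"
  unfolding K_functional_spec
proof (rule cInf_greatest)
  have "norm f + t * (norm (0::'h) + norm (spec (weight r) 0)) \<in> {norm f0 + t * (norm f1 + norm (spec (weight r) f1)) | f0 f1. f1 \<in> D (weight r) \<and> f = f0 + f1}"
    using D_weight_0 by fastforce
  then show "{norm f0 + t * (norm f1 + norm (spec (weight r) f1)) | f0 f1. f1 \<in> D (weight r) \<and> f = f0 + f1} \<noteq> {}" by blast
qed (use assms in blast)

lemma K_nonneg: "0 \<le> t \<Longrightarrow> 0 \<le> K_functional L r t f"
  by (rule K_ge) simp

lemma K_mono:
  assumes "0 \<le> s" "s \<le> t" shows "K_functional L r s f \<le> K_functional L r t f"
proof (rule K_ge)
  fix f0 f1 assume f: "f1 \<in> D (weight r)" "f = f0 + f1"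
  have "K_functional L r s f \<le> norm f0 + s * (norm f1 + norm (spec (weight r) f1))" by (rule K_le[OF assms(1) f])
  also have "\<dots> \<le> norm f0 + t * (norm f1 + norm (spec (weight r) f1))"
    using assms by (intro add_left_mono mult_right_mono) auto
  finally show "K_functional L r s f \<le> norm f0 + t * (norm f1 + norm (spec (weight r) f1))" .
qed

lemma K_le_K_1:
  assumes "1 \<le> t" shows "K_functional L r t f \<le> K_functional L r 1 f"
proof -
  have "K_functional L r t f \<le> norm f"
    using K_le[of t 0 r f f] assms by (simp add: D_weight_0 spec_weight_0)
  also have "\<dots> \<le> K_functional L r 1 f"
  proof (rule K_ge)
    fix f0 f1 assume "f = f0 + f1"
    then have "norm f \<le> norm f0 + norm f1" by (simp add: norm_triangle_ineq)
    then show "norm f \<le> norm f0 + 1 * (norm f1 + norm (spec (weight r) f1))"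
      using norm_ge_zero[of "spec (weight r) f1"] by argo
  qed
  finally show ?thesis .
qed

lemma weight_ge_1: "0 \<le> x \<Longrightarrow> 1 \<le> weight r x"
  by (simp add: weight_def ge_one_powr_ge_zero)

lemma powr_half_square:
  fixes y :: real
  assumes "0 < y" shows "(y\<^sup>2) powr (real r / 2) = y ^ r"
proof -
  have "(y\<^sup>2) powr (real r / 2) = (y powr 2) powr (real r / 2)" using assms by (simp add: powr_numeral)
  also have "\<dots> = y powr real r" unfolding powr_powr by simp
  also have "\<dots> = y ^ r" using assms by (rule powr_realpow)
  finally show ?thesis .
qed

lemma weight_le:
  assumes x: "0 \<le> x" "sqrt x \<le> 2 * 2 ^ j" shows "weight r x \<le> 5 powr (real r / 2) * (2 ^ r) ^ j"
proof -
  have "x = (sqrt x)\<^sup>2" using x by simp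
  also have "\<dots> \<le> (2 * 2 ^ j)\<^sup>2" using x by (intro power_mono) auto
  finally have "x \<le> 4 * (2 ^ j)\<^sup>2" by (simp add: power_mult_distrib)
  moreover have "(1::real) \<le> (2 ^ j)\<^sup>2" by simp
  ultimately have "1 + x \<le> 5 * (2 ^ j)\<^sup>2" by argo
  then have "weight r x \<le> (5 * (2 ^ j)\<^sup>2) powr (real r / 2)" unfolding weight_def using x by (intro powr_mono2) auto
  also have "\<dots> = 5 powr (real r / 2) * (2 ^ j) ^ r"
    using powr_half_square[of "2 ^ j" r] by (simp add: powr_mult)
  also have "(2 ^ j) ^ r = ((2::real) ^ r) ^ j" by (simp add: power_mult[symmetric] mult.commute)
  finally show ?thesis .
qed

lemma weight_ge_on_window:
  assumes x: "0 \<le> x" "F j x \<noteq> 0" shows "1 \<le> 2 ^ r * (1 / 2 ^ r) ^ j * weight r x"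
proof (cases j)
  case 0
  have "1 * 1 \<le> 2 ^ r * weight r x" using weight_ge_1[OF x(1), of r] by (intro mult_mono) auto
  then show ?thesis using 0 by simp
next
  case (Suc i)
  have s: "2 ^ i < sqrt x" using F_support_below[OF x(1)] x(2) Suc by simp
  have "(2 ^ i)\<^sup>2 \<le> (sqrt x)\<^sup>2" using s by (intro power_mono) auto
  then have "(2 ^ i)\<^sup>2 \<le> 1 + x" using x by simp
  then have "((2 ^ i)\<^sup>2) powr (real r / 2) \<le> weight r x" unfolding weight_def by (intro powr_mono2) auto
  then have "(2 ^ r) ^ i \<le> weight r x"
    using powr_half_square[of "2 ^ i" r] by (simp add: power_mult[symmetric] mult.commute)
  then have "(1 / 2 ^ r) ^ i * (2 ^ r) ^ i \<le> (1 / 2 ^ r) ^ i * weight r x" by (intro mult_left_mono) auto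
  moreover have "(1 / 2 ^ r) ^ i * ((2::real) ^ r) ^ i = 1" by (simp add: power_mult_distrib[symmetric])
  moreover have "2 ^ r * (1 / 2 ^ r) ^ j * weight r x = (1 / 2 ^ r) ^ i * weight r x" using Suc by simp
  ultimately show ?thesis by argo
qed

text \<open>On the support of \<open>F j\<close> the Sobolev weight is at least a multiple of \<open>2\<^bsup>jr\<^esup>\<close>, so the window of the smooth
  part \<open>f1\<close> of any splitting of \<open>f\<close> is at most a multiple of \<open>2\<^bsup>-jr\<^esup>\<close> times its Sobolev norm.\<close>

lemma window_le_K: "norm (spec (F j) f) \<le> 2 ^ r * K_functional L r ((1 / 2 ^ r) ^ j) f"
proof -
  have "norm (spec (F j) f) / 2 ^ r \<le> K_functional L r ((1 / 2 ^ r) ^ j) f"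
  proof (rule K_ge)
    fix f0 f1 assume f: "f1 \<in> D (weight r)" "f = f0 + f1"
    have "norm (spec (F j) f) \<le> norm (spec (F j) f0) + norm (spec (F j) f1)"
      using S.spec_add[OF F_measurable D_F D_F, of j f0 f1] by (simp add: f(2) norm_triangle_ineq)
    also have "norm (spec (F j) f0) \<le> 1 * norm (spec (\<lambda>_. 1) f0)"
      by (rule spec_dominated(2)) (use F_bounds in \<open>auto simp: S.D_one\<close>)
    also have "1 * norm (spec (\<lambda>_. 1) f0) \<le> 2 ^ r * norm f0"
      by (simp add: S.spec_one mult_le_cancel_right1)
    also have "norm (spec (F j) f1) \<le> 2 ^ r * (1 / 2 ^ r) ^ j * norm (spec (weight r) f1)"
    proof (rule spec_dominated(2)[OF F_measurable weight_measurable f(1)])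
      fix x :: real assume x: "0 \<le> x"
      show "\<bar>F j x\<bar> \<le> 2 ^ r * (1 / 2 ^ r) ^ j * \<bar>weight r x\<bar>"
      proof (cases "F j x = 0")
        case False
        have "\<bar>F j x\<bar> \<le> 1" using F_bounds[of j x] by simp
        also have "\<dots> \<le> 2 ^ r * (1 / 2 ^ r) ^ j * weight r x" by (rule weight_ge_on_window[OF x False])
        finally show ?thesis using weight_ge_1[OF x, of r] by simp
      qed simp
    qed simp
    also have "2 ^ r * (1 / 2 ^ r) ^ j * norm (spec (weight r) f1) \<le> 2 ^ r * (1 / 2 ^ r) ^ j * (norm f1 + norm (spec (weight r) f1))"
      by (intro mult_left_mono) auto
    finally have "norm (spec (F j) f) \<le> 2 ^ r * (norm f0 + (1 / 2 ^ r) ^ j * (norm f1 + norm (spec (weight r) f1)))"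
      by (simp add: distrib_left mult.assoc add_left_mono add_right_mono)
    then show "norm (spec (F j) f) / 2 ^ r \<le> norm f0 + (1 / 2 ^ r) ^ j * (norm f1 + norm (spec (weight r) f1))"
      by (simp add: divide_le_eq mult.commute)
  qed
  then show ?thesis by (simp add: divide_le_eq mult.commute)
qed

text \<open>For the converse, \<open>f\<close> is split into its part below frequency \<open>2\<^sup>j\<close>, measured in the Sobolev norm and
  scaled by \<open>2\<^bsup>-jr\<^esup>\<close>, and the rest. Since \<open>G (j + 1) - G j\<close> is the square of \<open>F (j + 1)\<close>, consecutive
  values are related up to a multiple of \<open>\<parallel>F\<^sub>j\<^sub>+\<^sub>1(\<surd>L) f\<parallel>\<close> (\<open>tail_Suc\<close>, \<open>low_Suc\<close>).\<close>

definition tail :: "'h \<Rightarrow> nat \<Rightarrow> real" where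
  "tail f j = norm (f - spec (G j) f)"

definition low :: "nat \<Rightarrow> 'h \<Rightarrow> nat \<Rightarrow> real" where
  "low r f j = (1 / 2 ^ r) ^ j * norm (spec (\<lambda>x. weight r x * G j x) f)"

lemma D_weight_window: "f \<in> D (\<lambda>x. weight r x * (F j x)\<^sup>2)"
  and weight_window_norm: "norm (spec (\<lambda>x. weight r x * (F j x)\<^sup>2) f) \<le> 5 powr (real r / 2) * (2 ^ r) ^ j * norm (spec (F j) f)"
proof -
  have le: "\<bar>weight r x * (F j x)\<^sup>2\<bar> \<le> 5 powr (real r / 2) * (2 ^ r) ^ j * \<bar>F j x\<bar>" if x: "0 \<le> x" for x
  proof (cases "F j x = 0")
    case False
    have "weight r x * (F j x)\<^sup>2 \<le> 5 powr (real r / 2) * (2 ^ r) ^ j * F j x"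
      using weight_le[OF x F_support[OF x False], of r] F_square_le[of j x] weight_ge_1[OF x, of r]
      by (intro mult_mono) auto
    then show ?thesis using F_bounds[of j x] weight_ge_1[OF x, of r] by simp
  qed simp
  have m: "(\<lambda>x. weight r x * (F j x)\<^sup>2) \<in> borel_measurable borel" by measurable
  have c: "0 \<le> 5 powr (real r / 2) * (2 ^ r) ^ j" by simp
  show "f \<in> D (\<lambda>x. weight r x * (F j x)\<^sup>2)" by (rule spec_dominated(1)[OF m F_measurable D_F c le])
  show "norm (spec (\<lambda>x. weight r x * (F j x)\<^sup>2) f) \<le> 5 powr (real r / 2) * (2 ^ r) ^ j * norm (spec (F j) f)"
    by (rule spec_dominated(2)[OF m F_measurable D_F c le])
qed

lemma weight_G_Suc: "(\<lambda>x. weight r x * G (Suc j) x) = (\<lambda>x. weight r x * G j x + weight r x * (F (Suc j) x)\<^sup>2)"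
  by (rule ext) (simp only: F_square distrib_left[symmetric], simp)

lemma D_weight_G: "f \<in> D (\<lambda>x. weight r x * G j x)"
proof (rule spec_dominated(1)[where \<psi> = "\<lambda>_. 1" and c = "5 powr (real r / 2) * (2 ^ r) ^ j"])
  fix x :: real assume x: "0 \<le> x"
  show "\<bar>weight r x * G j x\<bar> \<le> 5 powr (real r / 2) * (2 ^ r) ^ j * \<bar>1\<bar>"
  proof (cases "G j x = 0")
    case False
    have "\<not> 2 * 2 ^ j < sqrt x"
    proof
      assume "2 * 2 ^ j < sqrt x"
      then have "2 < sqrt x / 2 ^ j" by (simp add: field_simps)
      then show False using False x by (simp add: G_def g_zero)
    qed
    then have "weight r x \<le> 5 powr (real r / 2) * (2 ^ r) ^ j" by (intro weight_le x) simp
    moreover have "weight r x * G j x \<le> weight r x * 1"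
      using weight_ge_1[OF x, of r] G_bounds[of j x] by (intro mult_left_mono) auto
    moreover have "0 \<le> weight r x * G j x" using weight_ge_1[OF x, of r] G_bounds[of j x] by simp
    ultimately show ?thesis by simp
  qed simp
qed (simp_all add: S.D_one)

lemma low_0: "low r f 0 \<le> 5 powr (real r / 2) * norm (spec (F 0) f)"
proof -
  have "low r f 0 = norm (spec (\<lambda>x. weight r x * (F 0 x)\<^sup>2) f)"
    by (simp only: low_def F_square(1) power_0 mult_1)
  also have "\<dots> \<le> 5 powr (real r / 2) * (2 ^ r) ^ 0 * norm (spec (F 0) f)" by (rule weight_window_norm)
  finally show ?thesis by (simp only: power_0 mult_1_right)
qed

lemma low_Suc: "low r f (Suc j) \<le> 1 / 2 ^ r * low r f j + 5 powr (real r / 2) * norm (spec (F (Suc j)) f)"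
proof -
  define N where "N = norm (spec (\<lambda>x. weight r x * G j x) f)"
  define A where "A = norm (spec (F (Suc j)) f)"
  define C where "C = 5 powr (real r / 2)"
  define p where "p = ((2::real) ^ r) ^ Suc j"
  have mG: "(\<lambda>x. weight r x * G j x) \<in> borel_measurable borel" by measurable
  have mF: "(\<lambda>x. weight r x * (F (Suc j) x)\<^sup>2) \<in> borel_measurable borel" by measurable
  have d: "f \<in> D (\<lambda>x. weight r x * G j x + weight r x * (F (Suc j) x)\<^sup>2)"
    using D_weight_G[of f r "Suc j"] unfolding weight_G_Suc .
  have "norm (spec (\<lambda>x. weight r x * G (Suc j) x) f) \<le> N + norm (spec (\<lambda>x. weight r x * (F (Suc j) x)\<^sup>2) f)"
    unfolding weight_G_Suc S.spec_fun_add[OF mG mF D_weight_G D_weight_window d] N_def by (rule norm_triangle_ineq)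
  also have "\<dots> \<le> N + C * p * A"
    unfolding C_def p_def A_def by (rule add_left_mono[OF weight_window_norm])
  finally have "low r f (Suc j) \<le> (1 / 2 ^ r) ^ Suc j * (N + C * p * A)"
    unfolding low_def by (rule mult_left_mono) simp
  also have "\<dots> = 1 / 2 ^ r * ((1 / 2 ^ r) ^ j * N) + ((1 / 2 ^ r) ^ Suc j * p) * (C * A)"
    unfolding power_Suc by (simp only: distrib_left mult.assoc mult.left_commute)
  also have "(1 / 2 ^ r) ^ Suc j * p = 1" unfolding p_def power_mult_distrib[symmetric] by simp
  finally show ?thesis by (simp only: low_def N_def A_def C_def mult_1)
qed

lemma tail_Suc: "tail f j \<le> tail f (Suc j) + norm (spec (F (Suc j)) f)"
proof -
  have eq: "G (Suc j) = (\<lambda>x. G j x + (F (Suc j) x)\<^sup>2)" by (auto simp: F_square)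
  have "spec (G (Suc j)) f = spec (G j) f + spec (\<lambda>x. (F (Suc j) x)\<^sup>2) f"
    by (subst eq, rule S.spec_fun_add) (use D_G[of f "Suc j"] in \<open>simp_all add: D_G D_F2 eq\<close>)
  then have "f - spec (G j) f = (f - spec (G (Suc j)) f) + spec (\<lambda>x. (F (Suc j) x)\<^sup>2) f" by simp
  then have "tail f j \<le> tail f (Suc j) + norm (spec (\<lambda>x. (F (Suc j) x)\<^sup>2) f)"
    unfolding tail_def by (metis norm_triangle_ineq)
  also have "norm (spec (\<lambda>x. (F (Suc j) x)\<^sup>2) f) \<le> 1 * norm (spec (F (Suc j)) f)"
    by (rule spec_dominated(2)) (use F_bounds F_square_le in \<open>auto simp: D_F\<close>)
  finally show ?thesis by simp
qed

lemma tail_lim: "tail f \<longlonglongrightarrow> 0"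
proof -
  have D1: "f \<in> D (\<lambda>x. 1 - G j x)" for j by (rule S.D_bounded[of _ 1]) (use G_bounds in \<open>auto simp: abs_le_iff\<close>)
  have "f - spec (G j) f = spec (\<lambda>x. 1 - G j x) f" for j
  proof -
    have m: "(\<lambda>x. 1 - G j x) \<in> borel_measurable borel" by measurable
    have "f \<in> D (\<lambda>x. G j x + (1 - G j x))" using S.D_one by simp
    from S.spec_fun_add[OF G_measurable m D_G D1 this]
    have "spec (\<lambda>_. 1) f = spec (G j) f + spec (\<lambda>x. 1 - G j x) f" by simp
    then show ?thesis by (simp add: S.spec_one algebra_simps)
  qed
  then have sq: "(tail f j)\<^sup>2 = (\<integral>x. (1 - G j x)\<^sup>2 \<partial>S.mu f)" for j
    unfolding tail_def using D1 by (simp add: S.spec_norm)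
  have "(\<lambda>j. \<integral>x. (1 - G j x)\<^sup>2 \<partial>S.mu f) \<longlonglongrightarrow> (\<integral>x. 0 \<partial>S.mu f)"
  proof (rule integral_dominated_convergence[where w = "\<lambda>_. 1"])
    show "AE x in S.mu f. (\<lambda>j. (1 - G j x)\<^sup>2) \<longlonglongrightarrow> 0"
      using AE_nonneg[of f]
    proof eventually_elim
      case (elim x)
      obtain n where n: "sqrt x < 2 ^ n" using real_arch_pow[of 2 "sqrt x"] by auto
      have "(1 - G j x)\<^sup>2 = 0" if "n \<le> j" for j
      proof -
        have "(2::real) ^ n \<le> 2 ^ j" using that by (intro power_increasing) auto
        then have "sqrt x \<le> 2 ^ j" using n by linarith
        then show ?thesis using elim by (simp add: G_def g_one divide_le_eq)
      qed
      then show ?case by (intro tendsto_eventually) (auto simp: eventually_sequentially)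
    qed
    show "AE x in S.mu f. norm ((1 - G j x)\<^sup>2) \<le> 1" for j
      by (rule AE_I2) (use G_bounds in \<open>auto simp: abs_square_le_1 abs_le_iff\<close>)
    show "integrable (S.mu f) (\<lambda>_. 1::real)" by (rule S.integrable_mu_bounded[of _ 1]) auto
  qed auto
  then have "(\<lambda>j. sqrt ((tail f j)\<^sup>2)) \<longlonglongrightarrow> sqrt 0" unfolding sq by (intro tendsto_real_sqrt) simp
  moreover have "(\<lambda>j. sqrt ((tail f j)\<^sup>2)) = tail f" by (rule ext) (simp add: tail_def)
  ultimately show ?thesis by (simp only: real_sqrt_zero)
qed

lemma K_le_tail_low: "K_functional L r ((1 / 2 ^ r) ^ j) f \<le> tail f j + 2 * low r f j"
proof -
  define f1 where "f1 = spec (G j) f"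
  have d: "f1 \<in> D (weight r)" unfolding f1_def
    using S.spec_D_iff[OF G_measurable weight_measurable D_G] D_weight_G by blast
  have s: "spec (weight r) f1 = spec (\<lambda>x. weight r x * G j x) f" unfolding f1_def
    by (rule S.spec_spec[OF G_measurable weight_measurable D_G D_weight_G])
  have "norm f1 \<le> 1 * norm (spec (\<lambda>x. weight r x * G j x) f)"
    unfolding f1_def
  proof (rule spec_dominated(2)[OF G_measurable _ D_weight_G])
    fix x :: real assume x: "0 \<le> x"
    have "1 * G j x \<le> weight r x * G j x" using weight_ge_1[OF x] G_bounds by (intro mult_right_mono) auto
    then show "\<bar>G j x\<bar> \<le> 1 * \<bar>weight r x * G j x\<bar>" using G_bounds[of j x] by simp
  qed auto
  then have "norm f1 \<le> norm (spec (\<lambda>x. weight r x * G j x) f)" by simp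
  then have le: "(1 / 2 ^ r) ^ j * norm f1 \<le> low r f j" unfolding low_def by (rule mult_left_mono) simp
  have "K_functional L r ((1 / 2 ^ r) ^ j) f \<le> norm (f - f1) + (1 / 2 ^ r) ^ j * (norm f1 + norm (spec (weight r) f1))"
    by (rule K_le) (use d in auto)
  also have "\<dots> = tail f j + ((1 / 2 ^ r) ^ j * norm f1 + low r f j)"
    by (simp only: tail_def f1_def[symmetric] low_def s distrib_left)
  also have "\<dots> \<le> tail f j + 2 * low r f j" using le by argo
  finally show ?thesis .
qed

end

section \<open>Equivalence of the norms\<close>

context littlewood_paley
begin

definition window_norm :: "real \<Rightarrow> 'h \<Rightarrow> nat \<Rightarrow> real" where
  "window_norm \<alpha> f j = (2 powr \<alpha>) ^ j * norm (spec (F j) f)"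

lemma window_norm_nonneg: "0 \<le> window_norm \<alpha> f j"
  by (simp add: window_norm_def)

lemma besov_norm_interpolation:
  "besov_norm L r \<alpha> q f = interpolation_norm (\<alpha> / real r) q (\<lambda>t. K_functional L r t f)"
  by (simp only: besov_norm_def interpolation_norm_def Let_def)

lemma K_sample:
  assumes \<alpha>: "0 < \<alpha>" and r: "0 < r"
  shows "interpolation_sample (2 ^ r) (\<alpha> / real r) (2 powr \<alpha>) (\<lambda>t. K_functional L r t f)"
proof
  show "1 < (2::real) ^ r" using r by simp
  show "0 < \<alpha> / real r" using \<alpha> r by simp
  show "2 powr \<alpha> = (2 ^ r) powr (\<alpha> / real r)"
    using r by (simp add: powr_realpow[symmetric] powr_powr)
  show "0 \<le> K_functional L r t f" if "0 < t" for t using that by (simp add: K_nonneg)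
  show "K_functional L r s f \<le> K_functional L r t f" if "0 < s" "s \<le> t" for s t
    using that by (intro K_mono) auto
  show "K_functional L r t f \<le> K_functional L r 1 f" if "1 \<le> t" for t
    using that by (rule K_le_K_1)
qed

definition K_samples :: "nat \<Rightarrow> real \<Rightarrow> 'h \<Rightarrow> nat \<Rightarrow> real" where
  "K_samples r \<alpha> f j = (2 powr \<alpha>) ^ j * K_functional L r ((1 / 2 ^ r) ^ j) f"

lemma K_samples_nonneg: "0 \<le> K_samples r \<alpha> f j"
  by (simp add: K_samples_def K_nonneg)

lemma K_samples_eq:
  assumes "0 < \<alpha>" "0 < r"
  shows "interpolation_sample.\<sigma> (2 ^ r) (2 powr \<alpha>) (\<lambda>t. K_functional L r t f) = K_samples r \<alpha> f"
  using interpolation_sample.\<sigma>_def[OF K_sample[OF assms]] by (intro ext) (simp add: K_samples_def)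

lemma window_le_besov:
  assumes q: "1 \<le> q" and \<alpha>: "0 < \<alpha>" and r: "0 < r"
  shows "\<exists>c>0. \<forall>f. lq_norm q (window_norm \<alpha> f) \<le> ennreal c * besov_norm L r \<alpha> q f"
proof -
  define c where "c = (if q = \<infinity> then 1 else 2 powr \<alpha> * (1 / (1 - 1 / 2 ^ r)) powr (1 / enn2real q))"
  have "(1::real) < 2 ^ r" using r by simp
  then have c: "0 < c" by (simp add: c_def)
  have "lq_norm q (window_norm \<alpha> f) \<le> ennreal (2 ^ r * c) * besov_norm L r \<alpha> q f" for f
  proof -
    have "lq_norm q (window_norm \<alpha> f) \<le> ennreal (2 ^ r) * lq_norm q (K_samples r \<alpha> f)"
    proof (rule lq_norm_transfer[OF q K_samples_nonneg window_norm_nonneg])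
      fix M :: real assume M: "0 \<le> M" and le: "lq_le q (K_samples r \<alpha> f) M"
      have "window_norm \<alpha> f j \<le> 2 ^ r * K_samples r \<alpha> f j" for j
      proof -
        have "window_norm \<alpha> f j \<le> (2 powr \<alpha>) ^ j * (2 ^ r * K_functional L r ((1 / 2 ^ r) ^ j) f)"
          unfolding window_norm_def by (rule mult_left_mono[OF window_le_K]) simp
        then show ?thesis by (simp only: K_samples_def mult.left_commute)
      qed
      moreover have "lq_le q (\<lambda>j. 2 ^ r * K_samples r \<alpha> f j) (2 ^ r * M)"
        by (rule lq_le_scale[OF K_samples_nonneg _ M le]) simp
      ultimately show "lq_le q (window_norm \<alpha> f) (2 ^ r * M)"
        using lq_le_mono[of "window_norm \<alpha> f" "\<lambda>j. 2 ^ r * K_samples r \<alpha> f j" q "2 ^ r * M"] q window_norm_nonneg by blast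
    qed simp
    also have "lq_norm q (K_samples r \<alpha> f) \<le> ennreal c * besov_norm L r \<alpha> q f"
      using interpolation_sample.sample_le[OF K_sample[OF \<alpha> r] q, of f]
      by (simp only: K_samples_eq[OF \<alpha> r] besov_norm_interpolation c_def)
    finally show ?thesis using c by (simp add: ennreal_mult mult.assoc mult_left_mono)
  qed
  then show ?thesis using c by (intro exI[of _ "2 ^ r * c"]) auto
qed

text \<open>The tails obey a backward recursion with ratio \<open>2\<^sup>-\<^sup>\<alpha>\<close> and the low-frequency parts a
  forward one with ratio \<open>2\<^sup>\<alpha>\<^sup>-\<^sup>r\<close>, which is where \<open>0 < \<alpha> < r\<close> enters.\<close>

lemma besov_le_window:
  assumes q: "1 \<le> q" and \<alpha>: "0 < \<alpha>" and r: "\<alpha> < real r"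
  shows "\<exists>c>0. \<forall>f. besov_norm L r \<alpha> q f \<le> ennreal c * lq_norm q (window_norm \<alpha> f)"
proof -
  have r0: "0 < r" using \<alpha> r by (cases r) auto
  define \<beta> where "\<beta> = 2 powr \<alpha>"
  define \<kappa> where "\<kappa> = \<beta> / 2 ^ r"
  define C where "C = 5 powr (real r / 2)"
  have C: "0 < C" by (simp add: C_def)
  have \<beta>: "1 < \<beta>" using \<alpha> by (simp add: \<beta>_def gr_one_powr)
  have "\<beta> < 2 powr real r" unfolding \<beta>_def using r by (intro powr_less_mono) auto
  then have "\<beta> < 2 ^ r" by (simp add: powr_realpow)
  then have \<kappa>: "0 < \<kappa>" "\<kappa> < 1" using \<beta> by (auto simp: \<kappa>_def)
  define c1 where "c1 = 1 / (1 - 1 / \<beta>)"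
  define c2 where "c2 = 1 / (1 - \<kappa>) * C"
  have c1: "0 < c1" and c2: "0 < c2" using \<beta> \<kappa> C by (auto simp: c1_def c2_def)
  define c3 where "c3 = 4 * (c1 + 2 * c2)"
  have c3: "0 < c3" using c1 c2 by (simp add: c3_def)
  define c4 where "c4 = sample_const (2 ^ r) (2 powr \<alpha>) q"
  have c4: "0 < c4" using interpolation_sample.le_sample[OF K_sample[OF \<alpha> r0] q] unfolding c4_def by blast
  have "besov_norm L r \<alpha> q f \<le> ennreal (c4 * c3) * lq_norm q (window_norm \<alpha> f)" for f
  proof -
    have "besov_norm L r \<alpha> q f \<le> ennreal c4 * lq_norm q (K_samples r \<alpha> f)"
      using interpolation_sample.le_sample[OF K_sample[OF \<alpha> r0] q, of f]
      unfolding K_samples_eq[OF \<alpha> r0] besov_norm_interpolation c4_def by blast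
    also have "lq_norm q (K_samples r \<alpha> f) \<le> ennreal c3 * lq_norm q (window_norm \<alpha> f)"
    proof (rule lq_norm_transfer[OF q window_norm_nonneg K_samples_nonneg c3])
      fix M :: real assume M: "0 \<le> M" and le: "lq_le q (window_norm \<alpha> f) M"
      have le': "lq_le q (\<lambda>j. \<beta> ^ j * norm (spec (F j) f)) M"
        using le by (simp only: window_norm_def[abs_def] \<beta>_def)
      have t: "lq_le q (\<lambda>j. \<beta> ^ j * tail f j) (c1 * M)"
        unfolding c1_def
        by (rule lq_le_backward[OF q _ _ \<beta> M tail_Suc tail_lim le']) (simp_all add: tail_def)
      have low0: "0 \<le> low r f j" for j by (simp add: low_def)
      have l: "lq_le q (\<lambda>j. \<beta> ^ j * low r f j) (1 / (1 - \<kappa>) * (C * M))"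
      proof (rule lq_le_forward[OF q _ _ \<kappa>])
        show "lq_le q (\<lambda>j. C * (\<beta> ^ j * norm (spec (F j) f))) (C * M)"
          by (rule lq_le_scale[OF _ _ M le']) (use \<beta> C in auto)
        show "\<beta> ^ 0 * low r f 0 \<le> C * (\<beta> ^ 0 * norm (spec (F 0) f))"
          using low_0[of r f] by (simp add: C_def)
        show "\<beta> ^ Suc j * low r f (Suc j) \<le> \<kappa> * (\<beta> ^ j * low r f j) + C * (\<beta> ^ Suc j * norm (spec (F (Suc j)) f))" for j
        proof -
          have "\<beta> ^ Suc j * low r f (Suc j) \<le> \<beta> ^ Suc j * (1 / 2 ^ r * low r f j + C * norm (spec (F (Suc j)) f))"
            using low_Suc[of r f j] \<beta> unfolding C_def by (intro mult_left_mono) auto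
          also have "\<dots> = \<kappa> * (\<beta> ^ j * low r f j) + C * (\<beta> ^ Suc j * norm (spec (F (Suc j)) f))"
            by (simp add: \<kappa>_def distrib_left mult_ac)
          finally show ?thesis .
        qed
      qed (use \<beta> C M low0 in auto)
      have l2: "lq_le q (\<lambda>j. 2 * (\<beta> ^ j * low r f j)) (2 * (c2 * M))"
      proof (rule lq_le_scale)
        show "lq_le q (\<lambda>j. \<beta> ^ j * low r f j) (c2 * M)" using l unfolding c2_def mult.assoc .
      qed (use \<beta> c2 M low0 in auto)
      have sum: "lq_le q (\<lambda>j. \<beta> ^ j * tail f j + 2 * (\<beta> ^ j * low r f j)) (4 * (c1 * M + 2 * (c2 * M)))"
        by (rule lq_le_add[OF q _ _ _ _ t l2]) (use \<beta> c1 c2 M low0 in \<open>auto simp: tail_def\<close>)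
      have le2: "K_samples r \<alpha> f j \<le> \<beta> ^ j * tail f j + 2 * (\<beta> ^ j * low r f j)" for j
      proof -
        have "K_samples r \<alpha> f j \<le> \<beta> ^ j * (tail f j + 2 * low r f j)"
          unfolding K_samples_def \<beta>_def by (rule mult_left_mono[OF K_le_tail_low]) simp
        then show ?thesis by (simp only: distrib_left mult.left_commute)
      qed
      have "lq_le q (K_samples r \<alpha> f) (4 * (c1 * M + 2 * (c2 * M)))"
        by (rule lq_le_mono[OF K_samples_nonneg le2 q sum])
      moreover have "4 * (c1 * M + 2 * (c2 * M)) = c3 * M" by (simp add: c3_def algebra_simps)
      ultimately show "lq_le q (K_samples r \<alpha> f) (c3 * M)" by (simp only:)
    qed
    finally show ?thesis using c3 c4 by (simp add: ennreal_mult mult.assoc mult_left_mono)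
  qed
  then show ?thesis using c3 c4 by (intro exI[of _ "c4 * c3"]) auto
qed

section \<open>Paley--Wiener frames\<close>

text \<open>The function of \<open>x\<close> that \<open>op_powr\<close> integrates.\<close>

definition power_fun :: "real \<Rightarrow> real \<Rightarrow> real" where
  "power_fun s x = (if s = 0 then 1 else x powr s)"

lemma power_fun_measurable [measurable]: "power_fun s \<in> borel_measurable borel"
  unfolding power_fun_def by measurable

lemma smoothness_space_D: "smoothness_space L n = D (power_fun (n / 2))"
  unfolding smoothness_space_def op_powr_def S.dom_spectral_integral power_fun_def[abs_def] ..

lemma app_op_powr: "f \<in> D (power_fun s) \<Longrightarrow> app_op (op_powr L s) f = spec (power_fun s) f"
  using S.app_spectral_integral[OF power_fun_measurable, of f s]
  unfolding op_powr_def power_fun_def[abs_def] by blast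

lemma smoothness_space_antimono:
  assumes "0 \<le> a" "a \<le> b" shows "smoothness_space L b \<subseteq> smoothness_space L a"
proof
  fix f assume "f \<in> smoothness_space L b"
  then have f: "f \<in> D (power_fun (b / 2))" by (simp add: smoothness_space_D)
  have i: "integrable (S.mu f) (\<lambda>x. 1 + (power_fun (b / 2) x)\<^sup>2)"
    using f S.integrable_mu_bounded[of "\<lambda>_. 1" 1 f] by (simp add: S.D_iff)
  have le: "\<bar>power_fun (a / 2) x\<bar> \<le> 1 + \<bar>power_fun (b / 2) x\<bar>" if "0 \<le> x" for x :: real
  proof (cases "a = 0 \<or> x \<le> 1")
    case True
    then have "\<bar>power_fun (a / 2) x\<bar> \<le> 1" using that assms by (auto simp: power_fun_def powr_le1)
    then show ?thesis by simp
  next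
    case False
    then have le: "x powr (a / 2) \<le> x powr (b / 2)" using assms by (intro powr_mono) auto
    have "power_fun (a / 2) x = x powr (a / 2)" "power_fun (b / 2) x = x powr (b / 2)"
      using False assms by (auto simp: power_fun_def)
    moreover have "\<bar>x powr (a / 2)\<bar> = x powr (a / 2)" "\<bar>x powr (b / 2)\<bar> = x powr (b / 2)" by simp_all
    ultimately show ?thesis using le by argo
  qed
  have ae: "AE x in S.mu f. norm ((power_fun (a / 2) x)\<^sup>2) \<le> norm (2 * (1 + (power_fun (b / 2) x)\<^sup>2))"
    using AE_nonneg[of f]
  proof eventually_elim
    case (elim x)
    have "(power_fun (a / 2) x)\<^sup>2 \<le> (1 + \<bar>power_fun (b / 2) x\<bar>)\<^sup>2"
      using power_mono[OF le[OF elim], of 2] by simp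
    also have "\<dots> \<le> 2 * (1 + (power_fun (b / 2) x)\<^sup>2)"
      using sum_squares_bound[of 1 "\<bar>power_fun (b / 2) x\<bar>"] by (simp add: power2_sum)
    finally show ?case by simp
  qed
  have "integrable (S.mu f) (\<lambda>x. (power_fun (a / 2) x)\<^sup>2)"
    by (rule Bochner_Integration.integrable_bound[OF integrable_mult_right[OF i, of 2] _ ae]) simp
  then show "f \<in> smoothness_space L a" by (simp add: smoothness_space_D S.D_iff)
qed

lemma smoothness_space_csubspace: "csubspace (smoothness_space L n)"
  and smoothness_space_dense: "closure (smoothness_space L n) = UNIV"
  by (simp_all add: smoothness_space_D S.D_csubspace S.D_dense)

definition PW_fun :: "real \<Rightarrow> real \<Rightarrow> real" where
  "PW_fun \<omega> x = (if 0 \<le> x then indicator {0..\<omega>} (sqrt x) else 0)"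

lemma PW_fun_measurable [measurable]: "PW_fun \<omega> \<in> borel_measurable borel"
  unfolding PW_fun_def by measurable

lemma D_PW: "f \<in> D (PW_fun \<omega>)"
  by (rule S.D_bounded[of _ 1]) (auto simp: PW_fun_def indicator_def)

lemma PW_projection_spec: "PW_projection L \<omega> f = spec (PW_fun \<omega>) f"
  using S.app_spectral_integral[OF PW_fun_measurable D_PW, of \<omega> f]
  unfolding PW_projection_def fun_sqrt_op_def PW_fun_def[abs_def] by blast

lemma PW_window: "spec (PW_fun (omega j)) (spec (F j) f) = spec (F j) f"
proof -
  have eq: "(\<lambda>x. PW_fun (omega j) x * F j x) = F j"
  proof
    fix x
    show "PW_fun (omega j) x * F j x = F j x"
    proof (cases "0 \<le> x \<and> F j x \<noteq> 0")
      case True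
      then show ?thesis using F_support[of x j] by (simp add: PW_fun_def omega_def)
    next
      case False
      then show ?thesis by (auto simp: F_def)
    qed
  qed
  have "f \<in> D (\<lambda>x. PW_fun (omega j) x * F j x)" unfolding eq by (rule D_F)
  from S.spec_spec[OF F_measurable PW_fun_measurable D_F this] show ?thesis by (simp only: eq)
qed

text \<open>Bernstein's inequality: \<open>x \<le> \<omega>\<^sub>j\<^sup>2\<close> on the support of \<open>F j\<close>.\<close>

lemma window_smooth:
  assumes m: "0 < m"
  shows "spec (F j) f \<in> smoothness_space L m"
    and "norm (app_op (op_powr L (m / 2)) (spec (F j) f)) \<le> omega j powr m * norm (spec (F j) f)"
proof -
  have \<omega>: "0 < omega j" by (simp add: omega_def)
  have le: "\<bar>power_fun (m / 2) x * F j x\<bar> \<le> omega j powr m * \<bar>F j x\<bar>" if x: "0 \<le> x" for x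
  proof (cases "F j x = 0")
    case False
    have "x = (sqrt x)\<^sup>2" using x by simp
    also have "\<dots> \<le> (omega j)\<^sup>2" using F_support[OF x False] x by (intro power_mono) (auto simp: omega_def)
    finally have "x powr (m / 2) \<le> ((omega j)\<^sup>2) powr (m / 2)" using x m by (intro powr_mono2) auto
    also have "\<dots> = (omega j powr 2) powr (m / 2)" using \<omega> by (simp add: powr_numeral)
    also have "\<dots> = omega j powr m" unfolding powr_powr by simp
    finally show ?thesis using m by (simp add: power_fun_def abs_mult mult_right_mono)
  qed simp
  have meas: "(\<lambda>x. power_fun (m / 2) x * F j x) \<in> borel_measurable borel" by measurable
  have c: "0 \<le> omega j powr m" by simp
  note d = spec_dominated[OF meas F_measurable D_F c le]
  have D: "spec (F j) f \<in> D (power_fun (m / 2))"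
    using S.spec_D_iff[OF F_measurable power_fun_measurable D_F] d(1) by blast
  show "spec (F j) f \<in> smoothness_space L m" using D by (simp only: smoothness_space_D)
  have "app_op (op_powr L (m / 2)) (spec (F j) f) = spec (\<lambda>x. power_fun (m / 2) x * F j x) f"
    unfolding app_op_powr[OF D] by (rule S.spec_spec[OF F_measurable power_fun_measurable D_F d(1)])
  then show "norm (app_op (op_powr L (m / 2)) (spec (F j) f)) \<le> omega j powr m * norm (spec (F j) f)"
    using d(2) by (simp only:)
qed

end

lemma riesz_vector_cinner:
  fixes A :: "'h::complex_hilbert_space \<Rightarrow> complex"
  assumes "csubspace V" "closure V = UNIV" "linear_functional_on V A"
    and "\<And>f. f \<in> V \<Longrightarrow> cmod (A f) \<le> M * norm f" and "f \<in> V"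
  shows "cinner f (riesz_vector V A) = A f"
proof -
  obtain u where u: "\<forall>f\<in>V. cinner f u = A f" using Riesz_representation_subspace[OF assms(1,3,4)] by blast
  have "riesz_vector V A = u"
    unfolding riesz_vector_def
    by (rule the_equality) (use u in \<open>auto intro: cinner_eq_dense[OF assms(2)]\<close>)
  then show ?thesis using u assms(5) by simp
qed

lemma rho_props:
  assumes C: "1 \<le> C" and m: "0 < m" and \<delta>: "0 < \<delta>" "\<delta> < 1"
  shows rho_pos: "0 < rho C m \<delta> j" and rho_less_1: "rho C m \<delta> j < 1"
    and rho_powr: "rho C m \<delta> j powr (2 * m) = inverse C * omega j powr (- 2 * m) * \<delta>"
proof -
  define y where "y = inverse C * omega j powr (- 2 * m) * \<delta>"
  have \<omega>: "1 \<le> omega j" unfolding omega_def by (rule one_le_power) simp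
  have y0: "0 < y" using C \<delta> \<omega> by (simp add: y_def)
  have "inverse C * omega j powr (- 2 * m) \<le> 1 * 1"
    using C \<omega> m powr_mono[of "- 2 * m" 0 "omega j"] by (intro mult_mono) (auto simp: inverse_le_1_iff)
  then have "y \<le> 1 * \<delta>" unfolding y_def using \<delta> by (intro mult_right_mono) auto
  then have y1: "y < 1" using \<delta> by simp
  have r: "rho C m \<delta> j = y powr (1 / (2 * m))" by (simp add: rho_def y_def)
  show "0 < rho C m \<delta> j" using y0 by (simp add: r)
  have "y powr (1 / (2 * m)) < 1 powr (1 / (2 * m))" using y0 y1 m by (intro powr_less_mono2) auto
  then show "rho C m \<delta> j < 1" by (simp add: r)
  show "rho C m \<delta> j powr (2 * m) = inverse C * omega j powr (- 2 * m) * \<delta>"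
    unfolding r y_def[symmetric] using m y0 by (simp add: powr_powr)
qed

context littlewood_paley
begin

text \<open>As \<open>F\<^sub>j (\<surd>L) f\<close> is fixed by the Paley--Wiener projection, all operators in the definition of the
  frame vectors move to the other side of the inner product.\<close>

lemma PW_coefficient:
  assumes m: "0 \<le> m0" "m0 < m" and lin: "linear_functional_on (smoothness_space L m0) A"
    and bd: "\<And>h. h \<in> smoothness_space L m \<Longrightarrow> cmod (A h) \<le> M * norm h"
  shows "cinner f (fun_sqrt_op L (dyadic_window g j)
      (PW_projection L (omega j) (riesz_vector (smoothness_space L m) A))) = A (spec (F j) f)"
proof -
  define \<mu> where "\<mu> = riesz_vector (smoothness_space L m) A"
  have "linear_functional_on (smoothness_space L m) A"
    using lin smoothness_space_antimono[of m0 m] m unfolding linear_functional_on_def by (meson less_imp_le subsetD)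
  note riesz = riesz_vector_cinner[OF smoothness_space_csubspace smoothness_space_dense this bd]
  have "cinner f (fun_sqrt_op L (dyadic_window g j) (PW_projection L (omega j) \<mu>)) = cinner f (spec (F j) (spec (PW_fun (omega j)) \<mu>))"
    by (simp only: fun_sqrt_window PW_projection_spec)
  also have "\<dots> = cinner (spec (F j) f) (spec (PW_fun (omega j)) \<mu>)"
    by (rule S.spec_sym[OF F_measurable D_F D_F, symmetric])
  also have "\<dots> = cinner (spec (PW_fun (omega j)) (spec (F j) f)) \<mu>"
    by (rule S.spec_sym[OF PW_fun_measurable D_PW D_PW, symmetric])
  also have "\<dots> = cinner (spec (F j) f) \<mu>" by (simp only: PW_window)
  also have "\<dots> = A (spec (F j) f)"
    unfolding \<mu>_def by (rule riesz) (use window_smooth(1)[of m j f] m in auto)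
  finally show ?thesis by (simp only: \<mu>_def)
qed

end

text \<open>For \<open>a = \<parallel>f\<parallel>\<^sup>2\<close> and \<open>v = \<parallel>L\<^bsup>m/2\<^esup> f\<parallel>\<^sup>2\<close> the assumption is the sampling inequality combined with the upper
  bound on the functionals; letting \<open>\<rho>\<close> tend to \<open>0\<close> in it gives \<open>a \<le> C\<^sup>2 a\<close>.\<close>

lemma sampling_constant_ge_1:
  fixes a v C m :: real
  assumes a: "0 < a" and v: "0 \<le> v" and C: "0 < C" and m: "0 < m"
    and le: "\<And>\<rho>. 0 < \<rho> \<Longrightarrow> \<rho> < 1 \<Longrightarrow> a \<le> C * (C * a + \<rho> powr (2 * m) * v)"
  shows "1 \<le> C"
proof (rule ccontr)
  assume "\<not> 1 \<le> C"
  then have C1: "C < 1" by simp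
  have "C * C < 1 * 1" using C C1 by (intro mult_strict_mono) auto
  then have gap: "0 < (1 - C * C) * a" using a by simp
  \<comment> \<open>the value of \<open>\<rho> powr (2 * m)\<close>, so small that the last term is at most half of the gap\<close>
  define y where "y = min (1 / 2) ((1 - C * C) * a / (2 * (v + 1)))"
  have y: "0 < y" "y < 1" using gap v by (auto simp: y_def)
  define \<rho> where "\<rho> = y powr (1 / (2 * m))"
  have \<rho>y: "\<rho> powr (2 * m) = y" using y m by (simp add: \<rho>_def powr_powr)
  have "\<rho> < 1 powr (1 / (2 * m))" unfolding \<rho>_def using y m by (intro powr_less_mono2) auto
  then have "a \<le> C * (C * a + y * v)" using le[of \<rho>] y \<rho>y by (simp add: \<rho>_def)
  also have "C * (C * a + y * v) = C * C * a + C * (y * v)" by (simp only: distrib_left mult.assoc)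
  finally have 1: "a \<le> C * C * a + C * (y * v)" .
  have 2: "C * (y * v) \<le> 1 * (y * v)" using C1 y v by (intro mult_right_mono) auto
  have "y * v \<le> (1 - C * C) * a / (2 * (v + 1)) * (v + 1)"
    using y v gap by (intro mult_mono) (auto simp: y_def)
  also have "H / (2 * (v + 1)) * (v + 1) = H / 2" for H using v by (simp add: field_simps)
  finally have 3: "y * v \<le> (1 - C * C) * a / 2" .
  have 4: "(1 - C * C) * a = a - C * C * a" by (simp only: left_diff_distrib mult_1)
  have "X \<le> X / 2" if "a \<le> Y + W" "W \<le> 1 * Z" "Z \<le> X / 2" "X = a - Y" for W X Y Z :: real
    using that by argo
  from this[OF 1 2 3 4] have half: "(1 - C * C) * a \<le> (1 - C * C) * a / 2" .
  have "\<not> X \<le> X / 2" if "0 < X" for X :: real using that by simp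
  from this[OF gap] half show False by blast
qed

lemma frame_norm_lq_norm:
  fixes \<Phi> :: "nat \<Rightarrow> 'i \<Rightarrow> 'h::complex_inner"
  assumes q: "1 \<le> q" and b: "\<And>j. (\<Sum>\<^sub>\<infinity>k\<in>K j. ennreal ((cmod (cinner f (\<Phi> j k)))\<^sup>2)) = ennreal ((b j)\<^sup>2)" "\<And>j. 0 \<le> b j"
  shows "frame_norm K \<Phi> \<alpha> q f = lq_norm q (\<lambda>j. (2 powr \<alpha>) ^ j * b j)"
proof -
  have w: "2 powr (real j * \<alpha>) = (2 powr \<alpha>) ^ j" for j
    by (simp add: powr_powr[symmetric] powr_realpow mult.commute[of "real j"])
  have h: "((b j)\<^sup>2) powr (p / 2) = b j powr p" for j p
  proof (cases "b j = 0")
    case False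
    then have "(b j)\<^sup>2 = b j powr 2" using b(2)[of j] by (simp add: powr_numeral)
    then have "((b j)\<^sup>2) powr (p / 2) = (b j powr 2) powr (p / 2)" by (simp only:)
    also have "\<dots> = b j powr p" unfolding powr_powr by simp
    finally show ?thesis .
  qed simp
  show ?thesis
  proof (cases "q = \<infinity>")
    case True
    have "ennreal (2 powr (real j * \<alpha>)) * epowr (ennreal ((b j)\<^sup>2)) (1 / 2) = ennreal ((2 powr \<alpha>) ^ j * b j)" for j
    proof -
      have "epowr (ennreal ((b j)\<^sup>2)) (1 / 2) = ennreal (((b j)\<^sup>2) powr (1 / 2))" by (rule epowr_ennreal) simp
      also have "((b j)\<^sup>2) powr (1 / 2) = b j" using h[of j 1] b(2)[of j] by simp
      finally show ?thesis using b(2)[of j] by (simp only: w ennreal_mult zero_le_power powr_ge_zero)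
    qed
    then show ?thesis using True by (simp only: frame_norm_def lq_norm_def b(1) Let_def if_True simp_thms)
  next
    case False
    define p where "p = enn2real q"
    have "ennreal (2 powr (real j * \<alpha> * p)) * epowr (ennreal ((b j)\<^sup>2)) (p / 2) = ennreal (((2 powr \<alpha>) ^ j * b j) powr p)" for j
    proof -
      have "epowr (ennreal ((b j)\<^sup>2)) (p / 2) = ennreal (((b j)\<^sup>2) powr (p / 2))" by (rule epowr_ennreal) simp
      moreover have "2 powr (real j * \<alpha> * p) = ((2 powr \<alpha>) ^ j) powr p" by (simp only: w[symmetric] powr_powr)
      moreover have "((2 powr \<alpha>) ^ j * b j) powr p = ((2 powr \<alpha>) ^ j) powr p * b j powr p"
        by (rule powr_mult)
      ultimately show ?thesis by (simp only: h ennreal_mult powr_ge_zero)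
    qed
    then show ?thesis using False
      by (simp only: frame_norm_def lq_norm_def b(1) Let_def if_False simp_thms p_def)
  qed
qed

theorem theorem3p19:
  fixes L :: "'h::complex_hilbert_space unbounded_op"
    and K :: "real \<Rightarrow> 'i set"
    and A :: "real \<Rightarrow> 'i \<Rightarrow> 'h \<Rightarrow> complex"
    and g :: "real \<Rightarrow> real"
    and C m0 m \<delta> \<alpha> :: real
    and q :: ennreal
    and r :: nat
  assumes "self_adjoint_op L"
    and "positive_op L"
    and "C > 0"
    and "m0 \<ge> 0"
    and functionals: "\<And>\<rho> k. 0 < \<rho> \<Longrightarrow> \<rho> < 1 \<Longrightarrow> k \<in> K \<rho> \<Longrightarrow>
           linear_functional_on (smoothness_space L m0) (A \<rho> k)"
    and lower: "\<And>\<rho> n f. 0 < \<rho> \<Longrightarrow> \<rho> < 1 \<Longrightarrow> n > m0 \<Longrightarrow> f \<in> smoothness_space L n \<Longrightarrow>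
           ennreal ((norm f)\<^sup>2) \<le> ennreal C *
             ((\<Sum>\<^sub>\<infinity>k\<in>K \<rho>. ennreal ((cmod (A \<rho> k f))\<^sup>2))
               + ennreal (\<rho> powr (2 * n) * (norm (app_op (op_powr L (n / 2)) f))\<^sup>2))"
    and upper: "\<And>\<rho> n f. 0 < \<rho> \<Longrightarrow> \<rho> < 1 \<Longrightarrow> n > m0 \<Longrightarrow> f \<in> smoothness_space L n \<Longrightarrow>
           (\<Sum>\<^sub>\<infinity>k\<in>K \<rho>. ennreal ((cmod (A \<rho> k f))\<^sup>2)) \<le> ennreal (C * (norm f)\<^sup>2)"
    and "m > m0"
    and "0 < \<delta>" and "\<delta> < 1"
    and "cutoff_function g"
    and "\<alpha> > 0"
    and "1 \<le> q"
    and "\<alpha> < real r"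
  shows "\<exists>c1>0. \<exists>c2>0. \<forall>f.
           ennreal c1 * frame_norm (\<lambda>j. K (rho C m \<delta> j)) (PW_vector L A g C m \<delta>) \<alpha> q f
             \<le> besov_norm L r \<alpha> q f \<and>
           besov_norm L r \<alpha> q f
             \<le> ennreal c2 * frame_norm (\<lambda>j. K (rho C m \<delta> j)) (PW_vector L A g C m \<delta>) \<alpha> q f"
proof -
  interpret littlewood_paley L g by unfold_locales fact+
  note C = \<open>C > 0\<close> and q = \<open>1 \<le> q\<close> and \<alpha> = \<open>\<alpha> > 0\<close>
  have m: "0 < m" using \<open>m0 \<ge> 0\<close> \<open>m > m0\<close> by simp
  define \<rho> where "\<rho> j = rho C m \<delta> j" for j
  define \<Phi> where "\<Phi> = PW_vector L A g C m \<delta>"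
  define s where "s f j = (\<Sum>\<^sub>\<infinity>k\<in>K (\<rho> j). ennreal ((cmod (cinner f (\<Phi> j k)))\<^sup>2))" for f j
  define a where "a f j = norm (spec (F j) f)" for f j
  have frame: "s f j \<le> ennreal (C * (a f j)\<^sup>2) \<and> ennreal ((1 - \<delta>) * (a f j)\<^sup>2) \<le> ennreal C * s f j" for f j
    \<comment> \<open>in the zero space \<open>C\<close> may be less than \<open>1\<close>, so \<open>\<rho> j\<close> need not be below \<open>1\<close>, but both sides vanish\<close>
  proof (cases "\<exists>x::'h. x \<noteq> 0")
    case False
    then have "f = 0" "spec (F j) f = 0" by blast+
    then show ?thesis by (simp add: s_def a_def cinner.zero_left)
  next
    case True
    have "1 \<le> C"
    proof -
      obtain x :: 'h where x: "x \<noteq> 0" using True by blast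
      have "\<exists>f\<in>smoothness_space L m. f \<noteq> 0"
      proof (rule ccontr)
        assume "\<not> ?thesis"
        then have "smoothness_space L m \<subseteq> {0}" by blast
        then have "closure (smoothness_space L m) \<subseteq> {0}" by (rule closure_minimal) simp
        then show False using x smoothness_space_dense[of m] by auto
      qed
      then obtain f where f: "f \<in> smoothness_space L m" "f \<noteq> 0" by blast
      show ?thesis
      proof (rule sampling_constant_ge_1[of "(norm f)\<^sup>2" "(norm (app_op (op_powr L (m / 2)) f))\<^sup>2" C m])
        fix \<rho> :: real assume \<rho>: "0 < \<rho>" "\<rho> < 1"
        have "ennreal ((norm f)\<^sup>2) \<le> ennreal C * ((\<Sum>\<^sub>\<infinity>k\<in>K \<rho>. ennreal ((cmod (A \<rho> k f))\<^sup>2))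
               + ennreal (\<rho> powr (2 * m) * (norm (app_op (op_powr L (m / 2)) f))\<^sup>2))"
          by (rule lower[OF \<rho> \<open>m > m0\<close> f(1)])
        also have "\<dots> \<le> ennreal C * (ennreal (C * (norm f)\<^sup>2)
               + ennreal (\<rho> powr (2 * m) * (norm (app_op (op_powr L (m / 2)) f))\<^sup>2))"
          by (intro mult_left_mono add_right_mono upper[OF \<rho> \<open>m > m0\<close> f(1)]) simp
        also have "\<dots> = ennreal (C * (C * (norm f)\<^sup>2 + \<rho> powr (2 * m) * (norm (app_op (op_powr L (m / 2)) f))\<^sup>2))"
          using C by (simp add: ennreal_mult ennreal_plus)
        finally show "(norm f)\<^sup>2 \<le> C * (C * (norm f)\<^sup>2 + \<rho> powr (2 * m) * (norm (app_op (op_powr L (m / 2)) f))\<^sup>2)"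
          using C by (subst (asm) ennreal_le_iff) auto
      qed (use f C m in auto)
    qed
    note \<rho>p = rho_props[OF \<open>1 \<le> C\<close> m \<open>0 < \<delta>\<close> \<open>\<delta> < 1\<close>, of j, folded \<rho>_def]
    define h where "h = spec (F j) f"
    have h: "h \<in> smoothness_space L m" and hL: "norm (app_op (op_powr L (m / 2)) h) \<le> omega j powr m * norm h"
      unfolding h_def using window_smooth[OF m] by blast+
    have coeff: "cinner f (\<Phi> j k) = A (\<rho> j) k h" if k: "k \<in> K (\<rho> j)" for k
    proof -
      have "cmod (A (\<rho> j) k x) \<le> sqrt C * norm x" if x: "x \<in> smoothness_space L m" for x
      proof -
        have "ennreal ((cmod (A (\<rho> j) k x))\<^sup>2) = (\<Sum>\<^sub>\<infinity>k\<in>{k}. ennreal ((cmod (A (\<rho> j) k x))\<^sup>2))" by simp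
        also have "\<dots> \<le> (\<Sum>\<^sub>\<infinity>k\<in>K (\<rho> j). ennreal ((cmod (A (\<rho> j) k x))\<^sup>2))"
          by (rule infsum_mono_neutral) (use k in \<open>auto intro!: nonneg_summable_on_complete\<close>)
        also have "\<dots> \<le> ennreal (C * (norm x)\<^sup>2)" by (rule upper[OF \<rho>p(1,2) \<open>m > m0\<close> x])
        finally have "(cmod (A (\<rho> j) k x))\<^sup>2 \<le> C * (norm x)\<^sup>2" using C by (subst (asm) ennreal_le_iff) auto
        then have "sqrt ((cmod (A (\<rho> j) k x))\<^sup>2) \<le> sqrt (C * (norm x)\<^sup>2)" by (rule real_sqrt_le_mono)
        then show ?thesis by (simp add: real_sqrt_mult)
      qed
      from PW_coefficient[OF \<open>m0 \<ge> 0\<close> \<open>m > m0\<close> functionals[OF \<rho>p(1,2) k] this, of f j]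
      show ?thesis unfolding \<Phi>_def PW_vector_def Let_def \<rho>_def h_def .
    qed
    have s: "s f j = (\<Sum>\<^sub>\<infinity>k\<in>K (\<rho> j). ennreal ((cmod (A (\<rho> j) k h))\<^sup>2))"
      unfolding s_def by (rule infsum_cong) (simp only: coeff)
    have up: "s f j \<le> ennreal (C * (a f j)\<^sup>2)"
      unfolding s a_def h_def[symmetric] by (rule upper[OF \<rho>p(1,2) \<open>m > m0\<close> h])
    then obtain t where t: "s f j = ennreal t" "0 \<le> t" by (cases "s f j") (auto simp: top_unique)
    have "ennreal ((a f j)\<^sup>2) \<le> ennreal C * (s f j + ennreal (\<rho> j powr (2 * m) * (norm (app_op (op_powr L (m / 2)) h))\<^sup>2))"
      unfolding s a_def h_def[symmetric] by (rule lower[OF \<rho>p(1,2) \<open>m > m0\<close> h])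
    also have "\<dots> = ennreal (C * (t + \<rho> j powr (2 * m) * (norm (app_op (op_powr L (m / 2)) h))\<^sup>2))"
      using C t by (simp add: ennreal_mult ennreal_plus)
    finally have "(a f j)\<^sup>2 \<le> C * (t + \<rho> j powr (2 * m) * (norm (app_op (op_powr L (m / 2)) h))\<^sup>2)"
      using C t by (subst (asm) ennreal_le_iff) auto
    also have "\<dots> = C * t + C * \<rho> j powr (2 * m) * (norm (app_op (op_powr L (m / 2)) h))\<^sup>2" by (simp add: distrib_left mult.assoc)
    also have "\<dots> \<le> C * t + C * \<rho> j powr (2 * m) * (omega j powr m * a f j)\<^sup>2"
      using power_mono[OF hL, of 2] C unfolding a_def h_def[symmetric] by (intro add_left_mono mult_left_mono) auto
    \<comment> \<open>the choice of \<open>\<rho> j\<close> makes this term absorbable\<close>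
    also have "C * \<rho> j powr (2 * m) * (omega j powr m * a f j)\<^sup>2 = \<delta> * (a f j)\<^sup>2"
    proof -
      have "0 < omega j" by (simp add: omega_def)
      then have "omega j powr (- 2 * m) * (omega j powr m)\<^sup>2 = 1"
        by (simp add: power2_eq_square powr_add[symmetric])
      moreover have "C * \<rho> j powr (2 * m) = omega j powr (- 2 * m) * \<delta>"
        unfolding \<rho>p(3) using C by simp
      ultimately show ?thesis by (simp add: power_mult_distrib mult_ac)
    qed
    finally have "(1 - \<delta>) * (a f j)\<^sup>2 \<le> C * t" by (simp add: left_diff_distrib)
    then have "ennreal ((1 - \<delta>) * (a f j)\<^sup>2) \<le> ennreal C * s f j"
      using C t by (simp add: ennreal_mult[symmetric] ennreal_leI)
    with up show ?thesis ..
  qed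
  define b where "b f j = sqrt (enn2real (s f j))" for f j
  have b0: "0 \<le> b f j" for f j by (simp add: b_def)
  have sb: "s f j = ennreal ((b f j)\<^sup>2)" for f j
  proof -
    have "s f j < \<infinity>" using frame[of f j] by (auto intro: le_less_trans)
    then show ?thesis by (simp add: b_def)
  qed
  define w where "w f j = (2 powr \<alpha>) ^ j * b f j" for f j
  have w0: "0 \<le> w f j" for f j by (simp add: w_def b0)
  have fn: "frame_norm (\<lambda>j. K (rho C m \<delta> j)) (PW_vector L A g C m \<delta>) \<alpha> q f = lq_norm q (w f)" for f
    unfolding w_def[abs_def]
    by (rule frame_norm_lq_norm[OF q]) (use sb b0 in \<open>auto simp: s_def \<rho>_def \<Phi>_def\<close>)
  define B where "B = sqrt (C / (1 - \<delta>))"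
  have B: "0 < B" using C \<open>\<delta> < 1\<close> by (simp add: B_def)
  have ba: "b f j \<le> sqrt C * a f j" for f j
  proof -
    have "(b f j)\<^sup>2 \<le> C * (a f j)\<^sup>2" using frame[of f j] C unfolding sb by (subst (asm) ennreal_le_iff) auto
    then have "sqrt ((b f j)\<^sup>2) \<le> sqrt (C * (a f j)\<^sup>2)" by (rule real_sqrt_le_mono)
    then show ?thesis using b0[of f j] by (simp add: real_sqrt_mult a_def)
  qed
  have ab: "a f j \<le> B * b f j" for f j
  proof -
    have "ennreal ((1 - \<delta>) * (a f j)\<^sup>2) \<le> ennreal (C * (b f j)\<^sup>2)" using frame[of f j] C unfolding sb by (simp add: ennreal_mult)
    then have "(1 - \<delta>) * (a f j)\<^sup>2 \<le> C * (b f j)\<^sup>2" using C by (subst (asm) ennreal_le_iff) auto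
    then have "(a f j)\<^sup>2 \<le> C / (1 - \<delta>) * (b f j)\<^sup>2" using \<open>\<delta> < 1\<close> by (simp add: field_simps)
    then have "sqrt ((a f j)\<^sup>2) \<le> sqrt (C / (1 - \<delta>) * (b f j)\<^sup>2)" by (rule real_sqrt_le_mono)
    then show ?thesis using b0[of f j] unfolding B_def real_sqrt_mult by (simp add: a_def)
  qed
  have fw: "lq_norm q (w f) \<le> ennreal (sqrt C) * lq_norm q (window_norm \<alpha> f)" for f
  proof (rule lq_norm_transfer[OF q window_norm_nonneg w0])
    fix M :: real assume M: "0 \<le> M" and le: "lq_le q (window_norm \<alpha> f) M"
    have "w f j \<le> sqrt C * window_norm \<alpha> f j" for j
      using mult_left_mono[OF ba[of f j], of "(2 powr \<alpha>) ^ j"] unfolding w_def window_norm_def a_def by (simp only: mult.left_commute zero_le_power powr_ge_zero)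
    moreover have "lq_le q (\<lambda>j. sqrt C * window_norm \<alpha> f j) (sqrt C * M)"
      by (rule lq_le_scale[OF window_norm_nonneg _ M le]) (use C in simp)
    ultimately show "lq_le q (w f) (sqrt C * M)" by (intro lq_le_mono[OF w0 _ q])
  qed (use C in simp)
  have wf: "lq_norm q (window_norm \<alpha> f) \<le> ennreal B * lq_norm q (w f)" for f
  proof (rule lq_norm_transfer[OF q w0 window_norm_nonneg B])
    fix M :: real assume M: "0 \<le> M" and le: "lq_le q (w f) M"
    have "window_norm \<alpha> f j \<le> B * w f j" for j
      using mult_left_mono[OF ab[of f j], of "(2 powr \<alpha>) ^ j"] unfolding w_def window_norm_def a_def by (simp only: mult.left_commute zero_le_power powr_ge_zero)
    moreover have "lq_le q (\<lambda>j. B * w f j) (B * M)"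
      by (rule lq_le_scale[OF w0 _ M le]) (use B in simp)
    ultimately show "lq_le q (window_norm \<alpha> f) (B * M)" by (intro lq_le_mono[OF window_norm_nonneg _ q])
  qed
  have "0 < r" using \<alpha> \<open>\<alpha> < real r\<close> by (cases r) auto
  from window_le_besov[OF q \<alpha> this] obtain d1 where d1: "0 < d1"
    and le1: "\<And>f. lq_norm q (window_norm \<alpha> f) \<le> ennreal d1 * besov_norm L r \<alpha> q f" by blast
  from besov_le_window[OF q \<alpha> \<open>\<alpha> < real r\<close>] obtain d2 where d2: "0 < d2"
    and le2: "\<And>f. besov_norm L r \<alpha> q f \<le> ennreal d2 * lq_norm q (window_norm \<alpha> f)" by blast
  have sC: "0 < sqrt C" using C by simp
  define c1 where "c1 = 1 / (sqrt C * d1)"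
  have c1: "0 < c1" using sC d1 by (simp add: c1_def)
  have "ennreal c1 * lq_norm q (w f) \<le> besov_norm L r \<alpha> q f" for f
  proof -
    have "lq_norm q (w f) \<le> ennreal (sqrt C) * (ennreal d1 * besov_norm L r \<alpha> q f)"
      using fw[of f] by (rule order_trans) (intro mult_left_mono le1 zero_le)
    also have "\<dots> = ennreal (sqrt C * d1) * besov_norm L r \<alpha> q f"
      using sC d1 by (simp add: ennreal_mult mult.assoc)
    finally have "ennreal c1 * lq_norm q (w f) \<le> ennreal c1 * (ennreal (sqrt C * d1) * besov_norm L r \<alpha> q f)"
      by (rule mult_left_mono) simp
    also have "\<dots> = ennreal (c1 * (sqrt C * d1)) * besov_norm L r \<alpha> q f"
      using sC d1 c1 by (simp add: ennreal_mult mult.assoc)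
    also have "c1 * (sqrt C * d1) = 1" using sC d1 by (simp add: c1_def)
    finally show ?thesis by simp
  qed
  moreover have "besov_norm L r \<alpha> q f \<le> ennreal (d2 * B) * lq_norm q (w f)" for f
  proof -
    have "besov_norm L r \<alpha> q f \<le> ennreal d2 * (ennreal B * lq_norm q (w f))"
      using le2[of f] by (rule order_trans) (intro mult_left_mono wf zero_le)
    then show ?thesis using d2 B by (simp add: ennreal_mult mult.assoc)
  qed
  ultimately show ?thesis
    unfolding fn using c1 d2 B by (intro exI[of _ c1] exI[of _ "d2 * B"] conjI allI) auto
qed

end
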